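(* Let $X$ be the Cantor space and let $\Gamma$ be an ample subgroup of $\mathrm{Homeo}(X)$ acting minimally on $X$. Let $K=K_1\sqcup\sigma(K_1)$ be a closed subset of $X$ without isolated points, where $K_1$ is closed and $\sigma\in\mathrm{Homeo}(K)$ is an involution. Assume that $K$ is $\Gamma$-sparse. Denote by $R_{\Gamma,K}$ the finest equivalence relation on $X$ which is coarser than $R_\Gamma$ and for which $k$ and $\sigma(k)$ are equivalent for all $k\in K$. Then there exists an ample group $\Sigma\le\mathrm{Homeo}(X)$ whose action on $X$ induces $R_{\Gamma,K}$; furthermore, $\Sigma$ and $\Gamma$ are orbit equivalent.
   Context: $\mathrm{Homeo}(X)$ is the group of homeomorphisms of $X$. A subgroup $\Gamma\le\mathrm{Homeo}(X)$ is a full group if it contains every $g\in\mathrm{Homeo}(X)$ for which there is a finite $A\subset\Gamma$ such that for all $x\in X$ there is $\gamma\in A$ with $g(x)=\gamma(x)$. $\Gamma$ is ample if it is a countable, locally finite, full group such that $\{x\in X\colon\gamma(x)=x\}$ is clopen for every $\gamma\in\Gamma$. It acts minimally if all its orbits in $X$ are dense. $R_\Gamma$ is the orbit equivalence relation of $\Gamma$ on $X$: $xR_\Gamma y$ iff $\gamma(x)=y$ for some $\gamma\in\Gamma$; a group $\Sigma$ induces a relation $R$ if $R=R_\Sigma$. A closed set $K\subseteq X$ is $\Gamma$-sparse if each $\Gamma$-orbit intersects $K$ in at most one point. $\sqcup$ denotes disjoint union. $\Gamma$ and $\Sigma$ are orbit equivalent if there is $g\in\mathrm{Homeo}(X)$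 such that for all $x,x'\in X$: $xR_\Gamma x'$ iff $g(x)R_\Sigma g(x')$. *)

theory Defs
  imports "HOL-Analysis.Analysis" "HOL-Algebra.Generated_Groups"
begin

(* The ambient space X is the whole type 'a.  For a proper subset S, only the values of
   f on S matter for membership in Homeo S. *)

definition Homeo :: "'a::topological_space set \<Rightarrow> ('a \<Rightarrow> 'a) set" where
  "Homeo S = {f. \<exists>g. homeomorphism S S f g}"

definition homeo_group :: "('a::topological_space \<Rightarrow> 'a) monoid" where
  "homeo_group = \<lparr>carrier = Homeo UNIV, mult = (\<circ>), one = id\<rparr>"

lemma group_homeo_group: "group (homeo_group :: ('a::topological_space \<Rightarrow> 'a) monoid)"
proof (rule groupI)
  fix f g :: "'a \<Rightarrow> 'a"
  assume "f \<in> carrier homeo_group" "g \<in> carrier homeo_group"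
  then show "f \<otimes>\<^bsub>homeo_group\<^esub> g \<in> carrier homeo_group"
    using homeomorphism_compose by (fastforce simp: homeo_group_def Homeo_def)
next
  show "\<one>\<^bsub>homeo_group\<^esub> \<in> carrier (homeo_group :: ('a \<Rightarrow> 'a) monoid)"
    using homeomorphism_ident[of "UNIV :: 'a set"]
    by (auto simp: homeo_group_def Homeo_def id_def)
next
  fix f :: "'a \<Rightarrow> 'a"
  assume "f \<in> carrier homeo_group"
  then obtain g where g: "homeomorphism UNIV UNIV f g"
    by (auto simp: homeo_group_def Homeo_def)
  then have "g \<in> Homeo UNIV" "g \<circ> f = id"
    by (auto simp: Homeo_def homeomorphism_def fun_eq_iff)
  then show "\<exists>h\<in>carrier homeo_group. h \<otimes>\<^bsub>homeo_group\<^esub> f = \<one>\<^bsub>homeo_group\<^esub>"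
    by (auto simp: homeo_group_def)
qed (auto simp: homeo_group_def fun_eq_iff)

definition full_group :: "('a::topological_space \<Rightarrow> 'a) set \<Rightarrow> bool" where
  "full_group \<Gamma> \<longleftrightarrow> subgroup \<Gamma> homeo_group \<and>
     (\<forall>g\<in>Homeo UNIV. (\<exists>A. finite A \<and> A \<subseteq> \<Gamma> \<and> (\<forall>x. \<exists>\<gamma>\<in>A. g x = \<gamma> x)) \<longrightarrow> g \<in> \<Gamma>)"

definition locally_finite_group :: "('a, 'b) monoid_scheme \<Rightarrow> 'a set \<Rightarrow> bool" where
  "locally_finite_group G H \<longleftrightarrow>
     subgroup H G \<and> (\<forall>A. finite A \<and> A \<subseteq> H \<longrightarrow> finite (generate G A))"

definition ample :: "('a::topological_space \<Rightarrow> 'a) set \<Rightarrow> bool" where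
  "ample \<Gamma> \<longleftrightarrow> countable \<Gamma> \<and> locally_finite_group homeo_group \<Gamma> \<and> full_group \<Gamma> \<and>
     (\<forall>\<gamma>\<in>\<Gamma>. open {x. \<gamma> x = x} \<and> closed {x. \<gamma> x = x})"

definition orbit_of :: "('a \<Rightarrow> 'a) set \<Rightarrow> 'a \<Rightarrow> 'a set" where
  "orbit_of \<Gamma> x = {\<gamma> x | \<gamma>. \<gamma> \<in> \<Gamma>}"

definition orbit_rel :: "('a \<Rightarrow> 'a) set \<Rightarrow> ('a \<times> 'a) set" where
  "orbit_rel \<Gamma> = {(x, y). \<exists>\<gamma>\<in>\<Gamma>. \<gamma> x = y}"

definition acts_minimally :: "('a::topological_space \<Rightarrow> 'a) set \<Rightarrow> bool" where
  "acts_minimally \<Gamma> \<longleftrightarrow> (\<forall>x. closure (orbit_of \<Gamma> x) = UNIV)"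

definition orbit_sparse :: "('a::topological_space \<Rightarrow> 'a) set \<Rightarrow> 'a set \<Rightarrow> bool" where
  "orbit_sparse \<Gamma> K \<longleftrightarrow> closed K \<and>
     (\<forall>x. \<forall>k\<in>orbit_of \<Gamma> x \<inter> K. \<forall>k'\<in>orbit_of \<Gamma> x \<inter> K. k = k')"

(* Finest means smallest as a set of pairs; coarser means containing. *)

definition joined_rel :: "('a \<Rightarrow> 'a) set \<Rightarrow> 'a set \<Rightarrow> ('a \<Rightarrow> 'a) \<Rightarrow> ('a \<times> 'a) set" where
  "joined_rel \<Gamma> K \<sigma> =
     \<Inter>{E. equiv UNIV E \<and> orbit_rel \<Gamma> \<subseteq> E \<and> (\<forall>k\<in>K. (k, \<sigma> k) \<in> E)}"

lemma joined_rel_finest: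
  shows "equiv UNIV (joined_rel \<Gamma> K \<sigma>)"
    and "orbit_rel \<Gamma> \<subseteq> joined_rel \<Gamma> K \<sigma>"
    and "k \<in> K \<Longrightarrow> (k, \<sigma> k) \<in> joined_rel \<Gamma> K \<sigma>"
    and "\<lbrakk>equiv UNIV E; orbit_rel \<Gamma> \<subseteq> E; \<And>k. k \<in> K \<Longrightarrow> (k, \<sigma> k) \<in> E\<rbrakk> \<Longrightarrow> joined_rel \<Gamma> K \<sigma> \<subseteq> E"
proof -
  show "equiv UNIV (joined_rel \<Gamma> K \<sigma>)"
  proof (rule equivI)
    show "refl (joined_rel \<Gamma> K \<sigma>)"
      unfolding joined_rel_def by (rule refl_onI) (auto simp: equiv_def dest: refl_onD)
    show "sym (joined_rel \<Gamma> K \<sigma>)"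
      unfolding joined_rel_def by (rule symI) (auto simp: equiv_def dest: symD)
    show "trans (joined_rel \<Gamma> K \<sigma>)"
      unfolding joined_rel_def by (rule transI) (auto simp: equiv_def, meson transD)
  qed simp
qed (auto simp: joined_rel_def)

definition orbit_equivalent ::
  "('a::topological_space \<Rightarrow> 'a) set \<Rightarrow> ('a \<Rightarrow> 'a) set \<Rightarrow> bool" where
  "orbit_equivalent \<Gamma> \<Sigma> \<longleftrightarrow>
     (\<exists>g\<in>Homeo UNIV. \<forall>x x'. (x, x') \<in> orbit_rel \<Gamma> \<longleftrightarrow> (g x, g x') \<in> orbit_rel \<Sigma>)"

end

theory Submission
  imports Defs
begin

text \<open>
  The argument is a Hilbert hotel. For a sparse closed set $L$ and a fixed $\tau \in \Gamma$ without
  fixed points in $L$, every orbit through a point $l \in L$ is split into two dense halves, one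
  containing $l$ and the other $\tau(l)$, in such a way that the smaller relation is still induced
  by an ample group $\Delta \le \Gamma$ acting minimally. Thus $R_\Gamma$ is obtained from $R_\Delta$ by
  joining $l$ to $\tau(l)$ for $l \in L$, and $R_{\Gamma,K}$ by joining in addition $k$ to $\sigma(k)$
  for $k \in K$. If $L$ is chosen as a compactified sequence of copies of $K_1$, there is a homeomorphism
  of $K \sqcup L \sqcup \tau(L)$ onto $L \sqcup \tau(L)$ which carries $\sigma \sqcup \tau$ to $\tau$.
  Both sets are $\Delta$-sparse, so by a strengthening of Krieger's theorem the homeomorphism extends
  to some $g \in \mathrm{Homeo}(X)$ normalizing $\Delta$. Then $g$ carries $R_{\Gamma,K}$ onto
  $R_\Gamma$, and $\Sigma = g^{-1} \Gamma g$ is the required group.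
\<close>

section \<open>Cantor space\<close>

text \<open>A point l of L and its image \<tau>(l) share a \<Gamma>-orbit, so K, L and \<tau>(L)
  together are not \<Gamma>-sparse and an extension theorem for \<Gamma> cannot treat them. Passing
  to \<Delta> cuts exactly these coincidences. Only K1 has to be absorbed: once K1 and L are mapped
  onto L, the values on \<sigma>(K1) and \<tau>(L) are forced by the demand that pairs go to pairs.

  Extension theorems of this kind usually have to compare clopen sets under the action. Here both
  sides carry the same group, so the construction can start at the identity and compose it with
  involutions taken from the group itself. Minimality lets the orbit of g x come close to h x, and
  sparseness ensures that moving g x puts no second condition on the same orbit. Later involutions
  are made to commute with the finite subgroups already treated. The limit need not lie in the
  group, but on each of those subgroups it conjugates as some group element does, and therefore it
  normalizes the group.\<close>

definition clopen :: "'a::topological_space set \<Rightarrow> bool" where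
  "clopen S \<longleftrightarrow> open S \<and> closed S"

lemma clopen_empty [simp]: "clopen {}"
  and clopen_UNIV [simp]: "clopen UNIV"
  by (auto simp: clopen_def)

lemma clopen_Int: "clopen A \<Longrightarrow> clopen B \<Longrightarrow> clopen (A \<inter> B)"
  and clopen_Un: "clopen A \<Longrightarrow> clopen B \<Longrightarrow> clopen (A \<union> B)"
  and clopen_Diff: "clopen A \<Longrightarrow> clopen B \<Longrightarrow> clopen (A - B)"
  and clopen_Compl: "clopen A \<Longrightarrow> clopen (- A)"
  by (auto simp: clopen_def)

lemma clopen_UN: "finite I \<Longrightarrow> (\<And>i. i \<in> I \<Longrightarrow> clopen (A i)) \<Longrightarrow> clopen (\<Union>i\<in>I. A i)"
  and clopen_INT: "finite I \<Longrightarrow> (\<And>i. i \<in> I \<Longrightarrow> clopen (A i)) \<Longrightarrow> clopen (\<Inter>i\<in>I. A i)"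
  by (auto simp: clopen_def)

lemma clopen_vimage: "continuous_on UNIV f \<Longrightarrow> clopen A \<Longrightarrow> clopen (f -` A)"
  by (simp add: clopen_def open_vimage closed_vimage)

lemma clopen_Collect_eq:
  assumes "clopen {x. P x}" "clopen {x. Q x}"
  shows "clopen {x. P x \<longleftrightarrow> Q x}"
proof -
  have "{x. P x \<longleftrightarrow> Q x} = ({x. P x} \<inter> {x. Q x}) \<union> - ({x. P x} \<union> {x. Q x})"
    by auto
  then show ?thesis
    using assms by (simp add: clopen_Int clopen_Un clopen_Compl del: Compl_Un)
qed

text \<open>Makes a finite clopen cover disjoint: the index inserted last claims its points first,
  so the pieces remain clopen. A group element attached to each index then becomes a locally
  constant choice.\<close>

lemma clopen_choice:
  assumes "finite I" "\<And>i. i \<in> I \<Longrightarrow> clopen (N i)"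
  shows "\<exists>c. (\<forall>y \<in> (\<Union>i\<in>I. N i). c y \<in> I \<and> y \<in> N (c y)) \<and>
             (\<forall>i\<in>I. clopen {y \<in> (\<Union>i\<in>I. N i). c y = i})"
  using assms
proof (induction I rule: finite_induct)
  case (insert a I)
  then obtain c where c: "\<forall>y \<in> (\<Union>i\<in>I. N i). c y \<in> I \<and> y \<in> N (c y)"
      "\<forall>i\<in>I. clopen {y \<in> (\<Union>i\<in>I. N i). c y = i}"
    by auto
  define c' where "c' y = (if y \<in> N a then a else c y)" for y
  have "{y \<in> (\<Union>i\<in>insert a I. N i). c' y = i} =
      (if i = a then N a else {y \<in> (\<Union>i\<in>I. N i). c y = i} - N a)" if "i \<in> insert a I" for i
    using that c(1) insert.hyps by (auto simp: c'_def split: if_splits)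
  moreover have "\<forall>y \<in> (\<Union>i\<in>insert a I. N i). c' y \<in> insert a I \<and> y \<in> N (c' y)"
    using c(1) by (auto simp: c'_def)
  ultimately show ?case
    using c(2) insert.prems by (intro exI[of _ c']) (auto simp: clopen_Diff)
qed auto

section \<open>Binary sequences with the product topology\<close>

lemma compact_UNIV_fun_bool: "compact (UNIV :: (nat \<Rightarrow> bool) set)"
proof -
  have "compact_space (euclidean :: bool topology)"
    by (simp add: compact_space_def compactin_euclidean_iff finite_imp_compact)
  then have "compact_space (product_topology (\<lambda>i::nat. euclidean :: bool topology) UNIV)"
    by (simp add: compact_space_product_topology)
  then show ?thesis
    by (simp add: euclidean_product_topology compact_space_def compactin_euclidean_iff)
qed

lemma open_fun_bool_contains_cylinder:
  fixes a :: "nat \<Rightarrow> bool"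
  assumes "open U" "a \<in> U"
  shows "\<exists>n. \<forall>b. (\<forall>i<n. b i = a i) \<longrightarrow> b \<in> U"
proof -
  have "openin (product_topology (\<lambda>i. euclidean) UNIV) U"
    using assms(1) by (simp add: open_fun_def)
  from product_topology_open_contains_basis[OF this assms(2)] obtain X where
    X: "a \<in> Pi\<^sub>E UNIV X" "finite {i. X i \<noteq> UNIV}" "Pi\<^sub>E UNIV X \<subseteq> U"
    by auto
  from X(2) obtain n where n: "\<forall>i \<in> {i. X i \<noteq> UNIV}. i < n"
    using finite_nat_set_iff_bounded by auto
  have "b \<in> U" if "\<forall>i<n. b i = a i" for b
  proof -
    have "b i \<in> X i" for i
      using X(1) n that by (cases "X i = UNIV") (auto simp: PiE_def Pi_def)
    then show ?thesis using X(3) by auto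
  qed
  then show ?thesis by blast
qed

lemma clopen_coordinate: "clopen {a::nat \<Rightarrow> bool. a i}"
proof -
  have "clopen ((\<lambda>a::nat \<Rightarrow> bool. a i) -` {True})"
    by (rule clopen_vimage) (auto simp: clopen_def open_discrete closed_def)
  moreover have "(\<lambda>a::nat \<Rightarrow> bool. a i) -` {True} = {a. a i}" by auto
  ultimately show ?thesis by simp
qed

lemma continuous_on_into_fun_bool:
  fixes f :: "'a::topological_space \<Rightarrow> nat \<Rightarrow> bool"
  assumes "\<And>i. clopen {x. f x i}"
  shows "continuous_on UNIV f"
proof (rule continuous_on_coordinatewise_then_product)
  fix i
  have "open ((\<lambda>x. f x i) -` B)" for B
  proof -
    have "(\<lambda>x. f x i) -` B = (if True \<in> B then {x. f x i} else {}) \<union> (if False \<in> B then - {x. f x i} else {})"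
    proof (rule Set.set_eqI)
      fix x
      show "x \<in> (\<lambda>x. f x i) -` B \<longleftrightarrow>
          x \<in> (if True \<in> B then {x. f x i} else {}) \<union> (if False \<in> B then - {x. f x i} else {})"
        by (cases "f x i") auto
    qed
    then show ?thesis
      using assms[of i] by (auto simp: clopen_def)
  qed
  then show "continuous_on UNIV (\<lambda>x. f x i)"
    by (simp add: continuous_on_open_vimage)
qed

text \<open>The type carries a topology and nothing else. The coordinates of \<open>e\<close> play
  the part of a metric: separation of points, a clopen base and compactness are all read off from
  them.\<close>

locale cantor_space =
  fixes e :: "'a::topological_space \<Rightarrow> nat \<Rightarrow> bool" and e'
  assumes homeo: "homeomorphism UNIV UNIV e e'"
begin

lemma e_inverse [simp]: "e' (e x) = x" "e (e' a) = a"
  using homeo by (auto simp: homeomorphism_def)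

lemma continuous_e: "continuous_on UNIV e" "continuous_on UNIV e'"
  using homeo by (auto simp: homeomorphism_def)

lemma clopen_e: "clopen {x. e x i}"
  using clopen_vimage[OF continuous_e(1) clopen_coordinate[of i]] by (simp add: vimage_def)

lemma separation: "x = y" if "\<And>i. e x i = e y i"
proof -
  have "e x = e y"
    using that by (rule ext)
  then have "e' (e x) = e' (e y)"
    by (rule arg_cong)
  then show ?thesis
    by (simp only: e_inverse)
qed

lemma continuous_on_UNIV_I:
  assumes "\<And>i. clopen {x. e (f x) i}"
  shows "continuous_on UNIV f"
proof -
  have "continuous_on UNIV (\<lambda>x. e (f x))"
    by (rule continuous_on_into_fun_bool) (rule assms)
  then have "continuous_on UNIV (\<lambda>x. e' (e (f x)))"
    by (rule continuous_on_compose2[OF continuous_e(2)]) auto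
  then show ?thesis by simp
qed

lemma surj_e': "e' ` UNIV = UNIV"
  using homeo by (simp add: homeomorphism_def)

lemma compact_UNIV: "compact (UNIV :: 'a set)"
  using compact_continuous_image[OF continuous_e(2) compact_UNIV_fun_bool]
  unfolding surj_e' .

lemma compact_closed: "closed (S :: 'a set) \<Longrightarrow> compact S"
  using compact_Int_closed[OF compact_UNIV, of S] by simp

definition cyl :: "'a \<Rightarrow> nat \<Rightarrow> 'a set" where
  "cyl x n = {y. \<forall>i<n. e y i = e x i}"

lemma cyl_self [simp]: "x \<in> cyl x n"
  by (simp add: cyl_def)

lemma clopen_cyl: "clopen (cyl x n)"
proof -
  have "cyl x n = (\<Inter>i<n. {y. e y i \<longleftrightarrow> e x i})"
    by (auto simp: cyl_def)
  moreover have "clopen {y. e y i \<longleftrightarrow> e x i}" for i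
    by (rule clopen_Collect_eq[OF clopen_e]) (cases "e x i"; simp)
  ultimately show ?thesis
    by (simp add: clopen_INT)
qed

lemma finite_cyl: "finite (range (\<lambda>x. cyl x n))"
proof -
  have "cyl x n = (\<lambda>J. {y. \<forall>i<n. e y i = (i \<in> J)}) {i. i < n \<and> e x i}" for x
    by (auto simp: cyl_def)
  then have "range (\<lambda>x. cyl x n) \<subseteq> (\<lambda>J. {y. \<forall>i<n. e y i = (i \<in> J)}) ` Pow {..<n}"
    by blast
  then show ?thesis
    by (rule finite_subset) simp
qed

lemma open_contains_cyl:
  assumes "open U" "x \<in> U" shows "\<exists>n. cyl x n \<subseteq> U"
proof -
  have "open (e' -` U)"
    using assms(1) continuous_e(2) by (simp add: open_vimage)
  with open_fun_bool_contains_cylinder[of "e' -` U" "e x"] assms(2)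
  obtain n where n: "\<forall>b. (\<forall>i<n. b i = e x i) \<longrightarrow> e' b \<in> U" by auto
  have "cyl x n \<subseteq> U"
    using n[rule_format, of "e _"] by (auto simp: cyl_def)
  then show ?thesis by blast
qed

lemma cyl_antimono: "m \<le> n \<Longrightarrow> cyl x n \<subseteq> cyl x m"
  by (auto simp: cyl_def)

lemma open_diff_finite_nonempty:
  assumes "open (U :: 'a set)" "U \<noteq> {}" "finite A"
  shows "U - A \<noteq> {}"
proof -
  from assms(2) obtain x where "x \<in> U" by blast
  from open_contains_cyl[OF assms(1) this] obtain n where n: "cyl x n \<subseteq> U" by blast
  \<comment> \<open>After the prefix of length n taken from x, the k-th point has a single
    \<open>True\<close>, at position n + k; this gives infinitely many points in one
    cylinder.\<close>
  let ?f = "\<lambda>k. e' (\<lambda>i. if i < n then e x i else i = n + k)"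
  have "inj ?f"
  proof (rule injI)
    fix k l assume "?f k = ?f l"
    then have "(\<lambda>i. if i < n then e x i else i = n + k) = (\<lambda>i. if i < n then e x i else i = n + l)"
      by (metis (no_types, lifting) e_inverse(2))
    from fun_cong[OF this, of "n + k"] show "k = l" by simp
  qed
  moreover have "range ?f \<subseteq> cyl x n"
    by (auto simp: cyl_def)
  ultimately have "infinite U"
    using n by (meson finite_subset infinite_iff_countable_subset subset_trans)
  then show ?thesis
    using assms(3) by (metis Diff_eq_empty_iff finite_subset)
qed

text \<open>A point y outside S differs from each point of S in some coordinate. Compactness leaves
  finitely many such coordinates, and agreeing with y on all of them defines an open neighbourhood
  of y that misses S.\<close>

lemma compact_closed_iff: "compact (S :: 'a set) \<longleftrightarrow> closed S"
proof
  assume S: "compact S"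
  have "\<exists>T. open T \<and> y \<in> T \<and> T \<subseteq> - S" if y: "y \<in> - S" for y
  proof -
    have "S \<subseteq> (\<Union>i. {x. e x i \<noteq> e y i})"
    proof
      fix x assume "x \<in> S"
      with y have "x \<noteq> y" by blast
      then show "x \<in> (\<Union>i. {x. e x i \<noteq> e y i})"
        using separation[of x y] by blast
    qed
    moreover have o: "open {x. e x i \<noteq> e y i}" "open {x. e x i = e y i}" for i
    proof -
      have c: "clopen {x. e x i \<longleftrightarrow> e y i}"
        by (rule clopen_Collect_eq[OF clopen_e]) (cases "e y i"; simp)
      then show "open {x. e x i = e y i}"
        by (simp only: clopen_def)
      have "{x. e x i \<noteq> e y i} = - {x. e x i \<longleftrightarrow> e y i}" by blast
      then show "open {x. e x i \<noteq> e y i}"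
        using clopen_Compl[OF c] by (simp only: clopen_def)
    qed
    ultimately obtain I where I: "finite I" "S \<subseteq> (\<Union>i\<in>I. {x. e x i \<noteq> e y i})"
      using compactE_image[OF S, of UNIV "\<lambda>i. {x. e x i \<noteq> e y i}" thesis] by blast
    have "open (\<Inter>i\<in>I. {x. e x i = e y i})"
      using I(1) o(2) by auto
    then show ?thesis
      using I(2) by (intro exI[of _ "\<Inter>i\<in>I. {x. e x i = e y i}"]) auto
  qed
  then show "closed S"
    unfolding closed_def by (subst open_subopen) (rule ballI)
qed (rule compact_closed)

text \<open>Relatively closed subsets of S are compact, so their images are closed; that is
  continuity of the inverse. The domain type is arbitrary because the lemma is applied to binary
  sequences as well as to the space itself.\<close>

lemma compact_homeomorphism:
  fixes f :: "'b::topological_space \<Rightarrow> 'a"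
  assumes S: "compact S" and f: "continuous_on S f" "inj_on f S"
  shows "\<exists>g. homeomorphism S (f ` S) f g"
proof -
  have "continuous_on (f ` S) (the_inv_into S f)"
    unfolding continuous_on_closed_invariant
  proof (intro allI impI)
    fix B :: "'b set" assume B: "closed B"
    then have "compact (S \<inter> B)" using S by blast
    then have "closed (f ` (S \<inter> B))"
      using compact_continuous_image[OF continuous_on_subset[OF f(1)], of "S \<inter> B"]
      by (simp add: compact_closed_iff)
    moreover have "f ` (S \<inter> B) \<inter> f ` S = the_inv_into S f -` B \<inter> f ` S"
      using f(2) by (auto simp: the_inv_into_f_f dest: inj_onD)
    ultimately show "\<exists>A. closed A \<and> A \<inter> f ` S = the_inv_into S f -` B \<inter> f ` S"
      by blast
  qed
  then show ?thesis
    using f by (intro exI[of _ "the_inv_into S f"])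
      (auto simp: homeomorphism_def the_inv_into_f_f image_iff)
qed

lemma closed_image:
  fixes f :: "'a \<Rightarrow> 'a"
  assumes "closed S" "continuous_on S f" shows "closed (f ` S)"
  using compact_continuous_image[OF assms(2) compact_closed[OF assms(1)]]
  by (simp only: compact_closed_iff)

lemma clopen_between:
  assumes "closed (S :: 'a set)" "open U" "S \<subseteq> U"
  shows "\<exists>C. clopen C \<and> S \<subseteq> C \<and> C \<subseteq> U"
proof -
  have "\<forall>x\<in>S. \<exists>n. cyl x n \<subseteq> U"
    using assms open_contains_cyl by blast
  then obtain n where n: "\<forall>x\<in>S. cyl x (n x) \<subseteq> U" by metis
  have "S \<subseteq> (\<Union>x\<in>S. cyl x (n x))" by auto
  then obtain J where J: "J \<subseteq> S" "finite J" "S \<subseteq> (\<Union>x\<in>J. cyl x (n x))"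
    using compactE_image[OF compact_closed[OF assms(1)], of S "\<lambda>x. cyl x (n x)" thesis] clopen_cyl
    unfolding clopen_def by blast
  then show ?thesis
    using n by (intro exI[of _ "\<Union>x\<in>J. cyl x (n x)"]) (auto intro!: clopen_UN clopen_cyl)
qed

lemma clopen_neighbourhood:
  assumes "open U" "(x::'a) \<in> U"
  shows "\<exists>C. clopen C \<and> x \<in> C \<and> C \<subseteq> U"
proof -
  obtain n where "cyl x n \<subseteq> U"
    using open_contains_cyl[OF assms] by blast
  then show ?thesis
    by (intro exI[of _ "cyl x n"]) (simp add: clopen_cyl)
qed

lemma open_Compl_finite:
  assumes "finite (A :: 'a set)" shows "open (- A)"
proof -
  have "closed A"
    using finite_imp_compact[OF assms] by (simp only: compact_closed_iff)
  then show ?thesis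
    by (simp only: closed_def)
qed

end

section \<open>Ample groups\<close>

unbundle no m_inv_syntax

section \<open>Groups of homeomorphisms as sets of bijections\<close>

lemma Homeo_UNIV_iff:
  "f \<in> Homeo UNIV \<longleftrightarrow> bij f \<and> continuous_on UNIV f \<and> continuous_on UNIV (inv f)"
proof
  assume "f \<in> Homeo UNIV"
  then obtain g where g: "homeomorphism UNIV UNIV f g"
    by (auto simp: Homeo_def)
  then have fg: "\<And>x. g (f x) = x" "\<And>y. f (g y) = y"
    by (auto simp: homeomorphism_def)
  then have b: "bij f" by (metis bijI')
  have "inv f = g"
    using fg by (intro inv_unique_comp) auto
  with g b show "bij f \<and> continuous_on UNIV f \<and> continuous_on UNIV (inv f)"
    by (auto simp: homeomorphism_def)
next
  assume "bij f \<and> continuous_on UNIV f \<and> continuous_on UNIV (inv f)"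
  then have "homeomorphism UNIV UNIV f (inv f)"
    by (simp add: homeomorphism_def bij_is_inj bij_is_surj surj_f_inv_f bij_imp_bij_inv)
  then show "f \<in> Homeo UNIV"
    by (auto simp: Homeo_def)
qed

text \<open>The group axioms for a bare set of bijections, with function inverse in place of the
  abstract one. Continuity is left to the ambient group, so finite subgroups can be handled without
  a carrier.\<close>

definition perm_group :: "('a \<Rightarrow> 'a) set \<Rightarrow> bool" where
  "perm_group S \<longleftrightarrow> id \<in> S \<and> (\<forall>f\<in>S. \<forall>g\<in>S. f \<circ> g \<in> S) \<and> (\<forall>f\<in>S. bij f \<and> inv f \<in> S)"

lemma perm_group_conjugate:
  fixes g :: "'a \<Rightarrow> 'a"
  assumes \<Phi>: "perm_group \<Phi>" and g: "bij g"
  shows "perm_group ((\<lambda>\<phi>. inv g \<circ> (\<phi> \<circ> g)) ` \<Phi>)"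
proof -
  have ginv: "inv g (g x) = x" "g (inv g x) = x" for x
    using g by (simp_all add: bij_is_inj bij_is_surj surj_f_inv_f)
  show ?thesis
    unfolding perm_group_def
  proof (intro conjI ballI)
    show "id \<in> (\<lambda>\<phi>. inv g \<circ> (\<phi> \<circ> g)) ` \<Phi>"
      using \<Phi> by (intro image_eqI[of _ _ id]) (auto simp: perm_group_def fun_eq_iff ginv)
  next
    fix a b assume "a \<in> (\<lambda>\<phi>. inv g \<circ> (\<phi> \<circ> g)) ` \<Phi>" "b \<in> (\<lambda>\<phi>. inv g \<circ> (\<phi> \<circ> g)) ` \<Phi>"
    then obtain a' b' where "a' \<in> \<Phi>" "a = inv g \<circ> (a' \<circ> g)" "b' \<in> \<Phi>" "b = inv g \<circ> (b' \<circ> g)"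
      by blast
    then show "a \<circ> b \<in> (\<lambda>\<phi>. inv g \<circ> (\<phi> \<circ> g)) ` \<Phi>"
      using \<Phi> by (intro image_eqI[of _ _ "a' \<circ> b'"]) (auto simp: perm_group_def fun_eq_iff ginv)
  next
    fix a assume "a \<in> (\<lambda>\<phi>. inv g \<circ> (\<phi> \<circ> g)) ` \<Phi>"
    then obtain a' where a': "a' \<in> \<Phi>" "a = inv g \<circ> (a' \<circ> g)" by blast
    then have bij: "bij a'" "inv a' \<in> \<Phi>" using \<Phi> by (auto simp: perm_group_def)
    show "bij a" unfolding a'(2) using g bij(1) by (intro bij_comp bij_imp_bij_inv)
    have a'inv: "inv a' (a' x) = x" "a' (inv a' x) = x" for x
      using bij(1) by (simp_all add: bij_is_inj bij_is_surj surj_f_inv_f)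
    have "inv a = inv g \<circ> (inv a' \<circ> g)"
      unfolding a'(2) by (intro inv_unique_comp) (auto simp: fun_eq_iff ginv a'inv)
    then show "inv a \<in> (\<lambda>\<phi>. inv g \<circ> (\<phi> \<circ> g)) ` \<Phi>"
      using bij(2) by blast
  qed
qed

lemma inv_homeo_group:
  assumes "f \<in> Homeo UNIV" shows "m_inv homeo_group f = inv f"
proof (rule group.inv_equality[OF group_homeo_group])
  show "inv f \<otimes>\<^bsub>homeo_group\<^esub> f = \<one>\<^bsub>homeo_group\<^esub>"
    using assms by (simp add: homeo_group_def Homeo_UNIV_iff bij_is_inj)
  show "f \<in> carrier homeo_group" "inv f \<in> carrier homeo_group"
    using assms by (auto simp: homeo_group_def Homeo_UNIV_iff bij_imp_bij_inv inv_inv_eq)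
qed

lemma subgroup_homeo_group_iff:
  "subgroup S homeo_group \<longleftrightarrow> S \<subseteq> Homeo UNIV \<and> perm_group S"
proof
  assume S: "subgroup S homeo_group"
  then have sub: "S \<subseteq> Homeo UNIV"
    using subgroup.subset by (fastforce simp: homeo_group_def)
  moreover have "perm_group S"
    unfolding perm_group_def
  proof (intro conjI ballI)
    show "id \<in> S"
      using subgroup.one_closed[OF S] by (simp add: homeo_group_def)
    show "f \<circ> g \<in> S" if "f \<in> S" "g \<in> S" for f g
      using subgroup.m_closed[OF S that] by (simp add: homeo_group_def)
    show "bij f" if "f \<in> S" for f
      using that sub Homeo_UNIV_iff by blast
    show "inv f \<in> S" if "f \<in> S" for f
      using subgroup.m_inv_closed[OF S that] inv_homeo_group[of f] that sub by auto
  qed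
  ultimately show "S \<subseteq> Homeo UNIV \<and> perm_group S" ..
next
  assume S: "S \<subseteq> Homeo UNIV \<and> perm_group S"
  show "subgroup S homeo_group"
  proof
    show "S \<subseteq> carrier homeo_group" using S by (simp add: homeo_group_def)
    show "\<one>\<^bsub>homeo_group\<^esub> \<in> S" using S by (simp add: homeo_group_def perm_group_def)
    show "f \<otimes>\<^bsub>homeo_group\<^esub> g \<in> S" if "f \<in> S" "g \<in> S" for f g
      using S that by (simp add: homeo_group_def perm_group_def)
    show "m_inv homeo_group f \<in> S" if "f \<in> S" for f
      using S that inv_homeo_group[of f] by (auto simp: perm_group_def)
  qed
qed

text \<open>The generated subgroup is the least subgroup containing \<open>A\<close>, so it is
  finite as soon as some finite subgroup contains \<open>A\<close>, and is itself such a subgroup if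
  it is finite.\<close>

lemma locally_finite_homeo_group_iff:
  "locally_finite_group homeo_group \<Gamma> \<longleftrightarrow> \<Gamma> \<subseteq> Homeo UNIV \<and> perm_group \<Gamma> \<and>
    (\<forall>A. finite A \<and> A \<subseteq> \<Gamma> \<longrightarrow> (\<exists>S. finite S \<and> A \<subseteq> S \<and> S \<subseteq> \<Gamma> \<and> perm_group S))"
proof
  assume l: "locally_finite_group homeo_group \<Gamma>"
  then have s: "subgroup \<Gamma> homeo_group" by (simp add: locally_finite_group_def)
  have "\<exists>S. finite S \<and> A \<subseteq> S \<and> S \<subseteq> \<Gamma> \<and> perm_group S" if A: "finite A" "A \<subseteq> \<Gamma>" for A
  proof (intro exI conjI)
    show "finite (generate homeo_group A)"
      using l A unfolding locally_finite_group_def by blast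
    show "A \<subseteq> generate homeo_group A"
      by (rule subsetI) (rule generate.incl)
    show "generate homeo_group A \<subseteq> \<Gamma>"
      using group.generate_subgroup_incl[OF group_homeo_group A(2) s] .
    have "A \<subseteq> carrier homeo_group"
      using A(2) subgroup.subset[OF s] by blast
    then show "perm_group (generate homeo_group A)"
      using group.generate_is_subgroup[OF group_homeo_group, of A] by (simp add: subgroup_homeo_group_iff)
  qed
  with s show "\<Gamma> \<subseteq> Homeo UNIV \<and> perm_group \<Gamma> \<and>
    (\<forall>A. finite A \<and> A \<subseteq> \<Gamma> \<longrightarrow> (\<exists>S. finite S \<and> A \<subseteq> S \<and> S \<subseteq> \<Gamma> \<and> perm_group S))"
    by (auto simp: subgroup_homeo_group_iff)
next
  assume r: "\<Gamma> \<subseteq> Homeo UNIV \<and> perm_group \<Gamma> \<and>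
    (\<forall>A. finite A \<and> A \<subseteq> \<Gamma> \<longrightarrow> (\<exists>S. finite S \<and> A \<subseteq> S \<and> S \<subseteq> \<Gamma> \<and> perm_group S))"
  have "finite (generate homeo_group A)" if A: "finite A" "A \<subseteq> \<Gamma>" for A
  proof -
    obtain S where S: "finite S" "A \<subseteq> S" "S \<subseteq> \<Gamma>" "perm_group S"
      using r A by meson
    then have "subgroup S homeo_group"
      using r by (simp add: subgroup_homeo_group_iff subset_trans[of S \<Gamma>])
    from group.generate_subgroup_incl[OF group_homeo_group S(2) this] show ?thesis
      using S(1) finite_subset by blast
  qed
  then show "locally_finite_group homeo_group \<Gamma>"
    using r by (auto simp: locally_finite_group_def subgroup_homeo_group_iff)
qed

section \<open>Elementary consequences of ampleness\<close>

locale ample_action = cantor_space e e'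
  for e :: "'a::topological_space \<Rightarrow> nat \<Rightarrow> bool" and e' +
  fixes \<Gamma> :: "('a \<Rightarrow> 'a) set"
  assumes ample: "ample \<Gamma>"
begin

lemma perm_group: "perm_group \<Gamma>" and sub_Homeo: "\<Gamma> \<subseteq> Homeo UNIV"
  using ample by (auto simp: ample_def locally_finite_homeo_group_iff)

lemma id_mem: "id \<in> \<Gamma>"
  and comp_mem: "f \<in> \<Gamma> \<Longrightarrow> g \<in> \<Gamma> \<Longrightarrow> f \<circ> g \<in> \<Gamma>"
  and inv_mem: "f \<in> \<Gamma> \<Longrightarrow> inv f \<in> \<Gamma>"
  and bij_mem: "f \<in> \<Gamma> \<Longrightarrow> bij f"
  using perm_group by (auto simp: perm_group_def)

lemma inv_f_f [simp]: "f \<in> \<Gamma> \<Longrightarrow> inv f (f x) = x"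
  and f_inv_f [simp]: "f \<in> \<Gamma> \<Longrightarrow> f (inv f x) = x"
  by (simp_all add: bij_mem bij_is_inj bij_is_surj surj_f_inv_f)

lemma mem_eq_iff: "f \<in> \<Gamma> \<Longrightarrow> f x = f y \<longleftrightarrow> x = y"
  by (metis inv_f_f)

lemma continuous_mem: "f \<in> \<Gamma> \<Longrightarrow> continuous_on UNIV f"
  using sub_Homeo Homeo_UNIV_iff by blast

lemma clopen_fix: "f \<in> \<Gamma> \<Longrightarrow> clopen {x. f x = x}"
  using ample by (simp add: ample_def clopen_def)

lemma clopen_eq:
  assumes "f \<in> \<Gamma>" "g \<in> \<Gamma>" shows "clopen {x. f x = g x}"
proof -
  have "{x. f x = g x} = {x. (inv g \<circ> f) x = x}"
  proof (intro Collect_cong)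
    fix x show "f x = g x \<longleftrightarrow> (inv g \<circ> f) x = x"
      using f_inv_f[OF assms(2), of "f x"] inv_f_f[OF assms(2), of x] by (metis comp_apply)
  qed
  then show ?thesis
    using clopen_fix[OF comp_mem[OF inv_mem[OF assms(2)] assms(1)]] by simp
qed

lemma finite_subgroup:
  assumes "finite A" "A \<subseteq> \<Gamma>"
  obtains S where "finite S" "A \<subseteq> S" "S \<subseteq> \<Gamma>" "perm_group S"
  using ample assms unfolding ample_def locally_finite_homeo_group_iff by meson

lemma clopen_mem_vimage: "f \<in> \<Gamma> \<Longrightarrow> clopen A \<Longrightarrow> clopen {x. f x \<in> A}"
  using clopen_vimage[OF continuous_mem] by (simp add: vimage_def)

lemma clopen_mem_image:
  assumes "f \<in> \<Gamma>" "clopen A" shows "clopen (f ` A)"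
proof -
  have "f ` A = {x. inv f x \<in> A}"
  proof (intro equalityI subsetI)
    show "x \<in> {x. inv f x \<in> A}" if "x \<in> f ` A" for x
      using that assms(1) by auto
    show "x \<in> f ` A" if "x \<in> {x. inv f x \<in> A}" for x
      using that f_inv_f[OF assms(1), of x] by (metis imageI mem_Collect_eq)
  qed
  then show ?thesis
    using clopen_mem_vimage[OF inv_mem[OF assms(1)] assms(2)] by simp
qed

lemma closed_mem_image: "f \<in> \<Gamma> \<Longrightarrow> closed A \<Longrightarrow> closed (f ` A)"
  using closed_image continuous_on_subset[OF continuous_mem] by blast

text \<open>Fullness in local form. Compactness extracts the finite set of group elements that
  fullness asks for, and it also makes the locally continuous bijection a homeomorphism.\<close>

lemma locally_mem:
  assumes "bij f" "\<And>x. \<exists>\<gamma>\<in>\<Gamma>. \<exists>U. open U \<and> x \<in> U \<and> (\<forall>y\<in>U. f y = \<gamma> y)"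
  shows "f \<in> \<Gamma>"
proof -
  obtain c U where cU: "\<And>x. c x \<in> \<Gamma>" "\<And>x. open (U x)" "\<And>x. x \<in> U x"
      "\<And>x y. y \<in> U x \<Longrightarrow> f y = c x y"
    using assms(2) by metis
  have "open (f -` B)" if B: "open B" for B
  proof (subst open_subopen, intro ballI)
    fix x assume "x \<in> f -` B"
    then have "x \<in> U x \<inter> c x -` B" "U x \<inter> c x -` B \<subseteq> f -` B"
      using cU(3)[of x] cU(4)[of _ x] by fastforce+
    moreover have "open (U x \<inter> c x -` B)"
      using open_Int[OF cU(2) open_vimage[OF B continuous_mem[OF cU(1)]]] .
    ultimately show "\<exists>T. open T \<and> x \<in> T \<and> T \<subseteq> f -` B" by blast
  qed
  then have "continuous_on UNIV f"
    by (simp add: continuous_on_open_vimage)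
  from compact_homeomorphism[OF compact_UNIV this bij_is_inj[OF assms(1)]]
  have f: "f \<in> Homeo UNIV"
    unfolding bij_is_surj[OF assms(1)] by (simp add: Homeo_def)
  obtain J where J: "finite J" "UNIV \<subseteq> (\<Union>x\<in>J. U x)"
  proof (rule compactE_image[OF compact_UNIV, of UNIV U])
    show "UNIV \<subseteq> (\<Union>x\<in>UNIV. U x)" using cU(3) by blast
  qed (use cU(2) in auto)
  have "full_group \<Gamma>" using ample by (simp add: ample_def)
  moreover have "finite (c ` J)" "c ` J \<subseteq> \<Gamma>"
    using J(1) cU(1) by blast+
  moreover have "\<forall>x. \<exists>\<gamma>\<in>c ` J. f x = \<gamma> x"
  proof (intro allI)
    fix x
    obtain y where "y \<in> J" "x \<in> U y" using J(2) by blast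
    then show "\<exists>\<gamma>\<in>c ` J. f x = \<gamma> x"
      using cU(4) by blast
  qed
  ultimately show ?thesis
    using f unfolding full_group_def by blast
qed

end

section \<open>Swaps, sparse sets and approximations\<close>

context ample_action
begin

text \<open>\<open>T\<close> is the graph of a partial involution. By \<open>loc\<close> its domain
  is open and by \<open>cl\<close> it is closed, so the extension by the identity is still locally
  given by elements of \<Gamma>.\<close>

lemma swap:
  assumes sym: "\<And>z w. (z, w) \<in> T \<Longrightarrow> (w, z) \<in> T"
    and sv: "\<And>z w w'. (z, w) \<in> T \<Longrightarrow> (z, w') \<in> T \<Longrightarrow> w = w'"
    and loc: "\<And>z w. (z, w) \<in> T \<Longrightarrow> \<exists>\<gamma>\<in>\<Gamma>. \<exists>U. open U \<and> z \<in> U \<and> (\<forall>z'\<in>U. (z', \<gamma> z') \<in> T)"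
    and cl: "closed (Domain T)"
  shows "\<exists>u\<in>\<Gamma>. (\<forall>z w. (z, w) \<in> T \<longrightarrow> u z = w) \<and> (\<forall>z. z \<notin> Domain T \<longrightarrow> u z = z)"
proof -
  define u where "u z = (if z \<in> Domain T then THE w. (z, w) \<in> T else z)" for z
  have uT: "u z = w" if "(z, w) \<in> T" for z w
  proof -
    have "(THE w. (z, w) \<in> T) = w"
      using that by (rule the_equality) (rule sv[OF _ that])
    then show ?thesis
      using that by (auto simp: u_def)
  qed
  have un: "u z = z" if "z \<notin> Domain T" for z
    using that by (simp add: u_def)
  have uu: "u (u z) = z" for z
  proof (cases "z \<in> Domain T")
    case True
    then obtain w where "(z, w) \<in> T" by blast
    then show ?thesis using uT[of z w] uT[of w z] sym[of z w] by simp
  next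
    case False
    then show ?thesis by (simp add: un)
  qed
  have "u \<in> \<Gamma>"
  proof (rule locally_mem)
    show "bij u" by (rule bijI'[of u]) (metis uu)+
    fix x
    show "\<exists>\<gamma>\<in>\<Gamma>. \<exists>U. open U \<and> x \<in> U \<and> (\<forall>y\<in>U. u y = \<gamma> y)"
    proof (cases "x \<in> Domain T")
      case True
      then obtain w where "(x, w) \<in> T" by blast
      from loc[OF this] obtain \<gamma> U where "\<gamma> \<in> \<Gamma>" "open U" "x \<in> U" "\<forall>z'\<in>U. (z', \<gamma> z') \<in> T"
        by blast
      then show ?thesis using uT by blast
    next
      case False
      show ?thesis
      proof (intro bexI exI conjI ballI)
        show "open (- Domain T)" using cl by (simp add: closed_def)
        show "x \<in> - Domain T" using False by simp
        show "u y = id y" if "y \<in> - Domain T" for y using that un by simp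
      qed (rule id_mem)
    qed
  qed
  then show ?thesis using uT un by blast
qed

text \<open>Equivalent to \<open>orbit_sparse\<close> because \<Gamma> is a group. Speaking of
  single group elements allows the condition to be weakened to finite subgroups.\<close>

definition sparse :: "'a set \<Rightarrow> bool" where
  "sparse M \<longleftrightarrow> closed M \<and> (\<forall>x\<in>M. \<forall>\<gamma>\<in>\<Gamma>. \<gamma> x \<in> M \<longrightarrow> \<gamma> x = x)"

text \<open>Sparseness tested against \<open>\<Phi>\<close> only. For finite \<open>\<Phi>\<close>
  it spreads from a sparse set to a clopen neighbourhood.\<close>

definition transversal :: "('a \<Rightarrow> 'a) set \<Rightarrow> 'a set \<Rightarrow> bool" where
  "transversal \<Phi> F \<longleftrightarrow> (\<forall>\<gamma>\<in>\<Phi>. \<forall>y\<in>F. \<gamma> y \<in> F \<longrightarrow> \<gamma> y = y)"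

lemma sparse_closed: "sparse M \<Longrightarrow> closed M"
  by (simp add: sparse_def)

lemma sparse_image:
  assumes "sparse M" "g \<in> \<Gamma>" shows "sparse (g ` M)"
  unfolding sparse_def
proof (intro conjI ballI impI)
  show "closed (g ` M)"
    using assms closed_mem_image sparse_closed by blast
  fix y \<gamma> assume y: "y \<in> g ` M" "\<gamma> \<in> \<Gamma>" "\<gamma> y \<in> g ` M"
  then obtain x x' where x: "x \<in> M" "y = g x" "x' \<in> M" "\<gamma> y = g x'" by blast
  have "(inv g \<circ> (\<gamma> \<circ> g)) x = x'"
    using x assms(2) by simp
  then have "x' = x"
    using x(1,3) assms y(2) comp_mem inv_mem unfolding sparse_def by metis
  then show "\<gamma> y = y" using x by simp
qed

text \<open>One \<gamma> at a time: the points of \<open>M\<close> moved by \<gamma> form a closed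
  set because fixed-point sets are clopen, and by sparseness its image misses \<open>M\<close>.
  Choose a clopen Q around \<open>M\<close> missing that image, and delete from Q the points that
  \<gamma> moves but keeps in Q; no point of \<open>M\<close> is lost.\<close>

lemma transversal_neighbourhood:
  assumes M: "sparse M" and \<Phi>: "finite \<Phi>" "\<Phi> \<subseteq> \<Gamma>" and O: "open V" "M \<subseteq> V"
  obtains F where "clopen F" "M \<subseteq> F" "F \<subseteq> V" "transversal \<Phi> F"
proof -
  have "\<exists>F. clopen F \<and> M \<subseteq> F \<and> (\<forall>y\<in>F. \<gamma> y \<in> F \<longrightarrow> \<gamma> y = y)" if \<gamma>: "\<gamma> \<in> \<Gamma>" for \<gamma>
  proof -
    let ?M = "M - {x. \<gamma> x = x}"
    have "closed ?M"
      using sparse_closed[OF M] clopen_fix[OF \<gamma>] by (simp add: clopen_def closed_Diff)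
    then have "open (- (\<gamma> ` ?M))"
      using closed_mem_image[OF \<gamma>] by (simp only: closed_def)
    moreover have "M \<subseteq> - (\<gamma> ` ?M)"
      using M \<gamma> unfolding sparse_def by auto
    ultimately obtain Q where Q: "clopen Q" "M \<subseteq> Q" "Q \<subseteq> - (\<gamma> ` ?M)"
      using clopen_between[OF sparse_closed[OF M]] by meson
    let ?F = "Q \<inter> ({y. \<gamma> y = y} \<union> - {y. \<gamma> y \<in> Q})"
    have "clopen ?F"
      using Q(1) \<gamma> by (intro clopen_Int clopen_Un clopen_Compl clopen_fix clopen_mem_vimage)
    moreover have "M \<subseteq> ?F" using Q(2,3) by auto
    moreover have "\<forall>y\<in>?F. \<gamma> y \<in> ?F \<longrightarrow> \<gamma> y = y" by auto
    ultimately show ?thesis by meson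
  qed
  then have "\<forall>\<gamma>\<in>\<Phi>. \<exists>F. clopen F \<and> M \<subseteq> F \<and> (\<forall>y\<in>F. \<gamma> y \<in> F \<longrightarrow> \<gamma> y = y)"
    using \<Phi>(2) by blast
  then obtain F where F: "\<forall>\<gamma>\<in>\<Phi>. clopen (F \<gamma>) \<and> M \<subseteq> F \<gamma> \<and> (\<forall>y\<in>F \<gamma>. \<gamma> y \<in> F \<gamma> \<longrightarrow> \<gamma> y = y)"
    by (auto simp: bchoice_iff)
  obtain C where C: "clopen C" "M \<subseteq> C" "C \<subseteq> V"
    using clopen_between[OF sparse_closed[OF M] O] by blast
  show thesis
  proof
    show "clopen (C \<inter> (\<Inter>\<gamma>\<in>\<Phi>. F \<gamma>))"
      using C(1) F \<Phi>(1) by (intro clopen_Int clopen_INT) blast+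
    show "M \<subseteq> C \<inter> (\<Inter>\<gamma>\<in>\<Phi>. F \<gamma>)" "C \<inter> (\<Inter>\<gamma>\<in>\<Phi>. F \<gamma>) \<subseteq> V"
      using C F by blast+
    show "transversal \<Phi> (C \<inter> (\<Inter>\<gamma>\<in>\<Phi>. F \<gamma>))"
      unfolding transversal_def using F by blast
  qed
qed

text \<open>The pattern of a point records which of its translates by \<open>\<Phi>\<close> lie in
  which sets of \<open>\<A>\<close>; this is equality of patterns. With finite data and clopen sets
  the classes are clopen.\<close>

definition same :: "('a \<Rightarrow> 'a) set \<Rightarrow> 'a set set \<Rightarrow> 'a \<Rightarrow> 'a \<Rightarrow> bool" where
  "same \<Phi> \<A> y z \<longleftrightarrow> (\<forall>\<gamma>\<in>\<Phi>. \<forall>A\<in>\<A>. \<gamma> y \<in> A \<longleftrightarrow> \<gamma> z \<in> A)"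

lemma same_refl [simp]: "same \<Phi> \<A> x x"
  by (simp add: same_def)

lemma same_sym: "same \<Phi> \<A> x y \<Longrightarrow> same \<Phi> \<A> y x"
  by (simp add: same_def)

lemma same_trans: "same \<Phi> \<A> x y \<Longrightarrow> same \<Phi> \<A> y z \<Longrightarrow> same \<Phi> \<A> x z"
  by (simp add: same_def)

lemma same_mono: "same \<Phi>' \<A>' x y \<Longrightarrow> \<Phi> \<subseteq> \<Phi>' \<Longrightarrow> \<A> \<subseteq> \<A>' \<Longrightarrow> same \<Phi> \<A> x y"
  unfolding same_def by blast

lemma clopen_same:
  assumes "finite \<Phi>" "\<Phi> \<subseteq> \<Gamma>" "finite \<A>" "\<And>A. A \<in> \<A> \<Longrightarrow> clopen A"
  shows "clopen {y. same \<Phi> \<A> y z}"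
proof -
  have "{y. same \<Phi> \<A> y z} = (\<Inter>\<gamma>\<in>\<Phi>. \<Inter>A\<in>\<A>. {y. \<gamma> y \<in> A \<longleftrightarrow> \<gamma> z \<in> A})"
    unfolding same_def by blast
  moreover have "clopen {y. \<gamma> y \<in> A \<longleftrightarrow> \<gamma> z \<in> A}" if "\<gamma> \<in> \<Phi>" "A \<in> \<A>" for \<gamma> A
    by (rule clopen_Collect_eq[OF clopen_mem_vimage]) (use that assms in \<open>auto\<close>)
  ultimately show ?thesis
    using assms(1,3) by (simp add: clopen_INT)
qed

text \<open>
  The state of the back-and-forth construction of an extension of \<open>h\<close>: membership in the sets in
  \<open>\<A>\<close> and commutation with \<open>\<Phi>\<close> are settled by \<open>g\<close>. As \<open>\<A>\<close> contains the fixed-point sets, points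
  with the same pattern have the same stabilizer in \<open>\<Phi>\<close>.
\<close>

definition approximates ::
  "('a \<Rightarrow> 'a) \<Rightarrow> ('a \<Rightarrow> 'a) set \<Rightarrow> 'a set set \<Rightarrow> ('a \<Rightarrow> 'a) \<Rightarrow> 'a set \<Rightarrow> 'a set \<Rightarrow> bool" where
  "approximates g \<Phi> \<A> h M M' \<longleftrightarrow>
     g \<in> \<Gamma> \<and> finite \<Phi> \<and> \<Phi> \<subseteq> \<Gamma> \<and> perm_group \<Phi> \<and> finite \<A> \<and> (\<forall>A\<in>\<A>. clopen A) \<and>
     (\<forall>\<delta>\<in>\<Phi>. {x. \<delta> x = x} \<in> \<A>) \<and> (\<exists>F\<in>\<A>. M' \<subseteq> F \<and> transversal \<Phi> F) \<and>
     (\<forall>x\<in>M. same \<Phi> \<A> (g x) (h x))"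

end

section \<open>Minimality and the correction step\<close>

locale minimal_ample_action = ample_action +
  assumes minimal: "acts_minimally \<Gamma>"
begin

lemma orbit_meets_open:
  assumes "open U" "U \<noteq> {}" shows "\<exists>\<gamma>\<in>\<Gamma>. \<gamma> x \<in> U"
proof -
  have "closure (orbit_of \<Gamma> x) = UNIV"
    using minimal by (simp add: acts_minimally_def)
  then have "U \<inter> orbit_of \<Gamma> x \<noteq> {}"
    using open_Int_closure_eq_empty[OF assms(1), of "orbit_of \<Gamma> x"] assms(2) by auto
  then show ?thesis
    by (auto simp: orbit_of_def)
qed

text \<open>
  The correction \<open>u\<close> exchanges \<open>\<phi> y\<close> and \<open>\<phi> (m y)\<close> for \<open>\<phi> \<in> \<Phi>\<close> and \<open>y\<close> in a small neighbourhood \<open>V\<close> of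
  \<open>g ` M\<close>, where \<open>m\<close> is piecewise in \<open>\<Gamma>\<close> and takes \<open>g x\<close> close to \<open>h x\<close>. Being an involution, it needs
  no comparison or cancellation of clopen sets.
\<close>

lemma approximates_step:
  assumes h: "continuous_on M h" "h ` M = M'" and sM: "sparse M" "sparse M'"
    and st: "approximates g \<Phi> \<A> h M M'" and new: "\<psi> \<in> \<Gamma>" "clopen C"
  obtains u \<Phi>' \<A>' where "u \<in> \<Gamma>" "approximates (u \<circ> g) \<Phi>' \<A>' h M M'"
    "insert \<psi> \<Phi> \<subseteq> \<Phi>'" "insert C \<A> \<subseteq> \<A>'"
    "\<And>\<phi> x. \<phi> \<in> \<Phi> \<Longrightarrow> u (\<phi> x) = \<phi> (u x)" "\<And>A x. A \<in> \<A> \<Longrightarrow> u x \<in> A \<longleftrightarrow> x \<in> A"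
proof -
  have g: "g \<in> \<Gamma>" and \<Phi>: "finite \<Phi>" "\<Phi> \<subseteq> \<Gamma>" "perm_group \<Phi>"
    and \<A>: "finite \<A>" "\<And>A. A \<in> \<A> \<Longrightarrow> clopen A" "\<And>\<delta>. \<delta> \<in> \<Phi> \<Longrightarrow> {x. \<delta> x = x} \<in> \<A>"
    and gh: "\<And>x. x \<in> M \<Longrightarrow> same \<Phi> \<A> (g x) (h x)"
    using st by (auto simp: approximates_def)
  from st obtain F where F: "F \<in> \<A>" "M' \<subseteq> F" "transversal \<Phi> F"
    by (auto simp: approximates_def)
  have id\<Phi>: "id \<in> \<Phi>" and comp\<Phi>: "\<And>a b. a \<in> \<Phi> \<Longrightarrow> b \<in> \<Phi> \<Longrightarrow> a \<circ> b \<in> \<Phi>"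
    and inv\<Phi>: "\<And>a. a \<in> \<Phi> \<Longrightarrow> inv a \<in> \<Phi>"
    using \<Phi>(3) by (auto simp: perm_group_def)
  obtain \<Phi>' where \<Phi>': "finite \<Phi>'" "insert \<psi> \<Phi> \<subseteq> \<Phi>'" "\<Phi>' \<subseteq> \<Gamma>" "perm_group \<Phi>'"
    using finite_subgroup[of "insert \<psi> \<Phi>"] \<Phi>(1,2) new(1) by auto
  \<comment> \<open>The new state needs a neighbourhood transversal to the enlarged group
    \<open>\<Phi>'\<close>. The present correction itself is governed by the old \<open>F\<close>
    and \<open>\<Phi>\<close>.\<close>
  obtain F' where F': "clopen F'" "M' \<subseteq> F'" "transversal \<Phi>' F'"
    by (rule transversal_neighbourhood[OF sM(2) \<Phi>'(1,3) open_UNIV subset_UNIV])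
  define \<A>' where "\<A>' = insert C (insert F' (\<A> \<union> (\<lambda>\<delta>. {x. \<delta> x = x}) ` \<Phi>'))"
  have \<A>': "finite \<A>'" "\<And>A. A \<in> \<A>' \<Longrightarrow> clopen A" "insert C \<A> \<subseteq> \<A>'"
    using \<A>(1,2) \<Phi>'(1,3) new(2) F'(1) clopen_fix by (auto simp: \<A>'_def)
  \<comment> \<open>The target for g x: points with the finer pattern of h x, kept inside
    \<open>F\<close> so that transversality to \<open>\<Phi>\<close> still applies after the
    move.\<close>
  define E where "E x = F \<inter> {z. same \<Phi>' \<A>' z (h x)}" for x
  have cE: "clopen (E x)" for x
    unfolding E_def using F(1) \<A>(2) clopen_same[OF \<Phi>'(1,3) \<A>'(1,2)] by (simp add: clopen_Int)
  have hE: "h x \<in> E x" if "x \<in> M" for x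
    using that F(2) h(2) by (auto simp: E_def)
  have "\<forall>x. \<exists>c. x \<in> M \<longrightarrow> c \<in> \<Gamma> \<and> c (g x) \<in> E x"
    using orbit_meets_open cE hE unfolding clopen_def by (metis empty_iff)
  then obtain c where c: "\<And>x. x \<in> M \<Longrightarrow> c x \<in> \<Gamma>" "\<And>x. x \<in> M \<Longrightarrow> c x (g x) \<in> E x"
    by metis
  have "\<exists>N. clopen N \<and> g x \<in> N \<and> (\<forall>y\<in>N. y \<in> F \<and> same \<Phi> \<A> y (g x) \<and> c x y \<in> E x) \<and>
      (\<forall>x'\<in>M. g x' \<in> N \<longrightarrow> h x' \<in> E x)" if x: "x \<in> M" for x
  proof -
    \<comment> \<open>The points of \<open>M\<close> whose value under h leaves \<open>E x\<close>.
      Continuity of h makes this set closed; removing its image under g guarantees that one target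
      serves all points of \<open>M\<close> that g sends into N.\<close>
    let ?Z = "M \<inter> h -` (- E x)"
    let ?O = "F \<inter> {y. same \<Phi> \<A> y (g x)} \<inter> {y. c x y \<in> E x}"
    have "closed (- E x)" using cE[of x] by (simp add: clopen_def open_closed)
    then have "closed ?Z"
      using continuous_closed_preimage[OF h(1) sparse_closed[OF sM(1)]] by blast
    then have "open (- (g ` ?Z))"
      using closed_mem_image[OF g] by (simp only: closed_def)
    moreover have "clopen ?O"
      using F(1) \<A>(2) clopen_same[OF \<Phi>(1,2) \<A>(1,2)] clopen_mem_vimage[OF c(1)[OF x] cE]
      by (simp add: clopen_Int)
    ultimately have "open (?O \<inter> - (g ` ?Z))" by (simp add: clopen_def open_Int)
    \<comment> \<open>The identity belongs to \<open>\<Phi>\<close> and \<open>F\<close> to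
      \<open>\<A>\<close>, so g x lies in \<open>F\<close> along with h x.\<close>
    moreover have "g x \<in> F"
      using gh[OF x] id\<Phi> F(1,2) x h(2) unfolding same_def by (metis id_apply image_eqI subsetD)
    then have "g x \<in> ?O \<inter> - (g ` ?Z)"
      using c(2)[OF x] hE x g by (auto simp: mem_eq_iff)
    ultimately obtain N where "clopen N" "g x \<in> N" "N \<subseteq> ?O \<inter> - (g ` ?Z)"
      using clopen_neighbourhood by meson
    then show ?thesis by (intro exI[of _ N]) blast
  qed
  then obtain N where N: "\<And>x. x \<in> M \<Longrightarrow> clopen (N x)" "\<And>x. x \<in> M \<Longrightarrow> g x \<in> N x"
      "\<And>x y. x \<in> M \<Longrightarrow> y \<in> N x \<Longrightarrow> y \<in> F \<and> same \<Phi> \<A> y (g x) \<and> c x y \<in> E x"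
      "\<And>x x'. x \<in> M \<Longrightarrow> x' \<in> M \<Longrightarrow> g x' \<in> N x \<Longrightarrow> h x' \<in> E x"
    by metis
  have sgM: "sparse (g ` M)" using sM(1) g by (rule sparse_image)
  obtain X where X: "X \<subseteq> M" "finite X" "g ` M \<subseteq> (\<Union>x\<in>X. N x)"
  proof (rule compactE_image[OF compact_closed[OF sparse_closed[OF sgM]], of M N])
    show "g ` M \<subseteq> (\<Union>x\<in>M. N x)" using N(2) by blast
  qed (use N(1) clopen_def in auto)
  obtain k where k: "\<And>y. y \<in> (\<Union>x\<in>X. N x) \<Longrightarrow> k y \<in> X \<and> y \<in> N (k y)"
      "\<And>x. x \<in> X \<Longrightarrow> clopen {y \<in> (\<Union>x\<in>X. N x). k y = x}"
    using clopen_choice[of X N] X(1,2) N(1) by blast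
  \<comment> \<open>The chosen elements are placed in one finite group to which V will be
    transversal. This makes m injective on V and lets m y return to V only when m y = y.\<close>
  obtain \<Psi> where \<Psi>: "finite \<Psi>" "c ` X \<subseteq> \<Psi>" "\<Psi> \<subseteq> \<Gamma>" "perm_group \<Psi>"
    using finite_subgroup[of "c ` X"] X(1,2) c(1) by blast
  have "clopen (\<Union>x\<in>X. N x)" using X(1,2) N(1) by (intro clopen_UN) auto
  then obtain V where V: "clopen V" "g ` M \<subseteq> V" "V \<subseteq> (\<Union>x\<in>X. N x)" "transversal \<Psi> V"
    using transversal_neighbourhood[OF sgM \<Psi>(1,3) _ X(3)] unfolding clopen_def by metis
  define m where "m y = c (k y) y" for y
  have kM: "k y \<in> X" "k y \<in> M" "c (k y) \<in> \<Gamma>" "c (k y) \<in> \<Psi>" if "y \<in> V" for y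
    using that V(3) k(1) X(1) c(1) \<Psi>(2) by blast+
  \<comment> \<open>At the old level m y has the pattern of h (k y), hence that of g (k y), hence
    that of y. So \<open>\<Phi>\<close> and \<open>\<A>\<close> cannot tell y from m y.\<close>
  have mF: "y \<in> F" "m y \<in> F" "m y \<in> E (k y)" "same \<Phi> \<A> y (m y)" if y: "y \<in> V" for y
  proof -
    have 1: "y \<in> F \<and> same \<Phi> \<A> y (g (k y)) \<and> m y \<in> E (k y)"
      unfolding m_def using N(3)[OF kM(2)[OF y], of y] k(1) V(3) y by blast
    then have "same \<Phi> \<A> (m y) (h (k y))"
      using same_mono[of \<Phi>' \<A>' "m y" "h (k y)" \<Phi> \<A>] \<Phi>'(2) \<A>'(3) by (auto simp: E_def)
    with 1 gh[OF kM(2)[OF y]] show "same \<Phi> \<A> y (m y)"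
      by (meson same_sym same_trans)
    from 1 show "y \<in> F" "m y \<in> F" "m y \<in> E (k y)" by (auto simp: E_def)
  qed
  have m_inj: "y = y'" if "y \<in> V" "y' \<in> V" "m y = m y'" for y y'
  proof -
    let ?\<gamma> = "inv (c (k y')) \<circ> c (k y)"
    have "?\<gamma> \<in> \<Psi>" using kM(4) that \<Psi>(4) by (auto simp: perm_group_def)
    moreover have "?\<gamma> y = y'" using that kM(3)[of y'] by (simp add: m_def)
    ultimately show ?thesis using V(4) that(1,2) unfolding transversal_def by metis
  qed
  have m_V: "m y = y" if "y \<in> V" "m y \<in> V" for y
    using V(4) kM(4) that unfolding transversal_def m_def by blast
  have F_eq: "a = b \<and> \<delta> a = a" if "\<delta> \<in> \<Phi>" "\<delta> a = b" "a \<in> F" "b \<in> F" for \<delta> a b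
    using F(3) that unfolding transversal_def by metis
  have fix_m: "\<delta> y = y \<longleftrightarrow> \<delta> (m y) = m y" if "y \<in> V" "\<delta> \<in> \<Phi>" for \<delta> y
    using mF(4)[OF that(1)] id\<Phi> \<A>(3)[OF that(2)] unfolding same_def by fastforce
  have quot: "inv \<phi>' \<circ> \<phi> \<in> \<Phi>" "(inv \<phi>' \<circ> \<phi>) a = b" if "\<phi> \<in> \<Phi>" "\<phi>' \<in> \<Phi>" "\<phi> a = \<phi>' b" for \<phi> \<phi>' a b
    using that inv\<Phi> comp\<Phi> \<Phi>(2) by auto
  have quot_fix: "(inv \<phi>' \<circ> \<phi>) a = a \<longleftrightarrow> \<phi> a = \<phi>' a" if "\<phi>' \<in> \<Phi>" for \<phi> \<phi>' a
    using that \<Phi>(2) by (metis comp_apply f_inv_f inv_f_f subsetD)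
  \<comment> \<open>The graph of m is spread out by \<open>\<Phi>\<close> so that the correction
    commutes with \<open>\<Phi>\<close>. It remains single-valued: transversality of
    \<open>F\<close> recovers y from \<phi> y, and y and m y have equal stabilizers in
    \<open>\<Phi>\<close>.\<close>
  define S where "S = {(\<phi> y, \<phi> (m y)) |\<phi> y. \<phi> \<in> \<Phi> \<and> y \<in> V}"
  define T where "T = S \<union> S\<inverse>"
  have S_S: "w = w'" if zw: "(z, w) \<in> S" "(z, w') \<in> S" for z w w'
  proof -
    from zw obtain \<phi> y \<phi>' y' where *: "\<phi> \<in> \<Phi>" "y \<in> V" "\<phi>' \<in> \<Phi>" "y' \<in> V"
        "z = \<phi> y" "w = \<phi> (m y)" "z = \<phi>' y'" "w' = \<phi>' (m y')"
      by (auto simp: S_def)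
    then have "y = y' \<and> (inv \<phi>' \<circ> \<phi>) y = y"
      using F_eq[OF quot[of \<phi> \<phi>' y y']] mF(1) by metis
    then have "y = y' \<and> (inv \<phi>' \<circ> \<phi>) (m y) = m y"
      using fix_m[OF *(2) quot(1)[OF *(1,3)]] *(5,7) by metis
    then show ?thesis using quot_fix *(3,6,8) by metis
  qed
  have S'_S': "w = w'" if zw: "(w, z) \<in> S" "(w', z) \<in> S" for z w w'
  proof -
    from zw obtain \<phi> y \<phi>' y' where *: "\<phi> \<in> \<Phi>" "y \<in> V" "\<phi>' \<in> \<Phi>" "y' \<in> V"
        "w = \<phi> y" "z = \<phi> (m y)" "w' = \<phi>' y'" "z = \<phi>' (m y')"
      by (auto simp: S_def)
    then have 1: "m y = m y' \<and> (inv \<phi>' \<circ> \<phi>) (m y) = m y"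
      using F_eq[OF quot[of \<phi> \<phi>' "m y" "m y'"]] mF(2) by metis
    then have "y = y' \<and> (inv \<phi>' \<circ> \<phi>) y = y"
      using fix_m[OF *(2) quot(1)[OF *(1,3)]] *(6,8) m_inj[OF *(2,4)] by metis
    then show ?thesis using quot_fix *(3,5,7) by metis
  qed
  \<comment> \<open>If a forward and a backward prescription meet at z, then y = m y' lies in V, so
    m fixes y' and y = y'. Both prescriptions then send z to itself.\<close>
  have S_S': "w = w'" if zw: "(z, w) \<in> S" "(w', z) \<in> S" for z w w'
  proof -
    from zw obtain \<phi> y \<phi>' y' where *: "\<phi> \<in> \<Phi>" "y \<in> V" "\<phi>' \<in> \<Phi>" "y' \<in> V"
        "z = \<phi> y" "w = \<phi> (m y)" "w' = \<phi>' y'" "z = \<phi>' (m y')"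
      by (auto simp: S_def)
    then have 1: "y = m y'"
      using F_eq[OF quot[of \<phi> \<phi>' "y" "m y'"]] mF(1,2) by metis
    then have "m y' = y'" using m_V *(2,4) by metis
    then show ?thesis using 1 * by metis
  qed
  have "\<exists>u\<in>\<Gamma>. (\<forall>z w. (z, w) \<in> T \<longrightarrow> u z = w) \<and> (\<forall>z. z \<notin> Domain T \<longrightarrow> u z = z)"
  proof (rule swap[of T])
    show "(w, z) \<in> T" if "(z, w) \<in> T" for z w
      using that by (auto simp: T_def)
    show "w = w'" if "(z, w) \<in> T" "(z, w') \<in> T" for z w w'
      using that S_S S'_S' S_S' S_S'[symmetric] unfolding T_def by (metis UnE converseD)
    have Vx: "clopen {y \<in> V. k y = x}" if "x \<in> X" for x
    proof -
      have "{y \<in> V. k y = x} = V \<inter> {y \<in> (\<Union>x\<in>X. N x). k y = x}" using V(3) by blast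
      then show ?thesis using V(1) k(2)[OF that] by (simp only: clopen_Int)
    qed
    show "\<exists>\<gamma>\<in>\<Gamma>. \<exists>U. open U \<and> z \<in> U \<and> (\<forall>z'\<in>U. (z', \<gamma> z') \<in> T)" if "(z, w) \<in> T" for z w
    proof -
      have "\<exists>\<phi>\<in>\<Phi>. \<exists>y\<in>V. z = \<phi> y \<or> z = \<phi> (m y)"
        using that by (auto simp: T_def S_def)
      then obtain \<phi> y where \<phi>: "\<phi> \<in> \<Phi>" "y \<in> V" "z = \<phi> y \<or> z = \<phi> (m y)" by blast
      let ?V = "{y' \<in> V. k y' = k y}" and ?c = "c (k y)"
      have \<phi>': "\<phi> \<in> \<Gamma>" using \<phi>(1) \<Phi>(2) by blast
      have cl: "clopen ?V" "?c \<in> \<Gamma>" using Vx kM(1,3) \<phi>(2) by auto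
      from \<phi>(3) show ?thesis
      proof
        assume z: "z = \<phi> y"
        show ?thesis
        proof (intro bexI exI conjI ballI)
          show "open (\<phi> ` ?V)" using clopen_mem_image[OF \<phi>' cl(1)] by (simp only: clopen_def)
          show "z \<in> \<phi> ` ?V" using z \<phi>(2) by blast
          show "(z', (\<phi> \<circ> (?c \<circ> inv \<phi>)) z') \<in> T" if z': "z' \<in> \<phi> ` ?V" for z'
          proof -
            obtain y' where "y' \<in> V" "k y' = k y" "z' = \<phi> y'" using z' by blast
            moreover from this have "(z', \<phi> (?c y')) \<in> S"
              using \<phi>(1) unfolding S_def m_def by (auto intro!: exI[of _ \<phi>] exI[of _ y'])
            ultimately show ?thesis using \<phi>' by (simp add: T_def)
          qed
          show "\<phi> \<circ> (?c \<circ> inv \<phi>) \<in> \<Gamma>" using \<phi>' cl(2) by (simp add: comp_mem inv_mem)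
        qed
      next
        assume z: "z = \<phi> (m y)"
        show ?thesis
        proof (intro bexI exI conjI ballI)
          show "open (\<phi> ` ?c ` ?V)"
            using clopen_mem_image[OF \<phi>' clopen_mem_image[OF cl(2,1)]] by (simp only: clopen_def)
          show "z \<in> \<phi> ` ?c ` ?V" using z \<phi>(2) by (auto simp: m_def)
          show "(z', (\<phi> \<circ> (inv ?c \<circ> inv \<phi>)) z') \<in> T" if z': "z' \<in> \<phi> ` ?c ` ?V" for z'
          proof -
            obtain y' where "y' \<in> V" "k y' = k y" "z' = \<phi> (?c y')" using z' by blast
            moreover from this have "(\<phi> y', z') \<in> S"
              using \<phi>(1) unfolding S_def m_def by (auto intro!: exI[of _ \<phi>] exI[of _ y'])
            ultimately show ?thesis using \<phi>' cl(2) by (simp add: T_def)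
          qed
          show "\<phi> \<circ> (inv ?c \<circ> inv \<phi>) \<in> \<Gamma>" using \<phi>' cl(2) by (simp add: comp_mem inv_mem)
        qed
      qed
    qed
    have "Domain T = (\<Union>\<phi>\<in>\<Phi>. \<phi> ` V) \<union> (\<Union>\<phi>\<in>\<Phi>. \<Union>x\<in>X. \<phi> ` c x ` {y \<in> V. k y = x})"
      (is "_ = ?R")
    proof
      show "Domain T \<subseteq> ?R"
      proof
        fix z assume "z \<in> Domain T"
        then obtain \<phi> y where \<phi>: "\<phi> \<in> \<Phi>" "y \<in> V" "z = \<phi> y \<or> z = \<phi> (c (k y) y)"
          unfolding T_def S_def m_def by blast
        from \<phi>(3) show "z \<in> ?R"
        proof
          assume "z = \<phi> y"
          with \<phi> show ?thesis by (intro UnI1) blast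
        next
          assume "z = \<phi> (c (k y) y)"
          then have "z \<in> \<phi> ` c (k y) ` {y' \<in> V. k y' = k y}"
            using \<phi>(2) by (auto intro!: imageI)
          then show ?thesis
            using \<phi>(1) kM(1)[OF \<phi>(2)] by (intro UnI2 UN_I)
        qed
      qed
      show "?R \<subseteq> Domain T"
      proof
        fix z assume "z \<in> ?R"
        then obtain \<phi> y where "\<phi> \<in> \<Phi>" "y \<in> V" "z = \<phi> y \<or> z = \<phi> (m y)"
          by (auto simp: m_def)
        then show "z \<in> Domain T" unfolding T_def S_def by blast
      qed
    qed
    moreover have "closed (\<phi> ` V)" if "\<phi> \<in> \<Phi>" for \<phi>
      using clopen_mem_image[OF _ V(1), of \<phi>] \<Phi>(2) that unfolding clopen_def by blast
    moreover have "closed (\<phi> ` c x ` {y \<in> V. k y = x})" if "\<phi> \<in> \<Phi>" "x \<in> X" for \<phi> x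
      using clopen_mem_image[OF _ clopen_mem_image[OF _ Vx[OF that(2)], of "c x"], of \<phi>] \<Phi>(2) that X(1) c(1)
      unfolding clopen_def by blast
    ultimately show "closed (Domain T)"
      using \<Phi>(1) X(2) by (auto intro!: closed_Un closed_UN)
  qed
  then obtain u where u: "u \<in> \<Gamma>" "\<And>z w. (z, w) \<in> T \<Longrightarrow> u z = w" "\<And>z. z \<notin> Domain T \<Longrightarrow> u z = z"
    by blast
  have T_act: "(\<phi> z, \<phi> w) \<in> T" if "(z, w) \<in> T" "\<phi> \<in> \<Phi>" for \<phi> z w
  proof -
    have "(\<phi> z, \<phi> w) \<in> S" if zw: "(z, w) \<in> S" for z w
    proof -
      from zw obtain \<phi>' y where "\<phi>' \<in> \<Phi>" "y \<in> V" "z = \<phi>' y" "w = \<phi>' (m y)"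
        by (auto simp: S_def)
      then show ?thesis
        using comp\<Phi>[OF \<open>\<phi> \<in> \<Phi>\<close>, of \<phi>'] unfolding S_def by (auto intro!: exI[of _ "\<phi> \<circ> \<phi>'"])
    qed
    then show ?thesis using that(1) unfolding T_def by blast
  qed
  have u_comm: "u (\<phi> x) = \<phi> (u x)" if \<phi>: "\<phi> \<in> \<Phi>" for \<phi> x
  proof (cases "x \<in> Domain T")
    case True
    then obtain w where "(x, w) \<in> T" by blast
    then show ?thesis using T_act[OF _ \<phi>] u(2) by metis
  next
    case False
    have "\<phi> x \<notin> Domain T"
    proof
      assume "\<phi> x \<in> Domain T"
      then obtain w where "(\<phi> x, w) \<in> T" by blast
      from T_act[OF this inv\<Phi>[OF \<phi>]] have "x \<in> Domain T"
        using \<phi> \<Phi>(2) by (auto simp: subset_iff)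
      with False show False ..
    qed
    then show ?thesis using False u(3) by metis
  qed
  have u_pres: "u x \<in> A \<longleftrightarrow> x \<in> A" if A: "A \<in> \<A>" for A x
  proof (cases "x \<in> Domain T")
    case True
    have "z \<in> A \<longleftrightarrow> w \<in> A" if "(z, w) \<in> S" for z w
      using that mF(4) A unfolding S_def same_def by blast
    moreover from True obtain w where "(x, w) \<in> T" by blast
    ultimately show ?thesis using u(2)[of x w] unfolding T_def by blast
  next
    case False
    then show ?thesis using u(3) by simp
  qed
  have "same \<Phi>' \<A>' (u (g x)) (h x)" if x: "x \<in> M" for x
  proof -
    have gx: "g x \<in> V" using x V(2) by blast
    then have "(g x, m (g x)) \<in> T"
      using id\<Phi> unfolding T_def S_def by (auto intro!: exI[of _ id])
    then have "u (g x) \<in> E (k (g x))"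
      using u(2) mF(3)[OF gx] by simp
    moreover have "h x \<in> E (k (g x))"
      using N(4)[OF kM(2)[OF gx] x] k(1) gx V(3) by blast
    ultimately show ?thesis
      unfolding E_def using same_sym same_trans by blast
  qed
  then have "approximates (u \<circ> g) \<Phi>' \<A>' h M M'"
    unfolding approximates_def using \<Phi>' \<A>'(1,2) F' u(1) g comp_mem by (auto simp: \<A>'_def)
  then show thesis
    using that u(1) u_comm u_pres \<Phi>'(2) \<A>'(3) by blast
qed

end

section \<open>Extending homeomorphisms between sparse sets\<close>

context minimal_ample_action
begin

text \<open>Conjugating and pulling back along g interchanges the two sides, so a single correction
  step serves both directions of the back-and-forth. \<open>M\<close> lies in the preimage of F
  because g x and h x have the same pattern.\<close>

lemma approximates_dual:
  assumes h: "homeomorphism M M' h h'" and st: "approximates g \<Phi> \<A> h M M'"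
  shows "approximates (inv g) ((\<lambda>\<phi>. inv g \<circ> (\<phi> \<circ> g)) ` \<Phi>) ((\<lambda>A. g -` A) ` \<A>) h' M' M"
proof -
  have g: "g \<in> \<Gamma>" and \<Phi>: "finite \<Phi>" "\<Phi> \<subseteq> \<Gamma>" "perm_group \<Phi>"
    and \<A>: "finite \<A>" "\<And>A. A \<in> \<A> \<Longrightarrow> clopen A" "\<And>\<delta>. \<delta> \<in> \<Phi> \<Longrightarrow> {x. \<delta> x = x} \<in> \<A>"
    and gh: "\<And>x. x \<in> M \<Longrightarrow> same \<Phi> \<A> (g x) (h x)"
    using st by (auto simp: approximates_def)
  from st obtain F where F: "F \<in> \<A>" "M' \<subseteq> F" "transversal \<Phi> F"
    by (auto simp: approximates_def)
  have id\<Phi>: "id \<in> \<Phi>" using \<Phi>(3) by (simp add: perm_group_def)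
  have h': "h' x \<in> M" "h (h' x) = x" if "x \<in> M'" for x
    using h that by (auto simp: homeomorphism_def)
  have hM: "h x \<in> M'" if "x \<in> M" for x
    using h that by (auto simp: homeomorphism_def)
  show ?thesis
    unfolding approximates_def
  proof (intro conjI)
    show "inv g \<in> \<Gamma>" using g by (rule inv_mem)
    show "finite ((\<lambda>\<phi>. inv g \<circ> (\<phi> \<circ> g)) ` \<Phi>)" "finite ((\<lambda>A. g -` A) ` \<A>)"
      using \<Phi>(1) \<A>(1) by simp_all
    show "(\<lambda>\<phi>. inv g \<circ> (\<phi> \<circ> g)) ` \<Phi> \<subseteq> \<Gamma>"
      using g \<Phi>(2) comp_mem inv_mem by blast
    show "perm_group ((\<lambda>\<phi>. inv g \<circ> (\<phi> \<circ> g)) ` \<Phi>)"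
      using \<Phi>(3) bij_mem[OF g] by (rule perm_group_conjugate)
    show "\<forall>A\<in>(\<lambda>A. g -` A) ` \<A>. clopen A"
      using \<A>(2) clopen_vimage[OF continuous_mem[OF g]] by blast
    show "\<forall>\<delta>\<in>(\<lambda>\<phi>. inv g \<circ> (\<phi> \<circ> g)) ` \<Phi>. {x. \<delta> x = x} \<in> (\<lambda>A. g -` A) ` \<A>"
    proof
      fix \<delta> assume "\<delta> \<in> (\<lambda>\<phi>. inv g \<circ> (\<phi> \<circ> g)) ` \<Phi>"
      then obtain \<phi> where \<phi>: "\<phi> \<in> \<Phi>" "\<delta> = inv g \<circ> (\<phi> \<circ> g)" by blast
      have "\<delta> x = x \<longleftrightarrow> \<phi> (g x) = g x" for x
        using \<phi>(2) g by (metis comp_apply f_inv_f inv_f_f)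
      then have "{x. \<delta> x = x} = g -` {x. \<phi> x = x}" by auto
      then show "{x. \<delta> x = x} \<in> (\<lambda>A. g -` A) ` \<A>" using \<A>(3)[OF \<phi>(1)] by blast
    qed
    have "M \<subseteq> g -` F"
    proof
      fix x assume x: "x \<in> M"
      then have "g x \<in> F \<longleftrightarrow> h x \<in> F"
        using gh[OF x] id\<Phi> F(1) unfolding same_def by fastforce
      then show "x \<in> g -` F" using F(2) hM[OF x] by blast
    qed
    moreover have "transversal ((\<lambda>\<phi>. inv g \<circ> (\<phi> \<circ> g)) ` \<Phi>) (g -` F)"
      unfolding transversal_def
    proof (intro ballI impI)
      fix \<gamma> y
      assume "\<gamma> \<in> (\<lambda>\<phi>. inv g \<circ> (\<phi> \<circ> g)) ` \<Phi>" and y: "y \<in> g -` F" "\<gamma> y \<in> g -` F"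
      then obtain \<phi> where \<phi>: "\<phi> \<in> \<Phi>" "\<gamma> = inv g \<circ> (\<phi> \<circ> g)" by blast
      with y g have "g y \<in> F" "\<phi> (g y) \<in> F" by auto
      then have "\<phi> (g y) = g y" using F(3) \<phi>(1) unfolding transversal_def by blast
      then show "\<gamma> y = y" using \<phi>(2) g by simp
    qed
    ultimately show "\<exists>Fa\<in>(\<lambda>A. g -` A) ` \<A>. M \<subseteq> Fa \<and> transversal ((\<lambda>\<phi>. inv g \<circ> (\<phi> \<circ> g)) ` \<Phi>) Fa"
      using F(1) by blast
    show "\<forall>x\<in>M'. same ((\<lambda>\<phi>. inv g \<circ> (\<phi> \<circ> g)) ` \<Phi>) ((\<lambda>A. g -` A) ` \<A>) (inv g x) (h' x)"
      using gh[OF h'(1)] h'(2) g by (auto simp: same_def)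
  qed
qed

text \<open>A forward step treats \<open>\<psi>\<close> and \<open>C\<close>; a second step, on the
  dual state, treats them on the other side. Dualizing back turns the second pair into a conjugate
  of \<open>\<psi>\<close> and a preimage of \<open>C\<close>, which is what control of the inverse
  map requires.\<close>

lemma approximates_double_step:
  assumes h: "homeomorphism M M' h h'" and sM: "sparse M" "sparse M'"
    and st: "approximates g \<Phi> \<A> h M M'" and new: "\<psi> \<in> \<Gamma>" "clopen C"
  shows "\<exists>u \<Phi>' \<A>'. u \<in> \<Gamma> \<and> approximates (u \<circ> g) \<Phi>' \<A>' h M M' \<and>
    insert \<psi> \<Phi> \<subseteq> \<Phi>' \<and> insert C \<A> \<subseteq> \<A>' \<and>
    u \<circ> g \<circ> (\<psi> \<circ> inv (u \<circ> g)) \<in> \<Phi>' \<and> inv (u \<circ> g) -` C \<in> \<A>' \<and>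
    (\<forall>\<phi>\<in>\<Phi>. \<forall>x. u (\<phi> x) = \<phi> (u x)) \<and> (\<forall>A\<in>\<A>. \<forall>x. u x \<in> A \<longleftrightarrow> x \<in> A)"
proof -
  have h1: "continuous_on M h" "h ` M = M'" and h2: "continuous_on M' h'" "h' ` M' = M"
    and h': "homeomorphism M' M h' h"
    using h by (auto simp: homeomorphism_def)
  have g: "g \<in> \<Gamma>" using st by (simp add: approximates_def)
  obtain u \<Phi>' \<A>' where u: "u \<in> \<Gamma>" "approximates (u \<circ> g) \<Phi>' \<A>' h M M'"
      "insert \<psi> \<Phi> \<subseteq> \<Phi>'" "insert C \<A> \<subseteq> \<A>'"
      "\<And>\<phi> x. \<phi> \<in> \<Phi> \<Longrightarrow> u (\<phi> x) = \<phi> (u x)" "\<And>A x. A \<in> \<A> \<Longrightarrow> u x \<in> A \<longleftrightarrow> x \<in> A"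
    using approximates_step[OF h1 sM st new] by blast
  define k where "k = u \<circ> g"
  have k: "k \<in> \<Gamma>" using u(1) g by (simp add: k_def comp_mem)
  let ?\<Phi> = "(\<lambda>\<phi>. inv k \<circ> (\<phi> \<circ> k)) ` \<Phi>'" and ?\<A> = "(\<lambda>A. k -` A) ` \<A>'"
  obtain v \<Phi>'' \<A>'' where v: "v \<in> \<Gamma>" "approximates (v \<circ> inv k) \<Phi>'' \<A>'' h' M' M"
      "insert \<psi> ?\<Phi> \<subseteq> \<Phi>''" "insert C ?\<A> \<subseteq> \<A>''"
      "\<And>\<phi> x. \<phi> \<in> ?\<Phi> \<Longrightarrow> v (\<phi> x) = \<phi> (v x)" "\<And>A x. A \<in> ?\<A> \<Longrightarrow> v x \<in> A \<longleftrightarrow> x \<in> A"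
    using approximates_step[OF h2 sM(2,1) approximates_dual[OF h u(2)] new] unfolding k_def by blast
  \<comment> \<open>The factor \<open>inv k \<circ> u\<close> equals \<open>inv g\<close>, so w is
    the correction that turns g into \<open>k \<circ> inv v\<close>, the inverse of the map reached
    by the second step.\<close>
  define w where "w = k \<circ> (inv v \<circ> (inv k \<circ> u))"
  have w: "w \<in> \<Gamma>" using k v(1) u(1) by (simp add: w_def comp_mem inv_mem)
  have wg: "w \<circ> g = k \<circ> inv v"
  proof (rule ext)
    fix x
    have "u (g x) = k x" by (simp add: k_def)
    then show "(w \<circ> g) x = (k \<circ> inv v) x" using k by (simp add: w_def)
  qed
  have inv_wg: "inv (w \<circ> g) = v \<circ> inv k"
    unfolding wg using k v(1) by (intro inv_unique_comp) (auto simp: fun_eq_iff)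
  have inv_vk: "inv (v \<circ> inv k) = w \<circ> g"
    unfolding wg using k v(1) by (intro inv_unique_comp) (auto simp: fun_eq_iff)
  let ?\<Phi>' = "(\<lambda>\<phi>. w \<circ> g \<circ> (\<phi> \<circ> (v \<circ> inv k))) ` \<Phi>''" and ?\<A>' = "(\<lambda>A. (v \<circ> inv k) -` A) ` \<A>''"
  have ap: "approximates (w \<circ> g) ?\<Phi>' ?\<A>' h M M'"
    using approximates_dual[OF h' v(2)] unfolding inv_vk .
  have \<Phi>'\<Gamma>: "\<Phi>' \<subseteq> \<Gamma>" using u(2) by (simp add: approximates_def)
  have v_comm: "v (inv k (\<phi> (k x))) = inv k (\<phi> (k (v x)))" if "\<phi> \<in> \<Phi>'" for \<phi> x
    using v(5)[of "inv k \<circ> (\<phi> \<circ> k)"] that by auto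
  have v_comm': "k (inv v (inv k (\<phi> (k (v x))))) = \<phi> (k x)" if "\<phi> \<in> \<Phi>'" for \<phi> x
    using v_comm[OF that, of x, symmetric] v(1) k by simp
  have v_pres: "k (v x) \<in> A \<longleftrightarrow> k x \<in> A" if "A \<in> \<A>'" for A x
    using v(6)[of "k -` A" x] that by auto
  \<comment> \<open>Since v commutes with the conjugates of \<open>\<Phi>'\<close> by k, conjugating
    them back along the corrected map returns the original elements, so nothing treated before is
    lost.\<close>
  have incl: "\<Phi>' \<subseteq> ?\<Phi>'"
  proof
    fix \<phi> assume \<phi>: "\<phi> \<in> \<Phi>'"
    have "\<phi> = w \<circ> g \<circ> ((inv k \<circ> (\<phi> \<circ> k)) \<circ> (v \<circ> inv k))"
    proof (rule ext)
      fix x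
      show "\<phi> x = (w \<circ> g \<circ> ((inv k \<circ> (\<phi> \<circ> k)) \<circ> (v \<circ> inv k))) x"
        using v_comm'[OF \<phi>, of "inv k x"] k unfolding wg by simp
    qed
    moreover have "inv k \<circ> (\<phi> \<circ> k) \<in> \<Phi>''"
      using v(3) imageI[OF \<phi>, of "\<lambda>\<phi>. inv k \<circ> (\<phi> \<circ> k)"] by (meson insert_subset subsetD)
    ultimately show "\<phi> \<in> ?\<Phi>'" by (rule image_eqI)
  qed
  have inclA: "\<A>' \<subseteq> ?\<A>'"
  proof
    fix A assume A: "A \<in> \<A>'"
    have "A = (v \<circ> inv k) -` (k -` A)"
    proof (rule Set.set_eqI)
      fix x
      show "x \<in> A \<longleftrightarrow> x \<in> (v \<circ> inv k) -` (k -` A)"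
        using v_pres[OF A, of "inv k x"] k by simp
    qed
    moreover have "k -` A \<in> \<A>''"
      using v(4) imageI[OF A, of "\<lambda>A. k -` A"] by (meson insert_subset subsetD)
    ultimately show "A \<in> ?\<A>'" by (rule image_eqI)
  qed
  have w_comm: "w (\<phi> x) = \<phi> (w x)" if "\<phi> \<in> \<Phi>" for \<phi> x
  proof -
    have \<phi>: "\<phi> \<in> \<Phi>'" using that u(3) by blast
    show ?thesis
      using v_comm'[OF \<phi>, of "inv v (inv k (u x))"] u(5)[OF that] k v(1) by (simp add: w_def)
  qed
  have w_pres: "w x \<in> A \<longleftrightarrow> x \<in> A" if "A \<in> \<A>" for A x
  proof -
    have A: "A \<in> \<A>'" using that u(4) by blast
    show ?thesis
      using v_pres[OF A, of "inv v (inv k (u x))"] u(6)[OF that] k v(1) by (simp add: w_def)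
  qed
  have "\<psi> \<in> \<Phi>''" "C \<in> \<A>''" using v(3,4) by auto
  then have "w \<circ> g \<circ> (\<psi> \<circ> inv (w \<circ> g)) \<in> ?\<Phi>'" "inv (w \<circ> g) -` C \<in> ?\<A>'"
    unfolding inv_wg by (auto intro!: imageI)
  then show ?thesis
    using w ap order_trans[OF u(3) incl] order_trans[OF u(4) inclA] w_comm w_pres
    by (intro exI[of _ w] exI[of _ ?\<Phi>'] exI[of _ ?\<A>'] conjI ballI allI)
qed

text \<open>\<open>UNIV\<close> serves twice: as the fixed-point set of \<open>id\<close> and as a
  set transversal to the trivial group.\<close>

lemma approximates_initial:
  "approximates id {id} {UNIV} h M M'"
  by (auto simp: approximates_def id_mem perm_group_def transversal_def same_def)

text \<open>The stages converge because every coordinate is eventually settled, for the maps and for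
  their inverses. Later corrections commute with \<open>\<Phi> n\<close>, so the limit conjugates
  elements of \<open>\<Phi> n\<close> as g n does. Every \<gamma> and a suitable conjugate of it
  enter some \<open>\<Phi> n\<close>, which gives both directions of normalization.\<close>

lemma extension_exists:
  assumes h: "homeomorphism M M' h h'" and sM: "sparse M" "sparse M'"
  shows "\<exists>g\<in>Homeo UNIV. (\<forall>x\<in>M. g x = h x) \<and>
    (\<forall>\<gamma>\<in>\<Gamma>. inv g \<circ> (\<gamma> \<circ> g) \<in> \<Gamma> \<and> g \<circ> (\<gamma> \<circ> inv g) \<in> \<Gamma>)"
proof -
  define \<psi> where "\<psi> = from_nat_into \<Gamma>"
  have \<psi>: "\<psi> n \<in> \<Gamma>" for n
    unfolding \<psi>_def using id_mem by (intro from_nat_into) auto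
  have \<psi>_surj: "\<exists>n. \<psi> n = \<gamma>" if "\<gamma> \<in> \<Gamma>" for \<gamma>
    using ample that unfolding \<psi>_def ample_def by (metis from_nat_into_surj)
  \<comment> \<open>The coordinate sets separate points, so treating each of them once determines
    the limit map.\<close>
  define C where "C i = {x. e x i}" for i
  have "\<exists>s. \<forall>n. (case s n of (g, \<Phi>, \<A>) \<Rightarrow> approximates g \<Phi> \<A> h M M') \<and>
      (case (s n, s (Suc n)) of ((g, \<Phi>, \<A>), (g', \<Phi>', \<A>')) \<Rightarrow>
        \<exists>u\<in>\<Gamma>. g' = u \<circ> g \<and> insert (\<psi> n) \<Phi> \<subseteq> \<Phi>' \<and> insert (C n) \<A> \<subseteq> \<A>' \<and>
          g' \<circ> (\<psi> n \<circ> inv g') \<in> \<Phi>' \<and> inv g' -` C n \<in> \<A>' \<and>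
          (\<forall>\<phi>\<in>\<Phi>. \<forall>x. u (\<phi> x) = \<phi> (u x)) \<and> (\<forall>A\<in>\<A>. \<forall>x. u x \<in> A \<longleftrightarrow> x \<in> A))"
    (is "\<exists>s. \<forall>n. ?P (s n) \<and> ?Q n (s n) (s (Suc n))")
  proof (rule dependent_nat_choice)
    show "\<exists>s. ?P s" using approximates_initial[of h M M'] by (intro exI[of _ "(id, {id}, {UNIV})"]) simp
    fix s n assume "?P s"
    moreover obtain g \<Phi> \<A> where s: "s = (g, \<Phi>, \<A>)" by (cases s)
    ultimately have "approximates g \<Phi> \<A> h M M'" by simp
    moreover have "clopen (C n)" by (simp add: C_def clopen_e)
    ultimately have "\<exists>u \<Phi>' \<A>'. u \<in> \<Gamma> \<and> approximates (u \<circ> g) \<Phi>' \<A>' h M M' \<and>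
      insert (\<psi> n) \<Phi> \<subseteq> \<Phi>' \<and> insert (C n) \<A> \<subseteq> \<A>' \<and>
      u \<circ> g \<circ> (\<psi> n \<circ> inv (u \<circ> g)) \<in> \<Phi>' \<and> inv (u \<circ> g) -` C n \<in> \<A>' \<and>
      (\<forall>\<phi>\<in>\<Phi>. \<forall>x. u (\<phi> x) = \<phi> (u x)) \<and> (\<forall>A\<in>\<A>. \<forall>x. u x \<in> A \<longleftrightarrow> x \<in> A)"
      using approximates_double_step[OF h sM _ \<psi>] by (simp only:)
    then
    obtain u \<Phi>' \<A>' where "u \<in> \<Gamma>" "approximates (u \<circ> g) \<Phi>' \<A>' h M M'"
      "insert (\<psi> n) \<Phi> \<subseteq> \<Phi>'" "insert (C n) \<A> \<subseteq> \<A>'"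
      "u \<circ> g \<circ> (\<psi> n \<circ> inv (u \<circ> g)) \<in> \<Phi>'" "inv (u \<circ> g) -` C n \<in> \<A>'"
      "\<forall>\<phi>\<in>\<Phi>. \<forall>x. u (\<phi> x) = \<phi> (u x)" "\<forall>A\<in>\<A>. \<forall>x. u x \<in> A \<longleftrightarrow> x \<in> A"
      by (elim exE conjE)
    then have "?P (u \<circ> g, \<Phi>', \<A>')" "?Q n s (u \<circ> g, \<Phi>', \<A>')"
      unfolding s prod.case by - (assumption, intro bexI[of _ u] conjI refl)
    then show "\<exists>s'. ?P s' \<and> ?Q n s s'"
      by (intro exI[of _ "(u \<circ> g, \<Phi>', \<A>')"] conjI)
  qed
  then obtain s where s': "\<forall>n. ?P (s n) \<and> ?Q n (s n) (s (Suc n))" ..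
  note s = conjunct1[OF s'[rule_format]] conjunct2[OF s'[rule_format]]
  define g \<Phi> \<A> where "g n = fst (s n)" and "\<Phi> n = fst (snd (s n))" and "\<A> n = snd (snd (s n))" for n
  have ap: "approximates (g n) (\<Phi> n) (\<A> n) h M M'" for n
    using s(1)[of n] by (simp add: g_def \<Phi>_def \<A>_def split: prod.splits)
  have succ: "\<exists>u\<in>\<Gamma>. g (Suc n) = u \<circ> g n \<and> insert (\<psi> n) (\<Phi> n) \<subseteq> \<Phi> (Suc n) \<and>
      insert (C n) (\<A> n) \<subseteq> \<A> (Suc n) \<and>
      g (Suc n) \<circ> (\<psi> n \<circ> inv (g (Suc n))) \<in> \<Phi> (Suc n) \<and> inv (g (Suc n)) -` C n \<in> \<A> (Suc n) \<and>
      (\<forall>\<phi>\<in>\<Phi> n. \<forall>x. u (\<phi> x) = \<phi> (u x)) \<and> (\<forall>A\<in>\<A> n. \<forall>x. u x \<in> A \<longleftrightarrow> x \<in> A)" for n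
    using s(2)[of n] by (simp add: g_def \<Phi>_def \<A>_def split: prod.splits)
  have g: "g n \<in> \<Gamma>" for n using ap by (simp add: approximates_def)
  have later: "\<exists>w\<in>\<Gamma>. g k = w \<circ> g n \<and> \<Phi> n \<subseteq> \<Phi> k \<and> \<A> n \<subseteq> \<A> k \<and>
      (\<forall>\<phi>\<in>\<Phi> n. \<forall>x. w (\<phi> x) = \<phi> (w x)) \<and> (\<forall>A\<in>\<A> n. \<forall>x. w x \<in> A \<longleftrightarrow> x \<in> A)" if "n \<le> k" for n k
    using that
  proof (induction k rule: dec_induct)
    case base
    show ?case by (rule bexI[OF _ id_mem]) simp
  next
    case (step k)
    from step.IH obtain w where w: "w \<in> \<Gamma>" "g k = w \<circ> g n" "\<Phi> n \<subseteq> \<Phi> k" "\<A> n \<subseteq> \<A> k"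
      "\<forall>\<phi>\<in>\<Phi> n. \<forall>x. w (\<phi> x) = \<phi> (w x)" "\<forall>A\<in>\<A> n. \<forall>x. w x \<in> A \<longleftrightarrow> x \<in> A"
      by (elim bexE conjE)
    obtain u where u: "u \<in> \<Gamma>" "g (Suc k) = u \<circ> g k" "insert (\<psi> k) (\<Phi> k) \<subseteq> \<Phi> (Suc k)"
      "insert (C k) (\<A> k) \<subseteq> \<A> (Suc k)" "\<forall>\<phi>\<in>\<Phi> k. \<forall>x. u (\<phi> x) = \<phi> (u x)" "\<forall>A\<in>\<A> k. \<forall>x. u x \<in> A \<longleftrightarrow> x \<in> A"
      using succ[of k] by (elim bexE conjE)
    show ?case
    proof (intro bexI[of _ "u \<circ> w"] conjI ballI allI)
      show "g (Suc k) = u \<circ> w \<circ> g n" using u(2) w(2) by (simp add: comp_assoc)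
      show "\<Phi> n \<subseteq> \<Phi> (Suc k)" "\<A> n \<subseteq> \<A> (Suc k)" using u(3,4) w(3,4) by auto
      show "(u \<circ> w) (\<phi> x) = \<phi> ((u \<circ> w) x)" if "\<phi> \<in> \<Phi> n" for \<phi> x
        using w(5) bspec[OF u(5) subsetD[OF w(3) that]] that by simp
      show "(u \<circ> w) x \<in> A \<longleftrightarrow> x \<in> A" if "A \<in> \<A> n" for A x
        using w(6) bspec[OF u(6) subsetD[OF w(4) that]] that by simp
      show "u \<circ> w \<in> \<Gamma>" using u(1) w(1) by (rule comp_mem)
    qed
  qed
  have stable: "e (g k x) i \<longleftrightarrow> e (g (Suc i) x) i" "e (inv (g k) x) i \<longleftrightarrow> e (inv (g (Suc i)) x) i"
    if k: "Suc i \<le> k" for i k x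
  proof -
    obtain w where w: "w \<in> \<Gamma>" "g k = w \<circ> g (Suc i)" "\<forall>A\<in>\<A> (Suc i). \<forall>x. w x \<in> A \<longleftrightarrow> x \<in> A"
      using later[OF k] by (elim bexE conjE)
    have CA: "C i \<in> \<A> (Suc i)" "inv (g (Suc i)) -` C i \<in> \<A> (Suc i)"
      using succ[of i] by auto
    show "e (g k x) i \<longleftrightarrow> e (g (Suc i) x) i"
      using bspec[OF w(3) CA(1)] w(2) by (simp add: C_def)
    \<comment> \<open>The preimage of \<open>C i\<close> under the inverse of stage
      \<open>Suc i\<close> is itself in \<open>\<A> (Suc i)\<close> and hence preserved by w, so
      \<open>inv w\<close> does not affect the coordinate.\<close>
    have "inv (g k) x = inv (g (Suc i)) (inv w x)"
      using g[of "Suc i"] w(1) by (metis bij_mem comp_apply f_inv_f g inv_f_f w(2))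
    then show "e (inv (g k) x) i \<longleftrightarrow> e (inv (g (Suc i)) x) i"
      using bspec[OF w(3) CA(2), THEN spec, of "inv w x"] w(1) by (simp add: C_def)
  qed
  \<comment> \<open>A diagonal limit: coordinate i is treated in the step from i to
    \<open>Suc i\<close>, so it is read at stage \<open>Suc i\<close>, from which on it is
    final.\<close>
  define G where "G x = e' (\<lambda>i. e (g (Suc i) x) i)" for x
  define H where "H x = e' (\<lambda>i. e (inv (g (Suc i)) x) i)" for x
  have eG: "e (G x) i \<longleftrightarrow> e (g (Suc i) x) i" and eH: "e (H x) i \<longleftrightarrow> e (inv (g (Suc i)) x) i" for x i
    by (simp_all add: G_def H_def)
  have contG: "continuous_on UNIV G"
  proof (rule continuous_on_UNIV_I)
    show "clopen {x. e (G x) i}" for i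
      unfolding eG using clopen_mem_vimage[OF g clopen_e, of "Suc i" i] by (simp only: mem_Collect_eq)
  qed
  have contH: "continuous_on UNIV H"
  proof (rule continuous_on_UNIV_I)
    show "clopen {x. e (H x) i}" for i
      unfolding eH using clopen_mem_vimage[OF inv_mem[OF g] clopen_e, of "Suc i" i] by (simp only: mem_Collect_eq)
  qed
  have near: "\<exists>n. \<forall>k\<ge>n. g k x \<in> U" if U: "open U" "G x \<in> U" for U x
  proof -
    obtain n where n: "cyl (G x) n \<subseteq> U" using open_contains_cyl[OF U] by blast
    have "g k x \<in> cyl (G x) n" if "k \<ge> n" for k
      using that stable(1)[of _ k x] by (simp add: cyl_def eG)
    then show ?thesis using n by blast
  qed
  have near': "\<exists>n. \<forall>k\<ge>n. inv (g k) x \<in> U" if U: "open U" "H x \<in> U" for U x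
  proof -
    obtain n where n: "cyl (H x) n \<subseteq> U" using open_contains_cyl[OF U] by blast
    have "inv (g k) x \<in> cyl (H x) n" if "k \<ge> n" for k
      using that stable(2)[of _ k x] by (simp add: cyl_def eH)
    then show ?thesis using n by blast
  qed
  have agree: "open {z. e (f z) i \<longleftrightarrow> e (f y) i}" if "f \<in> \<Gamma>" for f i y
  proof -
    have "clopen {z. e (f z) i \<longleftrightarrow> e (f y) i}"
      using clopen_mem_vimage[OF that clopen_e[of i]] by (intro clopen_Collect_eq) (auto split: if_splits)
    then show ?thesis by (simp add: clopen_def)
  qed
  \<comment> \<open>The value of coordinate i at H x is already attained at
    \<open>inv (g k) x\<close> for late k. There stage \<open>Suc i\<close> may be replaced by stage
    k, and g k cancels its inverse.\<close>
  have GH: "G (H x) = x" for x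
  proof (rule separation)
    fix i
    obtain n where n: "\<forall>k\<ge>n. inv (g k) x \<in> {z. e (g (Suc i) z) i \<longleftrightarrow> e (g (Suc i) (H x)) i}"
      using near'[OF agree[OF g[of "Suc i"], of i "H x"]] by blast
    define k where "k = max n (Suc i)"
    have "e (G (H x)) i \<longleftrightarrow> e (g (Suc i) (inv (g k) x)) i"
      using n by (auto simp: eG k_def)
    also have "\<dots> \<longleftrightarrow> e (g k (inv (g k) x)) i"
      using stable(1)[of i k "inv (g k) x"] by (simp add: k_def)
    finally show "e (G (H x)) i = e x i" using g by simp
  qed
  have HG: "H (G x) = x" for x
  proof (rule separation)
    fix i
    obtain n where n: "\<forall>k\<ge>n. g k x \<in> {z. e (inv (g (Suc i)) z) i \<longleftrightarrow> e (inv (g (Suc i)) (G x)) i}"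
      using near[OF agree[OF inv_mem[OF g[of "Suc i"]], of i "G x"]] by blast
    define k where "k = max n (Suc i)"
    have "e (H (G x)) i \<longleftrightarrow> e (inv (g (Suc i)) (g k x)) i"
      using n by (auto simp: eH k_def)
    also have "\<dots> \<longleftrightarrow> e (inv (g k) (g k x)) i"
      using stable(2)[of i k "g k x"] by (simp add: k_def)
    finally show "e (H (G x)) i = e x i" using g by simp
  qed
  have bijG: "bij G" using GH HG by (metis bijI')
  have invG: "inv G = H"
    using GH HG by (intro inv_unique_comp) (auto simp: fun_eq_iff)
  \<comment> \<open>The correction leading from stage n to a late stage k commutes with \<phi>, so
    the identity holds exactly with g k in place of G; continuity of \<phi> then passes it to the
    limit.\<close>
  have conj: "G (inv (g n) (\<phi> (g n x))) = \<phi> (G x)" if \<phi>: "\<phi> \<in> \<Phi> n" for \<phi> n x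
  proof (rule separation)
    fix i
    have \<phi>\<Gamma>: "\<phi> \<in> \<Gamma>" using \<phi> ap[of n] by (auto simp: approximates_def)
    obtain m where m: "\<forall>k\<ge>m. g k x \<in> {z. e (\<phi> z) i \<longleftrightarrow> e (\<phi> (G x)) i}"
      using near[OF agree[OF \<phi>\<Gamma>, of i "G x"]] by blast
    define k where "k = max (max n m) (Suc i)"
    have k: "n \<le> k" "m \<le> k" "Suc i \<le> k" by (simp_all add: k_def)
    obtain w where w: "w \<in> \<Gamma>" "g k = w \<circ> g n" "\<forall>\<phi>\<in>\<Phi> n. \<forall>x. w (\<phi> x) = \<phi> (w x)"
      using later[OF k(1)] by (elim bexE conjE)
    have "e (G (inv (g n) (\<phi> (g n x)))) i \<longleftrightarrow> e (g k (inv (g n) (\<phi> (g n x)))) i"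
      using stable(1)[OF k(3)] by (simp add: eG)
    also have "g k (inv (g n) (\<phi> (g n x))) = \<phi> (g k x)"
      using bspec[OF w(3) \<phi>] w(1,2) g[of n] by simp
    also have "e (\<phi> (g k x)) i \<longleftrightarrow> e (\<phi> (G x)) i"
      using m k(2) by blast
    finally show "e (G (inv (g n) (\<phi> (g n x)))) i = e (\<phi> (G x)) i" .
  qed
  show ?thesis
  proof (intro bexI conjI ballI)
    show "G \<in> Homeo UNIV"
      using bijG contG contH invG by (simp add: Homeo_UNIV_iff)
    show "G x = h x" if x: "x \<in> M" for x
    proof (rule separation)
      fix i
      have "same (\<Phi> (Suc i)) (\<A> (Suc i)) (g (Suc i) x) (h x)" "id \<in> \<Phi> (Suc i)"
        using ap[of "Suc i"] x by (auto simp: approximates_def perm_group_def)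
      moreover have "C i \<in> \<A> (Suc i)" using succ[of i] by auto
      ultimately have "g (Suc i) x \<in> C i \<longleftrightarrow> h x \<in> C i"
        unfolding same_def by (metis id_apply)
      then show "e (G x) i = e (h x) i" by (simp add: eG C_def)
    qed
    fix \<gamma> assume \<gamma>: "\<gamma> \<in> \<Gamma>"
    then obtain n where n: "\<psi> n = \<gamma>" using \<psi>_surj by blast
    let ?g = "g (Suc n)"
    have \<Phi>: "\<gamma> \<in> \<Phi> (Suc n)" "?g \<circ> (\<gamma> \<circ> inv ?g) \<in> \<Phi> (Suc n)" using succ[of n] n by auto
    have "inv G \<circ> (\<gamma> \<circ> G) = inv ?g \<circ> (\<gamma> \<circ> ?g)"
    proof (rule ext)
      fix x
      have "H (\<gamma> (G x)) = H (G (inv ?g (\<gamma> (?g x))))" using conj[OF \<Phi>(1), of x] by simp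
      then show "(inv G \<circ> (\<gamma> \<circ> G)) x = (inv ?g \<circ> (\<gamma> \<circ> ?g)) x" by (simp add: invG HG)
    qed
    then show "inv G \<circ> (\<gamma> \<circ> G) \<in> \<Gamma>" using \<gamma> g[of "Suc n"] by (simp add: comp_mem inv_mem)
    \<comment> \<open>Here \<open>conj\<close> is applied to the stored conjugate of \<gamma>, whose
      outer factors cancel against the stage map, leaving \<gamma> between G and H.\<close>
    have "G \<circ> (\<gamma> \<circ> inv G) = ?g \<circ> (\<gamma> \<circ> inv ?g)"
    proof (rule ext)
      fix x
      show "(G \<circ> (\<gamma> \<circ> inv G)) x = (?g \<circ> (\<gamma> \<circ> inv ?g)) x"
        using conj[OF \<Phi>(2), of "H x"] g[of "Suc n"] by (simp add: invG GH)
    qed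
    then show "G \<circ> (\<gamma> \<circ> inv G) \<in> \<Gamma>" using \<gamma> g[of "Suc n"] by (simp add: comp_mem inv_mem)
  qed
qed

end

section \<open>Splitting the orbits through a sparse set\<close>

context minimal_ample_action
begin

text \<open>Nonempty open sets are infinite, so the orbit of x meets C outside the finite set S x.
  Agreement sets are clopen, hence each choice of \<gamma> works on a neighbourhood, and compactness
  makes finitely many choices suffice for all x.\<close>

lemma finite_escape:
  assumes S: "finite S" "S \<subseteq> \<Gamma>" and C: "open C" "C \<noteq> {}"
  shows "\<exists>A. finite A \<and> A \<subseteq> \<Gamma> \<and> (\<forall>x. \<exists>\<gamma>\<in>A. \<gamma> x \<in> C \<and> (\<forall>s\<in>S. \<gamma> x \<noteq> s x))"
proof -
  define U where "U \<gamma> = {x. \<gamma> x \<in> C} \<inter> (\<Inter>s\<in>S. - {x. \<gamma> x = s x})" for \<gamma>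
  have U: "open (U \<gamma>)" if "\<gamma> \<in> \<Gamma>" for \<gamma>
  proof -
    have "open {x. \<gamma> x \<in> C}"
      using open_vimage[OF C(1) continuous_mem[OF that]] by (simp add: vimage_def)
    moreover have "open (- {x. \<gamma> x = s x})" if "s \<in> S" for s
      using clopen_eq[OF \<open>\<gamma> \<in> \<Gamma>\<close>, of s] S(2) that by (auto simp: clopen_def open_Compl)
    ultimately show ?thesis
      unfolding U_def using S(1) by (intro open_Int open_INT) auto
  qed
  have cov: "UNIV \<subseteq> (\<Union>\<gamma>\<in>\<Gamma>. U \<gamma>)"
  proof
    fix x
    have "open (C - (\<lambda>s. s x) ` S)"
      using open_Int[OF C(1) open_Compl_finite, of "(\<lambda>s. s x) ` S"] S(1) by (simp add: Diff_eq)
    moreover have "C - (\<lambda>s. s x) ` S \<noteq> {}"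
      using open_diff_finite_nonempty[OF C] S(1) by simp
    ultimately obtain \<gamma> where "\<gamma> \<in> \<Gamma>" "\<gamma> x \<in> C - (\<lambda>s. s x) ` S"
      using orbit_meets_open by meson
    then show "x \<in> (\<Union>\<gamma>\<in>\<Gamma>. U \<gamma>)" by (auto simp: U_def)
  qed
  obtain A where A: "A \<subseteq> \<Gamma>" "finite A" "UNIV \<subseteq> (\<Union>\<gamma>\<in>A. U \<gamma>)"
    by (rule compactE_image[OF compact_UNIV U cov])
  have "\<exists>\<gamma>\<in>A. \<gamma> x \<in> C \<and> (\<forall>s\<in>S. \<gamma> x \<noteq> s x)" for x
  proof -
    obtain \<gamma> where "\<gamma> \<in> A" "x \<in> U \<gamma>" using A(3) by blast
    then show ?thesis by (auto simp: U_def)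
  qed
  then show ?thesis using A by blast
qed

text \<open>Serves a parity count of stages. As \<open>S 0\<close> is trivial and \<tau> enters at
  stage 1, a point moved by \<tau> has its image at stage exactly 1. The last clause provides, near
  every z, points first reached at stage exactly \<open>Suc n\<close>, so that either parity will be
  dense.\<close>

lemma exhaustion:
  assumes \<tau>: "\<tau> \<in> \<Gamma>"
  obtains S :: "nat \<Rightarrow> ('a \<Rightarrow> 'a) set" where
    "S 0 = {id}" "\<tau> \<in> S 1" "\<And>n. finite (S n)" "\<And>n. perm_group (S n)" "\<And>n. S n \<subseteq> \<Gamma>"
    "\<And>m n. m \<le> n \<Longrightarrow> S m \<subseteq> S n" "\<And>\<gamma>. \<gamma> \<in> \<Gamma> \<Longrightarrow> \<exists>n. \<gamma> \<in> S n"
    "\<And>n x z. \<exists>\<gamma>\<in>S (Suc n). \<gamma> x \<in> cyl z n \<and> (\<forall>s\<in>S n. \<gamma> x \<noteq> s x)"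
proof -
  define \<psi> where "\<psi> = from_nat_into \<Gamma>"
  have \<psi>: "\<psi> n \<in> \<Gamma>" for n
    unfolding \<psi>_def using id_mem by (intro from_nat_into) auto
  have \<psi>_surj: "\<exists>n. \<psi> n = \<gamma>" if "\<gamma> \<in> \<Gamma>" for \<gamma>
    using ample that unfolding \<psi>_def ample_def by (metis from_nat_into_surj)
  define P where "P n S \<longleftrightarrow> finite S \<and> perm_group S \<and> S \<subseteq> \<Gamma> \<and> (n = 0 \<longrightarrow> S = {id})"
    for n :: nat and S :: "('a \<Rightarrow> 'a) set"
  define Q where "Q n S S' \<longleftrightarrow> insert \<tau> (insert (\<psi> n) S) \<subseteq> S' \<and>
      (\<forall>x z. \<exists>\<gamma>\<in>S'. \<gamma> x \<in> cyl z n \<and> (\<forall>s\<in>S. \<gamma> x \<noteq> s x))" for n and S S' :: "('a \<Rightarrow> 'a) set"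
  have "\<exists>S. \<forall>n. P n (S n) \<and> Q n (S n) (S (Suc n))"
  proof (rule dependent_nat_choice)
    show "\<exists>S. P 0 S"
      using id_mem by (intro exI[of _ "{id}"]) (simp add: P_def perm_group_def)
    fix S n assume "P n S"
    then have S: "finite S" "perm_group S" "S \<subseteq> \<Gamma>" by (auto simp: P_def)
    have "\<exists>A. finite A \<and> A \<subseteq> \<Gamma> \<and> (\<forall>x. \<exists>\<gamma>\<in>A. \<gamma> x \<in> C \<and> (\<forall>s\<in>S. \<gamma> x \<noteq> s x))"
      if C: "C \<in> range (\<lambda>z. cyl z n)" for C
    proof (rule finite_escape[OF S(1,3)])
      from C obtain z where z: "C = cyl z n" by blast
      show "open C" using clopen_cyl[of z n] by (simp add: z clopen_def)
      show "C \<noteq> {}" using cyl_self[of z n] by (auto simp: z simp del: cyl_self)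
    qed
    then have "\<forall>C\<in>range (\<lambda>z. cyl z n). \<exists>A. finite A \<and> A \<subseteq> \<Gamma> \<and>
        (\<forall>x. \<exists>\<gamma>\<in>A. \<gamma> x \<in> C \<and> (\<forall>s\<in>S. \<gamma> x \<noteq> s x))"
      by (rule ballI)
    then obtain A where "\<forall>C\<in>range (\<lambda>z. cyl z n). finite (A C) \<and> A C \<subseteq> \<Gamma> \<and>
        (\<forall>x. \<exists>\<gamma>\<in>A C. \<gamma> x \<in> C \<and> (\<forall>s\<in>S. \<gamma> x \<noteq> s x))"
      unfolding bchoice_iff ..
    note A = conjunct1[OF bspec[OF this]] conjunct1[OF conjunct2[OF bspec[OF this]]]
      conjunct2[OF conjunct2[OF bspec[OF this]], THEN spec]
    \<comment> \<open>There are finitely many cylinders of length n, so one finite set of escaping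
      elements serves all z at once.\<close>
    let ?A = "insert \<tau> (insert (\<psi> n) S) \<union> (\<Union>C\<in>range (\<lambda>z. cyl z n). A C)"
    have "finite ?A" using A(1) S(1) finite_cyl[of n] by blast
    moreover have "?A \<subseteq> \<Gamma>" using A(2) S(3) \<tau> \<psi> by blast
    ultimately obtain S' where S': "finite S'" "?A \<subseteq> S'" "S' \<subseteq> \<Gamma>" "perm_group S'"
      by (rule finite_subgroup)
    have "\<exists>\<gamma>\<in>S'. \<gamma> x \<in> cyl z n \<and> (\<forall>s\<in>S. \<gamma> x \<noteq> s x)" for x z
      using A(3)[of "cyl z n" x] S'(2) by blast
    then show "\<exists>S'. P (Suc n) S' \<and> Q n S S'"
      using S' by (intro exI[of _ S']) (simp add: P_def Q_def)
  qed
  then obtain S where S: "\<And>n. P n (S n)" "\<And>n. Q n (S n) (S (Suc n))" by blast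
  show thesis
  proof
    show "S 0 = {id}" "finite (S n)" "perm_group (S n)" "S n \<subseteq> \<Gamma>" for n
      using S(1)[of n] S(1)[of 0] by (simp_all add: P_def)
    show "\<tau> \<in> S 1" using S(2)[of 0] by (simp add: Q_def)
    show "S m \<subseteq> S n" if "m \<le> n" for m n
      using lift_Suc_mono_le[of S, OF _ that] S(2) by (simp add: Q_def)
    show "\<exists>n. \<gamma> \<in> S n" if \<gamma>: "\<gamma> \<in> \<Gamma>" for \<gamma>
    proof -
      obtain n where "\<psi> n = \<gamma>" using \<psi>_surj[OF \<gamma>] by blast
      then have "\<gamma> \<in> S (Suc n)" using S(2)[of n] by (simp add: Q_def)
      then show ?thesis ..
    qed
    show "\<exists>\<gamma>\<in>S (Suc n). \<gamma> x \<in> cyl z n \<and> (\<forall>s\<in>S n. \<gamma> x \<noteq> s x)" for n x z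
      using S(2)[of n] unfolding Q_def by blast
  qed
qed

text \<open>Countability and clopen fixed-point sets pass to subgroups, and a finite subgroup of
  \<Gamma> is simply intersected with \<open>\<Delta>\<close>. Fullness alone is a condition on
  \<open>\<Delta>\<close>, and since \<Gamma> is full it need only be tested on elements of
  \<Gamma>.\<close>

lemma ample_subgroup:
  assumes sub: "\<Delta> \<subseteq> \<Gamma>" and grp: "perm_group \<Delta>"
    and full: "\<And>f. f \<in> \<Gamma> \<Longrightarrow> (\<And>x. \<exists>\<gamma>\<in>\<Delta>. f x = \<gamma> x) \<Longrightarrow> f \<in> \<Delta>"
  shows "ample \<Delta>"
proof -
  have sH: "\<Delta> \<subseteq> Homeo UNIV" using sub sub_Homeo by blast
  have "\<exists>S. finite S \<and> A \<subseteq> S \<and> S \<subseteq> \<Delta> \<and> perm_group S" if A: "finite A" "A \<subseteq> \<Delta>" for A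
  proof -
    obtain S where S: "finite S" "A \<subseteq> S" "S \<subseteq> \<Gamma>" "perm_group S"
      using finite_subgroup[OF A(1)] A(2) sub by blast
    have "perm_group (S \<inter> \<Delta>)"
      using S(4) grp by (auto simp: perm_group_def)
    then show ?thesis using S A by (intro exI[of _ "S \<inter> \<Delta>"]) auto
  qed
  then have "locally_finite_group homeo_group \<Delta>"
    using sH grp by (simp add: locally_finite_homeo_group_iff)
  moreover have "countable \<Delta>"
    using ample countable_subset[OF sub] by (simp add: ample_def)
  moreover have "full_group \<Delta>"
    unfolding full_group_def
  proof (intro conjI ballI impI)
    show "subgroup \<Delta> homeo_group"
      using sH grp by (simp add: subgroup_homeo_group_iff)
    fix f :: "'a \<Rightarrow> 'a" assume f: "f \<in> Homeo UNIV" and "\<exists>A. finite A \<and> A \<subseteq> \<Delta> \<and> (\<forall>x. \<exists>\<gamma>\<in>A. f x = \<gamma> x)"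
    then obtain A where A: "finite A" "A \<subseteq> \<Delta>" "\<forall>x. \<exists>\<gamma>\<in>A. f x = \<gamma> x" by blast
    have "full_group \<Gamma>" using ample by (simp add: ample_def)
    moreover have "A \<subseteq> \<Gamma>" using A(2) sub by blast
    ultimately have "f \<in> \<Gamma>"
      using f A(1,3) unfolding full_group_def by blast
    then show "f \<in> \<Delta>" using A(2,3) by (intro full) blast+
  qed
  moreover have "\<forall>\<gamma>\<in>\<Delta>. open {x. \<gamma> x = x} \<and> closed {x. \<gamma> x = x}"
    using sub clopen_fix unfolding clopen_def by blast
  ultimately show ?thesis by (simp add: ample_def)
qed

text \<open>
  With finite subgroups \<open>S n\<close> exhausting \<open>\<Gamma>\<close>, the orbit of \<open>l\<close> is split according to the parity of the
  first stage at which a point is reached from \<open>l\<close>. This stage is constant on \<open>S n\<close>-orbits not reached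
  by stage \<open>n\<close>, which makes the smaller relation open in the larger one.
\<close>

lemma splitting:
  assumes L: "sparse L" and \<tau>: "\<tau> \<in> \<Gamma>" "\<And>l. l \<in> L \<Longrightarrow> \<tau> l \<noteq> l"
  obtains \<Delta> where "ample \<Delta>" "acts_minimally \<Delta>" "\<Delta> \<subseteq> \<Gamma>"
    "\<forall>x y. (x, y) \<in> orbit_rel \<Gamma> \<longrightarrow> (x, y) \<in> orbit_rel \<Delta> \<or>
      (\<exists>l\<in>L. (x, l) \<in> orbit_rel \<Delta> \<and> (\<tau> l, y) \<in> orbit_rel \<Delta>
        \<or> (x, \<tau> l) \<in> orbit_rel \<Delta> \<and> (l, y) \<in> orbit_rel \<Delta>)"
    "\<forall>l\<in>L. (l, \<tau> l) \<notin> orbit_rel \<Delta>"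
proof -
  obtain S where S: "S 0 = {id}" "\<tau> \<in> S 1" "\<And>n. finite (S n)" "\<And>n. perm_group (S n)" "\<And>n. S n \<subseteq> \<Gamma>"
    "\<And>m n. m \<le> n \<Longrightarrow> S m \<subseteq> S n" "\<And>\<gamma>. \<gamma> \<in> \<Gamma> \<Longrightarrow> \<exists>n. \<gamma> \<in> S n"
    "\<And>n x z. \<exists>\<gamma>\<in>S (Suc n). \<gamma> x \<in> cyl z n \<and> (\<forall>s\<in>S n. \<gamma> x \<noteq> s x)"
    using exhaustion[OF \<tau>(1)] by metis
  have S_comp: "a \<circ> b \<in> S n" if "a \<in> S n" "b \<in> S n" for a b n
    using S(4)[of n] that by (simp add: perm_group_def)
  have S_inv: "inv a \<in> S n" if "a \<in> S n" for a n
    using S(4)[of n] that by (simp add: perm_group_def)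
  have S_mem: "a \<in> \<Gamma>" if "a \<in> S n" for a n using S(5) that by blast
  \<comment> \<open>Meaningful only for z in the orbit of l; elsewhere \<open>LEAST\<close> ranges
    over an empty set. For this reason the value is used only at points of the form \<gamma>
    l.\<close>
  define lev where "lev l z = (LEAST n. \<exists>s\<in>S n. s l = z)" for l z
  have lev_le: "lev l (\<gamma> l) \<le> n \<longleftrightarrow> (\<exists>s\<in>S n. s l = \<gamma> l)" if \<gamma>: "\<gamma> \<in> \<Gamma>" for \<gamma> l n
  proof
    assume le: "lev l (\<gamma> l) \<le> n"
    obtain m where "\<gamma> \<in> S m" using S(7)[OF \<gamma>] by blast
    then have "\<exists>n. \<exists>s\<in>S n. s l = \<gamma> l" by blast
    then have "\<exists>s\<in>S (lev l (\<gamma> l)). s l = \<gamma> l"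
      unfolding lev_def by (rule LeastI_ex)
    then show "\<exists>s\<in>S n. s l = \<gamma> l" using S(6)[OF le] by blast
  next
    assume "\<exists>s\<in>S n. s l = \<gamma> l"
    then show "lev l (\<gamma> l) \<le> n" unfolding lev_def by (rule Least_le)
  qed
  have lev_const: "lev l (s (\<gamma> l)) = lev l (\<gamma> l)" if s: "s \<in> S n" and \<gamma>: "\<gamma> \<in> \<Gamma>" "n \<le> lev l (\<gamma> l)"
      and n: "\<not> (\<exists>t\<in>S n. t l = \<gamma> l)" for s \<gamma> n l
  proof -
    have s\<gamma>: "s \<circ> \<gamma> \<in> \<Gamma>" using S_mem[OF s] \<gamma>(1) by (simp add: comp_mem)
    have "(\<exists>t\<in>S m. t l = s (\<gamma> l)) \<longleftrightarrow> (\<exists>t\<in>S m. t l = \<gamma> l)" for m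
    proof (cases "n \<le> m")
      case True
      have s: "s \<in> S m" using S(6)[OF True] s by blast
      show ?thesis
      proof
        assume "\<exists>t\<in>S m. t l = s (\<gamma> l)"
        then obtain t where "t \<in> S m" "t l = s (\<gamma> l)" by blast
        then show "\<exists>t\<in>S m. t l = \<gamma> l"
          using S_comp[OF S_inv[OF s], of t] S_mem[OF s] by (intro bexI[of _ "inv s \<circ> t"]) auto
      next
        assume "\<exists>t\<in>S m. t l = \<gamma> l"
        then obtain t where "t \<in> S m" "t l = \<gamma> l" by blast
        then show "\<exists>t\<in>S m. t l = s (\<gamma> l)"
          using S_comp[OF s, of t] by (intro bexI[of _ "s \<circ> t"]) auto
      qed
    next
      case False
      then have m: "S m \<subseteq> S n" using S(6)[of m n] by simp
      have "\<not> (\<exists>t\<in>S n. t l = s (\<gamma> l))"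
      proof
        assume "\<exists>t\<in>S n. t l = s (\<gamma> l)"
        then obtain t where "t \<in> S n" "t l = s (\<gamma> l)" by blast
        then have "\<exists>t\<in>S n. t l = \<gamma> l"
          using S_comp[OF S_inv[OF s], of t] S_mem[OF s] by (intro bexI[of _ "inv s \<circ> t"]) auto
        with n show False ..
      qed
      then show ?thesis using n m by blast
    qed
    then show ?thesis by (simp add: lev_def)
  qed
  \<comment> \<open>Orbits that miss \<open>L\<close> satisfy the parity condition vacuously and
    stay whole; an orbit through l falls into the points of even and of odd stage.\<close>
  define R where "R = {(x, y). (\<exists>\<gamma>\<in>\<Gamma>. \<gamma> x = y) \<and>
    (\<forall>l\<in>L. (\<exists>\<gamma>\<in>\<Gamma>. \<gamma> l = x) \<longrightarrow> (even (lev l x) \<longleftrightarrow> even (lev l y)))}"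
  have RI: "(x, y) \<in> R" if "\<gamma> \<in> \<Gamma>" "\<gamma> x = y"
      "\<And>l \<beta>. l \<in> L \<Longrightarrow> \<beta> \<in> \<Gamma> \<Longrightarrow> \<beta> l = x \<Longrightarrow> even (lev l x) \<longleftrightarrow> even (lev l y)" for x y \<gamma>
    using that unfolding R_def by blast
  have RD: "even (lev l x) \<longleftrightarrow> even (lev l y)"
    if "(x, y) \<in> R" "l \<in> L" "\<beta> \<in> \<Gamma>" "\<beta> l = x" for x y l \<beta>
    using that unfolding R_def by blast
  have RE: "\<exists>\<gamma>\<in>\<Gamma>. \<gamma> x = y" if "(x, y) \<in> R" for x y
    using that unfolding R_def by blast
  have R_refl: "(x, x) \<in> R" for x
    by (rule RI[OF id_mem]) simp_all
  have R_sym: "(y, x) \<in> R" if xy: "(x, y) \<in> R" for x y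
  proof -
    from RE[OF xy] obtain \<gamma> where \<gamma>: "\<gamma> \<in> \<Gamma>" "\<gamma> x = y" by blast
    have inv_y: "inv \<gamma> y = x" using \<gamma> by auto
    show ?thesis
    proof (rule RI[OF inv_mem[OF \<gamma>(1)] inv_y])
      fix l \<beta> assume "l \<in> L" "\<beta> \<in> \<Gamma>" "\<beta> l = y"
      then have "inv \<gamma> \<circ> \<beta> \<in> \<Gamma>" "(inv \<gamma> \<circ> \<beta>) l = x"
        using \<gamma>(1) inv_y by (simp_all add: comp_mem inv_mem)
      from RD[OF xy \<open>l \<in> L\<close> this] show "even (lev l y) \<longleftrightarrow> even (lev l x)" by simp
    qed
  qed
  have R_trans: "(x, z) \<in> R" if xy: "(x, y) \<in> R" and yz: "(y, z) \<in> R" for x y z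
  proof -
    from RE[OF xy] RE[OF yz] obtain \<gamma> \<delta> where \<gamma>: "\<gamma> \<in> \<Gamma>" "\<gamma> x = y" "\<delta> \<in> \<Gamma>" "\<delta> y = z" by blast
    have "\<delta> \<circ> \<gamma> \<in> \<Gamma>" "(\<delta> \<circ> \<gamma>) x = z" using \<gamma> by (auto simp: comp_mem)
    then show ?thesis
    proof (rule RI)
      fix l \<beta> assume \<beta>: "l \<in> L" "\<beta> \<in> \<Gamma>" "\<beta> l = x"
      then have "\<gamma> \<circ> \<beta> \<in> \<Gamma>" "(\<gamma> \<circ> \<beta>) l = y"
        using \<gamma> by (simp_all add: comp_mem)
      from RD[OF yz \<beta>(1) this] RD[OF xy \<beta>] show "even (lev l x) \<longleftrightarrow> even (lev l z)" by simp
    qed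
  qed
  define \<Delta> where "\<Delta> = {\<gamma>\<in>\<Gamma>. \<forall>x. (x, \<gamma> x) \<in> R}"
  have \<Delta>_grp: "perm_group \<Delta>"
    unfolding perm_group_def
  proof (intro conjI ballI)
    show "id \<in> \<Delta>" using id_mem R_refl by (simp add: \<Delta>_def)
    show "f \<circ> g \<in> \<Delta>" if "f \<in> \<Delta>" "g \<in> \<Delta>" for f g
    proof -
      have "(x, f (g x)) \<in> R" for x using that R_trans[of x "g x" "f (g x)"] by (simp add: \<Delta>_def)
      then show ?thesis using that by (simp add: \<Delta>_def comp_mem)
    qed
    show "bij f" if "f \<in> \<Delta>" for f using that bij_mem by (simp add: \<Delta>_def)
    show "inv f \<in> \<Delta>" if f: "f \<in> \<Delta>" for f
    proof -
      have "(x, inv f x) \<in> R" for x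
        using f R_sym[of "inv f x" x] by (simp add: \<Delta>_def) (metis f_inv_f)
      then show ?thesis using f by (simp add: \<Delta>_def inv_mem)
    qed
  qed
  have \<Delta>_ample: "ample \<Delta>"
  proof (rule ample_subgroup)
    show "\<Delta> \<subseteq> \<Gamma>" by (auto simp: \<Delta>_def)
    show "f \<in> \<Delta>" if f: "f \<in> \<Gamma>" "\<And>x. \<exists>\<gamma>\<in>\<Delta>. f x = \<gamma> x" for f
    proof -
      have "(x, f x) \<in> R" for x using f(2)[of x] by (auto simp: \<Delta>_def)
      then show ?thesis using f(1) by (simp add: \<Delta>_def)
    qed
  qed (rule \<Delta>_grp)
  have R_open: "\<exists>U. open U \<and> x \<in> U \<and> (\<forall>z\<in>U. (z, \<gamma> z) \<in> R)" if xy: "(x, \<gamma> x) \<in> R" and \<gamma>: "\<gamma> \<in> \<Gamma>" for x \<gamma>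
  proof -
    obtain n where n: "\<gamma> \<in> S n" using S(7)[OF \<gamma>] by blast
    \<comment> \<open>The points where \<gamma> could violate \<open>R\<close> are the \<delta> l
      with \<delta> in \<open>S n\<close> and l in \<open>B \<delta>\<close>: if l reaches a point
      only after stage n, then \<gamma>, being in \<open>S n\<close>, leaves its stage unchanged. So
      only finitely many closed sets have to be avoided.\<close>
    define B where "B \<delta> = {l \<in> L. even (lev l (\<delta> l)) \<noteq> even (lev l (\<gamma> (\<delta> l)))}" for \<delta>
    have clB: "closed (\<delta> ` B \<delta>)" if \<delta>: "\<delta> \<in> S n" for \<delta>
    proof -
      have cl: "clopen {l. lev l (\<beta> l) \<le> k}" if "\<beta> \<in> \<Gamma>" for \<beta> k
      proof -
        have "{l. lev l (\<beta> l) \<le> k} = (\<Union>s\<in>S k. {l. s l = \<beta> l})"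
          using lev_le[OF that] by auto
        then show ?thesis using S(3) clopen_eq S_mem that by (auto intro!: clopen_UN)
      qed
      have bound: "lev l (\<beta> l) \<le> n" if "\<beta> \<in> S n" for \<beta> l
        using lev_le[OF S_mem[OF that]] that by blast
      have ev: "clopen {l. even (lev l (\<beta> l))}" if \<beta>: "\<beta> \<in> S n" for \<beta>
      proof -
        \<comment> \<open>Exact level k is "at most k but not at most k - 1". Level 0 needs its own
          case because 0 - 1 = 0 for natural numbers, and the difference would be empty.\<close>
        have "{l. even (lev l (\<beta> l))} =
            (\<Union>k\<in>{k\<in>{..n}. even k}. {l. lev l (\<beta> l) \<le> k} - (if k = 0 then {} else {l. lev l (\<beta> l) \<le> k - 1}))"
          (is "_ = ?rhs")
        proof
          show "{l. even (lev l (\<beta> l))} \<subseteq> ?rhs"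
          proof
            fix l assume l: "l \<in> {l. even (lev l (\<beta> l))}"
            have "lev l (\<beta> l) \<noteq> 0 \<longrightarrow> \<not> lev l (\<beta> l) \<le> lev l (\<beta> l) - 1" by linarith
            then show "l \<in> ?rhs"
              using bound[OF \<beta>, of l] l by (intro UN_I[of "lev l (\<beta> l)"]) auto
          qed
          show "?rhs \<subseteq> {l. even (lev l (\<beta> l))}"
          proof
            fix l assume "l \<in> ?rhs"
            then obtain k where "even k" "lev l (\<beta> l) \<le> k" "k = 0 \<or> \<not> lev l (\<beta> l) \<le> k - 1"
              by (auto split: if_splits)
            then have "lev l (\<beta> l) = k" by linarith
            then show "l \<in> {l. even (lev l (\<beta> l))}" using \<open>even k\<close> by simp
          qed
        qed
        then show ?thesis
          using cl[OF S_mem[OF \<beta>]] by (auto intro!: clopen_UN clopen_Diff)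
      qed
      have "B \<delta> = L \<inter> - {l. even (lev l (\<delta> l)) \<longleftrightarrow> even (lev l ((\<gamma> \<circ> \<delta>) l))}"
        by (auto simp: B_def)
      moreover have "clopen {l. even (lev l (\<delta> l)) \<longleftrightarrow> even (lev l ((\<gamma> \<circ> \<delta>) l))}"
        by (intro clopen_Collect_eq ev \<delta> S_comp[OF n \<delta>])
      ultimately have "closed (B \<delta>)"
        using sparse_closed[OF L] by (simp add: clopen_def closed_Int closed_Compl)
      then show ?thesis by (rule closed_mem_image[OF S_mem[OF \<delta>]])
    qed
    define U where "U = - (\<Union>\<delta>\<in>S n. \<delta> ` B \<delta>)"
    have "open U"
      unfolding U_def using clB S(3) by (intro open_Compl closed_UN) auto
    moreover have "x \<in> U"
    proof (rule ccontr)
      assume "x \<notin> U"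
      then obtain \<delta> l where \<delta>: "\<delta> \<in> S n" "l \<in> B \<delta>" "x = \<delta> l" by (auto simp: U_def)
      then have "l \<in> L" "even (lev l x) \<noteq> even (lev l (\<gamma> x))" by (auto simp: B_def)
      then show False using RD[OF xy, of l \<delta>] S_mem[OF \<delta>(1)] \<delta>(3) by simp
    qed
    moreover have "(z, \<gamma> z) \<in> R" if z: "z \<in> U" for z
    proof -
      have "even (lev l z) \<longleftrightarrow> even (lev l (\<gamma> z))" if l: "l \<in> L" and \<beta>: "\<beta> \<in> \<Gamma>" "\<beta> l = z" for l \<beta>
      proof (cases "\<exists>\<delta>\<in>S n. \<delta> l = z")
        case True
        then obtain \<delta> where \<delta>: "\<delta> \<in> S n" "\<delta> l = z" by blast
        then have "l \<notin> B \<delta>" using z by (auto simp: U_def)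
        then show ?thesis using l \<delta>(2) by (auto simp: B_def)
      next
        case False
        then have nex: "\<not> (\<exists>t\<in>S n. t l = \<beta> l)" using \<beta>(2) by simp
        then have "n \<le> lev l (\<beta> l)" using lev_le[OF \<beta>(1), of l n] by simp
        from lev_const[OF n \<beta>(1) this nex] show ?thesis using \<beta>(2) by simp
      qed
      then show ?thesis by (rule RI[OF \<gamma> refl])
    qed
    ultimately show ?thesis by (intro exI[of _ U] conjI ballI)
  qed
  have orb\<Delta>: "orbit_rel \<Delta> = R"
  proof
    show "orbit_rel \<Delta> \<subseteq> R" by (auto simp: orbit_rel_def \<Delta>_def)
    show "R \<subseteq> orbit_rel \<Delta>"
    proof
      fix p assume "p \<in> R"
      moreover obtain x y where p: "p = (x, y)" by (cases p)
      ultimately have xy: "(x, y) \<in> R" by simp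
      from RE[OF xy] obtain \<gamma> where \<gamma>: "\<gamma> \<in> \<Gamma>" "\<gamma> x = y" by blast
      have "\<exists>\<delta>\<in>\<Delta>. \<delta> x = y"
      proof (cases "x = y")
        case True
        then show ?thesis using \<Delta>_grp by (intro bexI[of _ id]) (auto simp: perm_group_def)
      next
        case False
        obtain U where U: "open U" "x \<in> U" "\<forall>z\<in>U. (z, \<gamma> z) \<in> R"
          using R_open[of x \<gamma>] xy \<gamma> by blast
        \<comment> \<open>As y differs from x, there is a clopen V around x disjoint from its image
          under \<gamma>. Exchanging V with that image, inside the open set where \<gamma> respects
          \<open>R\<close>, yields an element of \<open>\<Delta>\<close> taking x to y.\<close>
        obtain n where n: "y \<notin> cyl x n"
          using separation[of y x] False unfolding cyl_def by blast
        have "open (U \<inter> cyl x n \<inter> {z. \<gamma> z \<notin> cyl x n})"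
          using U(1) clopen_cyl[of x n] clopen_mem_vimage[OF \<gamma>(1) clopen_Compl[OF clopen_cyl[of x n]]]
          by (simp add: clopen_def open_Int)
        moreover have "x \<in> U \<inter> cyl x n \<inter> {z. \<gamma> z \<notin> cyl x n}" using U(2) n \<gamma>(2) by simp
        ultimately obtain V where V: "clopen V" "x \<in> V" "V \<subseteq> U \<inter> cyl x n \<inter> {z. \<gamma> z \<notin> cyl x n}"
          using clopen_neighbourhood by meson
        have disj: "\<gamma> z \<notin> V" if "z \<in> V" for z using V(3) that by blast
        define T where "T = {(z, \<gamma> z) |z. z \<in> V} \<union> {(\<gamma> z, z) |z. z \<in> V}"
        have "\<exists>u\<in>\<Gamma>. (\<forall>z w. (z, w) \<in> T \<longrightarrow> u z = w) \<and> (\<forall>z. z \<notin> Domain T \<longrightarrow> u z = z)"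
        proof (rule swap)
          show "(w, z) \<in> T" if "(z, w) \<in> T" for z w using that by (auto simp: T_def)
          show "w = w'" if "(z, w) \<in> T" "(z, w') \<in> T" for z w w'
            using that disj \<gamma>(1) by (auto simp: T_def mem_eq_iff)
          show "\<exists>\<gamma>\<in>\<Gamma>. \<exists>U. open U \<and> z \<in> U \<and> (\<forall>z'\<in>U. (z', \<gamma> z') \<in> T)" if "(z, w) \<in> T" for z w
          proof (cases "z \<in> V")
            case True
            have "\<forall>z'\<in>V. (z', \<gamma> z') \<in> T" by (auto simp: T_def)
            then show ?thesis using True V(1) \<gamma>(1) unfolding clopen_def by blast
          next
            case False
            then have z: "z \<in> \<gamma> ` V" using that by (auto simp: T_def)
            have "\<forall>z'\<in>\<gamma> ` V. (z', inv \<gamma> z') \<in> T" using \<gamma>(1) by (auto simp: T_def)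
            then show ?thesis
              using z clopen_mem_image[OF \<gamma>(1) V(1)] inv_mem[OF \<gamma>(1)] unfolding clopen_def by blast
          qed
          have "Domain T = V \<union> \<gamma> ` V" by (auto simp: T_def)
          then show "closed (Domain T)"
            using V(1) clopen_mem_image[OF \<gamma>(1) V(1)] by (simp add: clopen_def closed_Un)
        qed
        then obtain u where u: "u \<in> \<Gamma>" "\<And>z w. (z, w) \<in> T \<Longrightarrow> u z = w" "\<And>z. z \<notin> Domain T \<Longrightarrow> u z = z"
          by blast
        have "(z, u z) \<in> R" for z
        proof (cases "z \<in> Domain T")
          case True
          then obtain w where w: "(z, w) \<in> T" by blast
          have "(a, \<gamma> a) \<in> R" if "a \<in> V" for a using that V(3) U(3) by blast
          then have "(z, w) \<in> R" using w R_sym by (auto simp: T_def)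
          then show ?thesis using u(2)[OF w] by simp
        next
          case False
          then show ?thesis using u(3) R_refl by simp
        qed
        then have "u \<in> \<Delta>" using u(1) by (simp add: \<Delta>_def)
        moreover have "u x = y" using u(2)[of x y] V(2) \<gamma>(2) by (auto simp: T_def)
        ultimately show ?thesis by blast
      qed
      then show "p \<in> orbit_rel \<Delta>" by (simp add: p orbit_rel_def)
    qed
  qed
  have lev_self: "lev l l = 0" for l
    using lev_le[OF id_mem, of l 0] S(1) by simp
  have lev_\<tau>: "lev l (\<tau> l) = 1" if l: "l \<in> L" for l
  proof -
    have "lev l (\<tau> l) \<le> 1" using lev_le[OF \<tau>(1), of l 1] S(2) by blast
    moreover have "\<not> lev l (\<tau> l) \<le> 0" using lev_le[OF \<tau>(1), of l 0] S(1) \<tau>(2)[OF l] by auto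
    ultimately show ?thesis by simp
  qed
  \<comment> \<open>An orbit meets \<open>L\<close> in at most one point, so the condition over all
    l in \<open>R\<close> comes down to a single parity.\<close>
  have uniq: "l' = l" if "l \<in> L" "l' \<in> L" "\<beta> \<in> \<Gamma>" "\<beta>' \<in> \<Gamma>" "\<beta> l = \<beta>' l'" for l l' \<beta> \<beta>'
  proof -
    have "(inv \<beta>' \<circ> \<beta>) l = l'" "inv \<beta>' \<circ> \<beta> \<in> \<Gamma>" using that by (auto simp: comp_mem inv_mem)
    then show ?thesis using that(1,2) L unfolding sparse_def by metis
  qed
  have R_even: "(x, y) \<in> R"
    if "l \<in> L" "\<beta> \<in> \<Gamma>" "\<beta> l = x" "\<delta> \<in> \<Gamma>" "\<delta> x = y" "even (lev l x) \<longleftrightarrow> even (lev l y)" for l \<beta> x y \<delta>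
  proof (rule RI[OF that(4,5)])
    fix l' \<beta>' assume "l' \<in> L" "\<beta>' \<in> \<Gamma>" "\<beta>' l' = x"
    then have "l' = l" using uniq[OF that(1) _ that(2), of l' \<beta>'] that(3) by simp
    with that(6) show "even (lev l' x) \<longleftrightarrow> even (lev l' y)" by simp
  qed
  have l_\<tau>l: "(l, \<tau> l) \<notin> orbit_rel \<Delta>" if "l \<in> L" for l
    using RD[OF _ that id_mem, of l "\<tau> l"] lev_self[of l] lev_\<tau>[OF that] unfolding orb\<Delta> by auto
  have split: "(x, y) \<in> orbit_rel \<Delta> \<or>
    (\<exists>l\<in>L. (x, l) \<in> orbit_rel \<Delta> \<and> (\<tau> l, y) \<in> orbit_rel \<Delta>
      \<or> (x, \<tau> l) \<in> orbit_rel \<Delta> \<and> (l, y) \<in> orbit_rel \<Delta>)" if "(x, y) \<in> orbit_rel \<Gamma>" for x y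
  proof (cases "(x, y) \<in> R")
    case True
    then show ?thesis by (simp add: orb\<Delta>)
  next
    case False
    from that obtain \<delta> where \<delta>: "\<delta> \<in> \<Gamma>" "\<delta> x = y" by (auto simp: orbit_rel_def)
    with False obtain l \<beta> where l: "l \<in> L" "\<beta> \<in> \<Gamma>" "\<beta> l = x" "even (lev l x) \<noteq> even (lev l y)"
      using RI[OF \<delta>] by blast
    have x: "inv \<beta> x = l" "(\<tau> \<circ> inv \<beta>) x = \<tau> l" using l by auto
    have y: "(\<delta> \<circ> \<beta>) l = y" "(\<delta> \<circ> (\<beta> \<circ> inv \<tau>)) (\<tau> l) = y" using l \<delta> \<tau>(1) by auto
    have mem: "inv \<beta> \<in> \<Gamma>" "\<tau> \<circ> inv \<beta> \<in> \<Gamma>" "\<delta> \<circ> \<beta> \<in> \<Gamma>" "\<delta> \<circ> (\<beta> \<circ> inv \<tau>) \<in> \<Gamma>"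
      using l \<delta> \<tau>(1) by (simp_all add: comp_mem inv_mem)
    show ?thesis
    proof (cases "even (lev l x)")
      case True
      then have "(x, l) \<in> R" "(\<tau> l, y) \<in> R"
        using R_even[OF l(1,2,3) mem(1) x(1)] R_even[OF l(1) \<tau>(1) refl mem(4) y(2)] l(4)
          lev_self[of l] lev_\<tau>[OF l(1)] by simp_all
      then show ?thesis using l(1) unfolding orb\<Delta> by blast
    next
      case False
      then have "(x, \<tau> l) \<in> R" "(l, y) \<in> R"
        using R_even[OF l(1,2,3) mem(2) x(2)] R_even[OF l(1) id_mem _ mem(3) y(1)] l(4)
          lev_self[of l] lev_\<tau>[OF l(1)] by simp_all
      then show ?thesis using l(1) unfolding orb\<Delta> by blast
    qed
  qed
  show thesis
  proof
    show "ample \<Delta>" by (rule \<Delta>_ample)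
    show "\<Delta> \<subseteq> \<Gamma>" by (auto simp: \<Delta>_def)
    show "\<forall>l\<in>L. (l, \<tau> l) \<notin> orbit_rel \<Delta>" using l_\<tau>l by blast
    show "\<forall>x y. (x, y) \<in> orbit_rel \<Gamma> \<longrightarrow> (x, y) \<in> orbit_rel \<Delta> \<or>
      (\<exists>l\<in>L. (x, l) \<in> orbit_rel \<Delta> \<and> (\<tau> l, y) \<in> orbit_rel \<Delta>
        \<or> (x, \<tau> l) \<in> orbit_rel \<Delta> \<and> (l, y) \<in> orbit_rel \<Delta>)"
      by (intro allI impI split)
    show "acts_minimally \<Delta>"
      unfolding acts_minimally_def
    proof (intro allI)
      fix x
      have "\<exists>y\<in>U. (x, y) \<in> R" if U: "open U" "z \<in> U" for U z
      proof (cases "\<exists>l\<in>L. \<exists>\<beta>\<in>\<Gamma>. \<beta> l = x")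
        case True
        then obtain l \<beta> where l: "l \<in> L" "\<beta> \<in> \<Gamma>" "\<beta> l = x" by blast
        obtain m where m: "cyl z m \<subseteq> U" using open_contains_cyl[OF U] by blast
        \<comment> \<open>The point \<gamma> l will be reached first at stage exactly
          \<open>Suc n\<close>, so this number must have the parity of the stage of x; n at least m
          keeps the point inside U.\<close>
        obtain n where n: "m \<le> n" "even (Suc n) \<longleftrightarrow> even (lev l x)"
          by (cases "even (Suc m) \<longleftrightarrow> even (lev l x)") (auto intro: that[of m] that[of "Suc m"])
        obtain \<gamma> where \<gamma>: "\<gamma> \<in> S (Suc n)" "\<gamma> l \<in> cyl z n" "\<forall>s\<in>S n. \<gamma> l \<noteq> s l"
          using S(8)[where n = n and x = l and z = z] by blast
        have \<gamma>\<Gamma>: "\<gamma> \<in> \<Gamma>" using \<gamma>(1) S_mem by blast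
        have "lev l (\<gamma> l) \<le> Suc n" using lev_le[OF \<gamma>\<Gamma>, of l "Suc n"] \<gamma>(1) by blast
        moreover have "\<not> lev l (\<gamma> l) \<le> n" using lev_le[OF \<gamma>\<Gamma>, of l n] \<gamma>(3) by auto
        ultimately have "lev l (\<gamma> l) = Suc n" by simp
        moreover have "\<gamma> \<circ> inv \<beta> \<in> \<Gamma>" "(\<gamma> \<circ> inv \<beta>) x = \<gamma> l"
          using \<gamma>\<Gamma> l by (auto simp: comp_mem inv_mem)
        ultimately have "(x, \<gamma> l) \<in> R"
          using n(2) by (intro R_even[OF l, of "\<gamma> \<circ> inv \<beta>"]) auto
        moreover have "\<gamma> l \<in> U" using \<gamma>(2) cyl_antimono[OF n(1)] m by blast
        ultimately show ?thesis by blast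
      next
        case False
        obtain \<gamma> where \<gamma>: "\<gamma> \<in> \<Gamma>" "\<gamma> x \<in> U" using orbit_meets_open[OF U(1), of x] U(2) by blast
        have "(x, \<gamma> x) \<in> R" using False by (intro RI[OF \<gamma>(1) refl]) blast
        then show ?thesis using \<gamma>(2) by blast
      qed
      then have "U \<inter> orbit_of \<Delta> x \<noteq> {}" if "open U" "z \<in> U" for U z
        using that orb\<Delta> unfolding orbit_of_def orbit_rel_def by blast
      then show "closure (orbit_of \<Delta> x) = UNIV"
        by (auto simp: closure_iff_nhds_not_empty) blast
    qed
  qed
qed

end

section \<open>Independent Cantor sets\<close>

text \<open>Induction on the length by splitting on the last bit. \<open>Q\<close> has to vary,
  since fixing that bit turns it into a property of the shorter prefix.\<close>

lemma clopen_prefix: "clopen {a::nat \<Rightarrow> bool. Q (map a [0..<n])}"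
proof (induction n arbitrary: Q)
  case 0
  show ?case by (cases "Q []") simp_all
next
  case (Suc n)
  have "{a::nat \<Rightarrow> bool. Q (map a [0..<Suc n])} =
      ({a. a n} \<inter> {a. Q (map a [0..<n] @ [True])}) \<union> ({a. Q (map a [0..<n] @ [False])} - {a. a n})"
    (is "_ = ?rhs")
  proof (rule Set.set_eqI)
    fix a :: "nat \<Rightarrow> bool"
    show "a \<in> {a. Q (map a [0..<Suc n])} \<longleftrightarrow> a \<in> ?rhs"
      by (cases "a n") simp_all
  qed
  then show ?case
    using Suc[of "\<lambda>l. Q (l @ [True])"] Suc[of "\<lambda>l. Q (l @ [False])"] clopen_coordinate[of n]
    by (simp add: clopen_Int clopen_Un clopen_Diff)
qed

context cantor_space
begin

lemma finite_separation:
  assumes "finite (A :: 'a set)"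
  shows "\<exists>N. \<forall>x\<in>A. \<forall>y\<in>A. x \<in> cyl y N \<longrightarrow> x = y"
proof -
  have "\<exists>i. x \<noteq> y \<longrightarrow> e x i \<noteq> e y i" for x y
    using separation[of x y] by blast
  then obtain d where d: "\<And>x y. x \<noteq> y \<Longrightarrow> e x (d x y) \<noteq> e y (d x y)" by metis
  have "finite ((\<lambda>(x, y). d x y) ` (A \<times> A))" using assms by simp
  then obtain N where N: "\<forall>i\<in>(\<lambda>(x, y). d x y) ` (A \<times> A). i < N"
    using finite_nat_set_iff_bounded by blast
  have "x = y" if "x \<in> A" "y \<in> A" "x \<in> cyl y N" for x y
  proof (rule ccontr)
    assume "x \<noteq> y"
    moreover have "d x y < N" using N that by auto
    ultimately show False using d[of x y] that(3) by (simp add: cyl_def)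
  qed
  then show ?thesis by blast
qed

end

section \<open>Points and sets independent under finite subgroups\<close>

context minimal_ample_action
begin

text \<open>If U lay inside \<open>K\<close>, density of the orbit of a point x of U would bring it
  back to U at another point, giving two points of \<open>K\<close> in one orbit.\<close>

lemma sparse_nowhere_dense:
  assumes K: "sparse K" and U: "open U" "U \<noteq> {}"
  shows "open (U - K)" "U - K \<noteq> {}"
proof -
  show "open (U - K)" using U(1) sparse_closed[OF K] by (rule open_Diff)
  show "U - K \<noteq> {}"
  proof
    assume "U - K = {}"
    then have sub: "U \<subseteq> K" by blast
    obtain x where x: "x \<in> U" using U(2) by blast
    have "open (U - {x})"
      using open_Int[OF U(1) open_Compl_finite[of "{x}"]] by (simp add: Diff_eq)
    moreover have "U - {x} \<noteq> {}" using open_diff_finite_nonempty[OF U, of "{x}"] by simp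
    ultimately obtain \<gamma> where \<gamma>: "\<gamma> \<in> \<Gamma>" "\<gamma> x \<in> U - {x}" using orbit_meets_open by meson
    then have "\<gamma> x = x" using K sub x unfolding sparse_def by blast
    with \<gamma>(2) show False by blast
  qed
qed

text \<open>The condition on s excludes the image of \<open>K\<close> under \<open>inv s\<close>,
  which is again sparse; finitely many nowhere dense closed sets are removed one by one.\<close>

lemma translates_nowhere_dense:
  assumes K: "sparse K" and U: "open U" "U \<noteq> {}" and S: "finite S" "S \<subseteq> \<Gamma>"
  shows "open {x \<in> U. \<forall>s\<in>S. s x \<notin> K} \<and> {x \<in> U. \<forall>s\<in>S. s x \<notin> K} \<noteq> {}"
  using S
proof (induction S rule: finite_induct)
  case empty
  then show ?case using U by simp
next
  case (insert s S)
  let ?V = "{x \<in> U. \<forall>s\<in>S. s x \<notin> K}"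
  have s: "s \<in> \<Gamma>" using insert.prems by blast
  have "{x \<in> U. \<forall>t\<in>insert s S. t x \<notin> K} = ?V - inv s ` K"
    using s by (auto simp: image_iff) (metis inv_f_f)
  moreover have "open ?V" "?V \<noteq> {}" using insert by auto
  ultimately show ?case
    using sparse_nowhere_dense[OF sparse_image[OF K inv_mem[OF s]], of ?V] by simp
qed

text \<open>Points are chosen one after another. The translates of \<open>K\<close> are avoided by
  nowhere density, the finite \<open>S\<close>-orbits of earlier points because a nonempty open set
  is infinite.\<close>

lemma independent_points:
  assumes K: "sparse K" and S: "finite S" "S \<subseteq> \<Gamma>" "perm_group S"
    and I: "finite I" "\<And>i. i \<in> I \<Longrightarrow> open (P i) \<and> P i \<noteq> {}"
  shows "\<exists>x. \<forall>i\<in>I. x i \<in> P i \<and> (\<forall>s\<in>S. s (x i) \<notin> K) \<and> (\<forall>j\<in>I. \<forall>s\<in>S. s (x i) = x j \<longrightarrow> i = j)"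
  using I
proof (induction I rule: finite_induct)
  case (insert a I)
  have "\<exists>x. \<forall>i\<in>I. x i \<in> P i \<and> (\<forall>s\<in>S. s (x i) \<notin> K) \<and> (\<forall>j\<in>I. \<forall>s\<in>S. s (x i) = x j \<longrightarrow> i = j)"
    by (rule insert.IH) (use insert.prems in simp)
  then obtain x where
    "\<forall>i\<in>I. x i \<in> P i \<and> (\<forall>s\<in>S. s (x i) \<notin> K) \<and> (\<forall>j\<in>I. \<forall>s\<in>S. s (x i) = x j \<longrightarrow> i = j)" ..
  then have x: "\<And>i. i \<in> I \<Longrightarrow> x i \<in> P i" "\<And>i s. i \<in> I \<Longrightarrow> s \<in> S \<Longrightarrow> s (x i) \<notin> K"
      "\<And>i j s. i \<in> I \<Longrightarrow> j \<in> I \<Longrightarrow> s \<in> S \<Longrightarrow> s (x i) = x j \<Longrightarrow> i = j"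
    by blast+
  let ?V = "{x \<in> P a. \<forall>s\<in>S. s x \<notin> K}" and ?O = "\<Union>s\<in>S. \<Union>i\<in>I. {s (x i)}"
  have "open ?V" "?V \<noteq> {}"
    using translates_nowhere_dense[OF K _ _ S(1,2), of "P a"] insert.prems by auto
  moreover have "finite ?O" using S(1) insert.hyps(1) by simp
  ultimately obtain y where y: "y \<in> ?V" "y \<notin> ?O"
    using open_diff_finite_nonempty[of ?V ?O] by blast
  have y1: "s (x i) \<noteq> y" if "i \<in> I" "s \<in> S" for i s using y(2) that by blast
  have y2: "s y \<noteq> x i" if "i \<in> I" "s \<in> S" for i s
  proof
    assume "s y = x i"
    then have "inv s (x i) = y" using S(2) that(2) by (metis inv_f_f subsetD)
    then show False using y1[OF that(1), of "inv s"] S(3) that(2) by (simp add: perm_group_def)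
  qed
  show ?case
  proof (intro exI[of _ "x(a := y)"] ballI conjI impI)
    fix i assume i: "i \<in> insert a I"
    show "(x(a := y)) i \<in> P i" using i x(1) y(1) by auto
    show "s ((x(a := y)) i) \<notin> K" if "s \<in> S" for s using i x(2) y(1) that by auto
    show "i = j" if "j \<in> insert a I" "s \<in> S" "s ((x(a := y)) i) = (x(a := y)) j" for j s
      using that i x(3)[of i j s] y1[of i s] y2[of j s] by (auto split: if_splits)
  qed
qed simp

text \<open>Thickens independent points to clopen sets. A length N separates the finitely many
  points s (x i); if translates stay in the N-cylinders of these points, then s y in
  \<open>Q j\<close> forces s (x i) = x j, and so i = j.\<close>

lemma independent_refinement:
  assumes K: "sparse K" and S: "finite S" "S \<subseteq> \<Gamma>" "perm_group S"
    and I: "finite I" "\<And>i. i \<in> I \<Longrightarrow> clopen (P i) \<and> P i \<noteq> {}"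
  shows "\<exists>P'. \<forall>i\<in>I. clopen (P' i) \<and> P' i \<noteq> {} \<and> P' i \<subseteq> P i \<and> (\<forall>y\<in>P' i. \<forall>s\<in>S. s y \<notin> K) \<and>
    (\<forall>j\<in>I. \<forall>s\<in>S. \<forall>y\<in>P' i. s y \<in> P' j \<longrightarrow> i = j) \<and> (\<forall>y\<in>P' i. \<forall>z\<in>P' i. e y n = e z n)"
proof -
  have "\<exists>x. \<forall>i\<in>I. x i \<in> P i \<and> (\<forall>s\<in>S. s (x i) \<notin> K) \<and> (\<forall>j\<in>I. \<forall>s\<in>S. s (x i) = x j \<longrightarrow> i = j)"
    by (rule independent_points[OF K S I(1)]) (use I(2) in \<open>simp add: clopen_def\<close>)
  then obtain x where
    "\<forall>i\<in>I. x i \<in> P i \<and> (\<forall>s\<in>S. s (x i) \<notin> K) \<and> (\<forall>j\<in>I. \<forall>s\<in>S. s (x i) = x j \<longrightarrow> i = j)" ..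
  then have x: "\<And>i. i \<in> I \<Longrightarrow> x i \<in> P i" "\<And>i s. i \<in> I \<Longrightarrow> s \<in> S \<Longrightarrow> s (x i) \<notin> K"
      "\<And>i j s. i \<in> I \<Longrightarrow> j \<in> I \<Longrightarrow> s \<in> S \<Longrightarrow> s (x i) = x j \<Longrightarrow> i = j"
    by blast+
  have "finite (\<Union>s\<in>S. \<Union>i\<in>I. {s (x i)})" using S(1) I(1) by simp
  from finite_separation[OF this] obtain N where
    N: "\<And>s t i j. s \<in> S \<Longrightarrow> t \<in> S \<Longrightarrow> i \<in> I \<Longrightarrow> j \<in> I \<Longrightarrow> s (x i) \<in> cyl (t (x j)) N \<Longrightarrow> s (x i) = t (x j)"
    by (metis (no_types, lifting) UN_I singletonI)
  have idS: "id \<in> S" using S(3) by (simp add: perm_group_def)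
  \<comment> \<open>Length \<open>Suc n\<close> is needed to fix coordinate n itself. The last
    factor keeps each translate s y in the N-cylinder of s (x i).\<close>
  define W where "W i = P i \<inter> cyl (x i) (Suc n) \<inter> (\<Inter>s\<in>S. {y. s y \<in> cyl (s (x i)) N})" for i
  have W: "clopen (W i)" if "i \<in> I" for i
    unfolding W_def using I(2)[OF that] S(1,2) clopen_cyl clopen_mem_vimage
    by (intro clopen_Int clopen_INT) auto
  have xW: "x i \<in> W i" if "i \<in> I" for i using x(1)[OF that] by (simp add: W_def)
  have "\<exists>Q. clopen Q \<and> x i \<in> Q \<and> Q \<subseteq> {y \<in> W i. \<forall>s\<in>S. s y \<notin> K}" if i: "i \<in> I" for i
  proof (rule clopen_neighbourhood)
    show "open {y \<in> W i. \<forall>s\<in>S. s y \<notin> K}"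
      using translates_nowhere_dense[OF K _ _ S(1,2), of "W i"] W[OF i] xW[OF i] unfolding clopen_def by blast
    show "x i \<in> {y \<in> W i. \<forall>s\<in>S. s y \<notin> K}" using xW x(2) i by blast
  qed
  then have "\<forall>i\<in>I. \<exists>Q. clopen Q \<and> x i \<in> Q \<and> Q \<subseteq> {y \<in> W i. \<forall>s\<in>S. s y \<notin> K}" by (rule ballI)
  then obtain Q where Q: "\<forall>i\<in>I. clopen (Q i) \<and> x i \<in> Q i \<and> Q i \<subseteq> {y \<in> W i. \<forall>s\<in>S. s y \<notin> K}"
    unfolding bchoice_iff ..
  have ind: "i = j" if i: "i \<in> I" "j \<in> I" "s \<in> S" "y \<in> Q i" "s y \<in> Q j" for i j s y
  proof -
    have "y \<in> W i" "s y \<in> W j" using Q i by blast+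
    then have "s y \<in> cyl (s (x i)) N" "s y \<in> cyl (id (x j)) N"
      using i(3) idS unfolding W_def by fastforce+
    then have "s (x i) \<in> cyl (id (x j)) N" by (simp add: cyl_def)
    then have "s (x i) = id (x j)" by (rule N[OF i(3) idS i(1,2)])
    then show ?thesis using x(3)[OF i(1,2,3)] by simp
  qed
  have lev: "e y n = e z n" if "i \<in> I" "y \<in> Q i" "z \<in> Q i" for i y z
  proof -
    have "y \<in> cyl (x i) (Suc n)" "z \<in> cyl (x i) (Suc n)" using Q that by (auto simp: W_def)
    then show ?thesis by (simp add: cyl_def)
  qed
  show ?thesis
  proof (intro exI[of _ Q] ballI conjI impI)
    fix i assume i: "i \<in> I"
    show "clopen (Q i)" "Q i \<noteq> {}" "Q i \<subseteq> P i" using Q i by (auto simp: W_def)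
    show "s y \<notin> K" if "y \<in> Q i" "s \<in> S" for y s using Q i that by blast
    show "i = j" if "j \<in> I" "s \<in> S" "y \<in> Q i" "s y \<in> Q j" for j s y using ind i that by blast
    show "e y n = e z n" if "y \<in> Q i" "z \<in> Q i" for y z using lev i that by blast
  qed
qed

text \<open>The sets at level n + 1 are independent under \<open>S n\<close>, and every \<gamma>
  lies in some \<open>S n\<close>, so different branches end in different orbits, none of which
  meets \<open>K\<close>. The identity gives injectivity. Coordinate n is constant on each set of
  level n + 1, which gives continuity.\<close>

lemma cantor_scheme:
  assumes K: "sparse K" and b: "clopen b" "b \<noteq> {}"
  obtains \<phi> :: "(nat \<Rightarrow> bool) \<Rightarrow> 'a" where "continuous_on UNIV \<phi>" "inj \<phi>" "range \<phi> \<subseteq> b"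
    "\<forall>\<gamma>\<in>\<Gamma>. \<forall>a. \<gamma> (\<phi> a) \<notin> K"
    "\<forall>\<gamma>\<in>\<Gamma>. \<forall>a a'. \<gamma> (\<phi> a) = \<phi> a' \<longrightarrow> a = a'"
proof -
  obtain S :: "nat \<Rightarrow> ('a \<Rightarrow> 'a) set" where S: "\<And>n. finite (S n)" "\<And>n. perm_group (S n)" "\<And>n. S n \<subseteq> \<Gamma>"
    "\<And>m n. m \<le> n \<Longrightarrow> S m \<subseteq> S n" "\<And>\<gamma>. \<gamma> \<in> \<Gamma> \<Longrightarrow> \<exists>n. \<gamma> \<in> S n"
    using exhaustion[OF id_mem] by metis
  define A where "A n P \<longleftrightarrow> (\<forall>s. length s = n \<longrightarrow> clopen (P s) \<and> P s \<noteq> {} \<and> P s \<subseteq> b)"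
    for n and P :: "bool list \<Rightarrow> 'a set"
  define B where "B n P P' \<longleftrightarrow> (\<forall>t. length t = Suc n \<longrightarrow> P' t \<subseteq> P (butlast t) \<and>
      (\<forall>y\<in>P' t. \<forall>s\<in>S n. s y \<notin> K) \<and> (\<forall>y\<in>P' t. \<forall>z\<in>P' t. e y n = e z n) \<and>
      (\<forall>t'. length t' = Suc n \<longrightarrow> (\<forall>s\<in>S n. \<forall>y\<in>P' t. s y \<in> P' t' \<longrightarrow> t = t')))"
    for n and P P' :: "bool list \<Rightarrow> 'a set"
  have "\<exists>P. \<forall>n. A n (P n) \<and> B n (P n) (P (Suc n))"
  proof (rule dependent_nat_choice)
    show "\<exists>P. A 0 P" using b by (intro exI[of _ "\<lambda>_. b"]) (simp add: A_def)
    fix P n assume P: "A n P"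
    let ?I = "{t::bool list. length t = Suc n}"
    have "finite ?I" using finite_lists_length_eq[of "UNIV :: bool set" "Suc n"] by simp
    moreover have "clopen (P (butlast t)) \<and> P (butlast t) \<noteq> {}" if "t \<in> ?I" for t
      using P that by (simp add: A_def)
    ultimately have "\<exists>P'. \<forall>i\<in>?I. clopen (P' i) \<and> P' i \<noteq> {} \<and> P' i \<subseteq> P (butlast i) \<and>
        (\<forall>y\<in>P' i. \<forall>s\<in>S n. s y \<notin> K) \<and> (\<forall>j\<in>?I. \<forall>s\<in>S n. \<forall>y\<in>P' i. s y \<in> P' j \<longrightarrow> i = j) \<and>
        (\<forall>y\<in>P' i. \<forall>z\<in>P' i. e y n = e z n)"
      by (rule independent_refinement[OF K S(1)[of n] S(3)[of n] S(2)[of n],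
            where I = ?I and P = "\<lambda>t. P (butlast t)" and n = n])
    then obtain P' where P': "\<forall>i\<in>?I. clopen (P' i) \<and> P' i \<noteq> {} \<and> P' i \<subseteq> P (butlast i) \<and>
        (\<forall>y\<in>P' i. \<forall>s\<in>S n. s y \<notin> K) \<and> (\<forall>j\<in>?I. \<forall>s\<in>S n. \<forall>y\<in>P' i. s y \<in> P' j \<longrightarrow> i = j) \<and>
        (\<forall>y\<in>P' i. \<forall>z\<in>P' i. e y n = e z n)" ..
    have "P (butlast t) \<subseteq> b" if "length t = Suc n" for t
      using P that by (simp add: A_def)
    then have "A (Suc n) P'" using P' unfolding A_def by blast
    moreover have "B n P P'"
      unfolding B_def
    proof (intro allI impI)
      fix t :: "bool list" assume "length t = Suc n"
      then have "t \<in> ?I" by simp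
      from bspec[OF P' this]
      show "P' t \<subseteq> P (butlast t) \<and> (\<forall>y\<in>P' t. \<forall>s\<in>S n. s y \<notin> K) \<and>
        (\<forall>y\<in>P' t. \<forall>z\<in>P' t. e y n = e z n) \<and>
        (\<forall>t'. length t' = Suc n \<longrightarrow> (\<forall>s\<in>S n. \<forall>y\<in>P' t. s y \<in> P' t' \<longrightarrow> t = t'))"
        by blast
    qed
    ultimately show "\<exists>P'. A (Suc n) P' \<and> B n P P'" by blast
  qed
  then obtain P where PA: "\<And>n. A n (P n)" and PB: "\<And>n. B n (P n) (P (Suc n))" by blast
  define pre where "pre a n = map a [0..<n]" for a :: "nat \<Rightarrow> bool" and n
  have len: "length (pre a n) = n" for a n by (simp add: pre_def)
  define V where "V a n = P n (pre a n)" for a n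
  have V_clopen: "clopen (V a n)" and V_ne: "V a n \<noteq> {}" and V_b: "V a n \<subseteq> b" for a n
    using PA[of n] len[of a n] by (auto simp: A_def V_def)
  have but: "butlast (pre a (Suc n)) = pre a n" for a n by (simp add: pre_def)
  have V_dec: "V a (Suc n) \<subseteq> V a n" for a n
  proof -
    have "P (Suc n) (pre a (Suc n)) \<subseteq> P n (butlast (pre a (Suc n)))"
      using PB[of n] len[of a "Suc n"] unfolding B_def by blast
    then show ?thesis unfolding but V_def .
  qed
  have V_mono: "V a n \<subseteq> V a m" if "m \<le> n" for a m n
    using lift_Suc_antimono_le[of "V a", OF V_dec that] .
  have V_K: "s y \<notin> K" if "y \<in> V a (Suc n)" "s \<in> S n" for s y a n
    using PB[of n] len[of a "Suc n"] that unfolding B_def V_def by blast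
  have V_e: "e y n = e z n" if "y \<in> V a (Suc n)" "z \<in> V a (Suc n)" for y z a n
    using PB[of n] len[of a "Suc n"] that unfolding B_def V_def by blast
  have V_ind: "pre a (Suc n) = pre a' (Suc n)" if "y \<in> V a (Suc n)" "s \<in> S n" "s y \<in> V a' (Suc n)" for y s a a' n
    using PB[of n] len[of a "Suc n"] len[of a' "Suc n"] that unfolding B_def V_def by blast
  \<comment> \<open>The sets along a branch are nonempty, closed and decreasing, so compactness
    provides a point in all of them.\<close>
  have "UNIV \<inter> (\<Inter>n\<in>UNIV. V a n) \<noteq> {}" for a
  proof (rule compact_imp_fip_image[OF compact_UNIV])
    show "closed (V a n)" for n using V_clopen by (simp add: clopen_def)
    fix J :: "nat set" assume "finite J"
    then obtain N where "\<forall>n\<in>J. n \<le> N" using finite_nat_set_iff_bounded_le by blast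
    then have "V a N \<subseteq> (\<Inter>n\<in>J. V a n)" using V_mono by blast
    then show "UNIV \<inter> (\<Inter>n\<in>J. V a n) \<noteq> {}" using V_ne[of a N] by blast
  qed
  then have "\<exists>y. \<forall>n. y \<in> V a n" for a by blast
  then obtain \<phi> where \<phi>: "\<And>a n. \<phi> a \<in> V a n" by metis
  have indep: "a = a'" if \<gamma>: "\<gamma> \<in> \<Gamma>" "\<gamma> (\<phi> a) = \<phi> a'" for \<gamma> a a'
  proof (rule ext)
    fix i
    obtain m where m: "\<gamma> \<in> S m" using S(5)[OF \<gamma>(1)] by blast
    \<comment> \<open>The level must satisfy two demands: \<open>S n\<close> contains \<gamma>, and
      the prefix of length \<open>Suc n\<close> includes position i.\<close>
    define n where "n = max m i"
    have "\<gamma> \<in> S n" using m S(4)[of m n] by (auto simp: n_def)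
    then have "pre a (Suc n) = pre a' (Suc n)" using V_ind[of "\<phi> a" a n \<gamma> a'] \<phi> \<gamma>(2) by simp
    then have "pre a (Suc n) ! i = pre a' (Suc n) ! i" by simp
    moreover have "i < Suc n" by (simp add: n_def)
    ultimately show "a i = a' i" unfolding pre_def by (simp del: upt_Suc)
  qed
  have "continuous_on UNIV (\<lambda>a. e (\<phi> a))"
  proof (rule continuous_on_into_fun_bool)
    fix n
    \<comment> \<open>Coordinate n is constant on a set indexed by the first n + 1 bits of a, so it
      depends on those bits alone.\<close>
    have "e (\<phi> a) n \<longleftrightarrow> (\<forall>z\<in>P (Suc n) (map a [0..<Suc n]). e z n)" for a
      using V_e[OF \<phi>[of a "Suc n"]] \<phi>[of a "Suc n"] unfolding V_def pre_def by blast
    then have "{a. e (\<phi> a) n} = {a. \<forall>z\<in>P (Suc n) (map a [0..<Suc n]). e z n}" by (simp only:)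
    then show "clopen {a. e (\<phi> a) n}"
      using clopen_prefix[of "\<lambda>l. \<forall>z\<in>P (Suc n) l. e z n" "Suc n"] by (simp only:)
  qed
  then have "continuous_on UNIV (\<lambda>a. e' (e (\<phi> a)))"
    by (rule continuous_on_compose2[OF continuous_e(2)]) simp
  then have "continuous_on UNIV \<phi>" by simp
  moreover have "inj \<phi>" using indep[OF id_mem] by (intro injI) simp
  moreover have "range \<phi> \<subseteq> b" using \<phi>[of _ 0] V_b by blast
  moreover have "\<forall>\<gamma>\<in>\<Gamma>. \<forall>a. \<gamma> (\<phi> a) \<notin> K"
  proof (intro ballI allI)
    fix \<gamma> a assume "\<gamma> \<in> \<Gamma>"
    then obtain n where "\<gamma> \<in> S n" using S(5) by blast
    then show "\<gamma> (\<phi> a) \<notin> K" by (rule V_K[OF \<phi>])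
  qed
  moreover have "\<forall>\<gamma>\<in>\<Gamma>. \<forall>a a'. \<gamma> (\<phi> a) = \<phi> a' \<longrightarrow> a = a'"
    using indep by (intro ballI allI impI)
  ultimately show thesis by (rule that)
qed

end

section \<open>Absorption\<close>

lemma orbit_relI: "\<gamma> \<in> \<Gamma> \<Longrightarrow> \<gamma> x = y \<Longrightarrow> (x, y) \<in> orbit_rel \<Gamma>"
  by (auto simp: orbit_rel_def)

lemma orbit_relE: "(x, y) \<in> orbit_rel \<Gamma> \<Longrightarrow> (\<And>\<gamma>. \<gamma> \<in> \<Gamma> \<Longrightarrow> \<gamma> x = y \<Longrightarrow> P) \<Longrightarrow> P"
  by (auto simp: orbit_rel_def)

lemma orbit_rel_conjugate:
  assumes "bij g"
  shows "(x, y) \<in> orbit_rel ((\<lambda>\<gamma>. inv g \<circ> (\<gamma> \<circ> g)) ` \<Gamma>) \<longleftrightarrow> (g x, g y) \<in> orbit_rel \<Gamma>"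
proof -
  have "inv g (\<gamma> (g x)) = y \<longleftrightarrow> \<gamma> (g x) = g y" for \<gamma>
    using assms by (metis bij_inv_eq_iff)
  then show ?thesis by (auto simp: orbit_rel_def)
qed

lemma continuous_case_nat: "continuous_on UNIV (case_nat b :: (nat \<Rightarrow> bool) \<Rightarrow> nat \<Rightarrow> bool)"
proof (rule continuous_on_into_fun_bool)
  show "clopen {a. case_nat b a i}" for i
    using clopen_coordinate by (cases i; cases b) simp_all
qed

context ample_action
begin

lemma orbit_rel_refl: "(x, x) \<in> orbit_rel \<Gamma>"
  using id_mem by (rule orbit_relI) simp

lemma orbit_rel_sym: "(x, y) \<in> orbit_rel \<Gamma> \<Longrightarrow> (y, x) \<in> orbit_rel \<Gamma>"
  by (elim orbit_relE, rule orbit_relI[OF inv_mem]) auto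

lemma orbit_rel_trans: "(x, y) \<in> orbit_rel \<Gamma> \<Longrightarrow> (y, z) \<in> orbit_rel \<Gamma> \<Longrightarrow> (x, z) \<in> orbit_rel \<Gamma>"
proof (elim orbit_relE)
  fix \<gamma> \<delta> assume "\<gamma> \<in> \<Gamma>" "\<gamma> x = y" "\<delta> \<in> \<Gamma>" "\<delta> y = z"
  then show "(x, z) \<in> orbit_rel \<Gamma>"
    by (intro orbit_relI[of "\<delta> \<circ> \<gamma>"]) (simp_all add: comp_mem)
qed

lemma sparse_subset: "sparse M \<Longrightarrow> closed L \<Longrightarrow> L \<subseteq> M \<Longrightarrow> sparse L"
  unfolding sparse_def by blast

lemma sparseD: "sparse M \<Longrightarrow> x \<in> M \<Longrightarrow> y \<in> M \<Longrightarrow> (x, y) \<in> orbit_rel \<Gamma> \<Longrightarrow> x = y"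
proof (elim orbit_relE)
  fix \<gamma> assume "sparse M" "x \<in> M" "y \<in> M" "\<gamma> \<in> \<Gamma>" "\<gamma> x = y"
  then have "\<gamma> x = x" unfolding sparse_def by blast
  then show "x = y" using \<open>\<gamma> x = y\<close> by simp
qed

lemma ample_conjugate:
  assumes g: "g \<in> Homeo UNIV"
  shows "ample ((\<lambda>\<gamma>. inv g \<circ> (\<gamma> \<circ> g)) ` \<Gamma>)"
proof -
  let ?c = "\<lambda>\<gamma>. inv g \<circ> (\<gamma> \<circ> g)"
  have bg: "bij g" and cg: "continuous_on UNIV g" "continuous_on UNIV (inv g)"
    using g by (simp_all add: Homeo_UNIV_iff)
  have ginv: "inv g (g x) = x" "g (inv g x) = x" for x
    using bg by (simp_all add: bij_is_inj bij_is_surj surj_f_inv_f)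
  have comp: "continuous_on UNIV (a \<circ> b)" if "continuous_on UNIV a" "continuous_on UNIV b" for a b :: "'a \<Rightarrow> 'a"
    using that continuous_on_compose[of UNIV b a] continuous_on_subset[of UNIV a "range b"] by simp
  have H_comp: "a \<circ> b \<in> Homeo UNIV" if "a \<in> Homeo UNIV" "b \<in> Homeo UNIV" for a b :: "'a \<Rightarrow> 'a"
    using that comp[of a b] comp[of "inv b" "inv a"]
    by (simp add: Homeo_UNIV_iff bij_comp o_inv_distrib)
  have H_inv: "inv g \<in> Homeo UNIV"
    using bg cg by (simp add: Homeo_UNIV_iff bij_imp_bij_inv inv_inv_eq)
  have sub: "?c ` \<Gamma> \<subseteq> Homeo UNIV"
    using H_comp[OF H_inv H_comp[OF _ g]] sub_Homeo by blast
  have grp: "perm_group (?c ` \<Gamma>)" using perm_group bg by (rule perm_group_conjugate)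
  have "\<exists>S. finite S \<and> A \<subseteq> S \<and> S \<subseteq> ?c ` \<Gamma> \<and> perm_group S" if A: "finite A" "A \<subseteq> ?c ` \<Gamma>" for A
  proof -
    obtain A' where A': "A' \<subseteq> \<Gamma>" "finite A'" "A = ?c ` A'"
      using finite_subset_image[OF A] by blast
    obtain S where S: "finite S" "A' \<subseteq> S" "S \<subseteq> \<Gamma>" "perm_group S"
      by (rule finite_subgroup[OF A'(2,1)])
    show ?thesis
      using S A'(3) perm_group_conjugate[OF S(4) bg] by (intro exI[of _ "?c ` S"]) auto
  qed
  then have lf: "locally_finite_group homeo_group (?c ` \<Gamma>)"
    using sub grp unfolding locally_finite_homeo_group_iff by blast
  have fixed_clopen: "clopen {x. a x = x}" if a: "a \<in> ?c ` \<Gamma>" for a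
  proof -
    obtain \<gamma> where \<gamma>: "\<gamma> \<in> \<Gamma>" "a = ?c \<gamma>" using a by blast
    have "a x = x \<longleftrightarrow> \<gamma> (g x) = g x" for x
      unfolding \<gamma>(2) comp_apply using bg by (metis bij_inv_eq_iff)
    then have "{x. a x = x} = g -` {y. \<gamma> y = y}" by auto
    then show ?thesis using clopen_vimage[OF cg(1) clopen_fix[OF \<gamma>(1)]] by simp
  qed
  \<comment> \<open>Conjugation by g in the opposite direction takes a map pieced together from the
    conjugated group to one pieced together from \<Gamma>, where fullness is available.\<close>
  have full: "f \<in> ?c ` \<Gamma>" if f: "f \<in> Homeo UNIV" and A: "finite A" "A \<subseteq> ?c ` \<Gamma>" "\<forall>x. \<exists>a\<in>A. f x = a x" for f A
  proof -
    let ?f = "g \<circ> (f \<circ> inv g)"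
    obtain A' where A': "A' \<subseteq> \<Gamma>" "finite A'" "A = ?c ` A'"
      using finite_subset_image[OF A(1,2)] by blast
    have "\<exists>\<gamma>\<in>A'. ?f x = \<gamma> x" for x
    proof -
      obtain \<gamma> where "\<gamma> \<in> A'" "f (inv g x) = ?c \<gamma> (inv g x)" using A(3) A'(3) by blast
      then show ?thesis by (intro bexI[of _ \<gamma>]) (simp_all add: ginv)
    qed
    moreover have "?f \<in> Homeo UNIV" using H_comp[OF g H_comp[OF f H_inv]] .
    moreover have "full_group \<Gamma>" using ample by (simp add: ample_def)
    ultimately have "?f \<in> \<Gamma>" using A'(1,2) unfolding full_group_def by blast
    moreover have "f = ?c ?f" by (simp add: fun_eq_iff ginv)
    ultimately show ?thesis by (intro image_eqI[of f ?c ?f])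
  qed
  have "full_group (?c ` \<Gamma>)"
    unfolding full_group_def subgroup_homeo_group_iff
    using sub grp full by (intro conjI ballI impI) (assumption, assumption, elim exE conjE)
  moreover have "countable (?c ` \<Gamma>)" using ample by (simp add: ample_def)
  ultimately show ?thesis
    using lf fixed_clopen unfolding ample_def clopen_def by blast
qed

end

section \<open>A closed set that absorbs one more copy of \<open>K1\<close>\<close>

context minimal_ample_action
begin

text \<open>h is a shift: \<open>K1\<close> goes to the first copy, each copy to the next, and the
  limit point stays fixed. In the coding both rules prefix one bit, so continuity at the limit is
  automatic. Placing \<open>L\<close> inside a prescribed \<open>b\<close> lets the caller keep it
  away from a translate.\<close>

lemma self_absorbing_set:
  assumes K: "sparse K" and K1: "closed K1" "K1 \<subseteq> K" and b: "clopen b" "b \<noteq> {}"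
  obtains L h where "closed L" "L \<subseteq> b" "sparse (K \<union> L)" "\<And>\<gamma> l. \<gamma> \<in> \<Gamma> \<Longrightarrow> l \<in> L \<Longrightarrow> \<gamma> l \<notin> K"
    "continuous_on (K1 \<union> L) h" "inj_on h (K1 \<union> L)" "h ` (K1 \<union> L) = L"
proof -
  obtain \<phi> :: "(nat \<Rightarrow> bool) \<Rightarrow> 'a" where \<phi>: "continuous_on UNIV \<phi>" "inj \<phi>" "range \<phi> \<subseteq> b"
    "\<forall>\<gamma>\<in>\<Gamma>. \<forall>a. \<gamma> (\<phi> a) \<notin> K" "\<forall>\<gamma>\<in>\<Gamma>. \<forall>a a'. \<gamma> (\<phi> a) = \<phi> a' \<longrightarrow> a = a'"
    by (rule cantor_scheme[OF K b])
  \<comment> \<open>the words \<open>1\<dots>10k\<close> with \<open>k \<in> K1\<close>, and the limit \<open>111\<dots>\<close>\<close>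
  define Y where "Y = {a. \<forall>i. (\<forall>j<i. a j) \<and> \<not> a i \<longrightarrow> e' (\<lambda>j. a (Suc (i + j))) \<in> K1}"
  have Y_False: "case_nat False a \<in> Y \<longleftrightarrow> e' a \<in> K1" for a
  proof
    assume "case_nat False a \<in> Y"
    then have "(\<forall>j<0. case_nat False a j) \<and> \<not> case_nat False a 0 \<longrightarrow>
        e' (\<lambda>j. case_nat False a (Suc (0 + j))) \<in> K1" unfolding Y_def by blast
    then show "e' a \<in> K1" by simp
  next
    assume a: "e' a \<in> K1"
    show "case_nat False a \<in> Y"
      unfolding Y_def
    proof (intro CollectI allI impI)
      fix i :: nat assume i: "(\<forall>j<i. case_nat False a j) \<and> \<not> case_nat False a i"
      then have "i = 0" by (cases i) auto
      then show "e' (\<lambda>j. case_nat False a (Suc (i + j))) \<in> K1" using a by simp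
    qed
  qed
  have Y_True: "case_nat True a \<in> Y \<longleftrightarrow> a \<in> Y" for a
  proof
    assume a: "case_nat True a \<in> Y"
    show "a \<in> Y"
      unfolding Y_def
    proof (intro CollectI allI impI)
      fix i assume i: "(\<forall>j<i. a j) \<and> \<not> a i"
      have "\<forall>j<Suc i. case_nat True a j" using i by (auto split: nat.split)
      moreover have "\<not> case_nat True a (Suc i)" using i by simp
      ultimately have "e' (\<lambda>j. case_nat True a (Suc (Suc i + j))) \<in> K1" using a unfolding Y_def by blast
      then show "e' (\<lambda>j. a (Suc (i + j))) \<in> K1" by simp
    qed
  next
    assume a: "a \<in> Y"
    show "case_nat True a \<in> Y"
      unfolding Y_def
    proof (intro CollectI allI impI)
      fix i :: nat assume i: "(\<forall>j<i. case_nat True a j) \<and> \<not> case_nat True a i"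
      then obtain k where k: "i = Suc k" by (cases i) auto
      have "a j" if "j < k" for j using i[THEN conjunct1, rule_format, of "Suc j"] k that by simp
      moreover have "\<not> a k" using i k by simp
      ultimately have "e' (\<lambda>j. a (Suc (k + j))) \<in> K1" using a unfolding Y_def by blast
      then show "e' (\<lambda>j. case_nat True a (Suc (i + j))) \<in> K1" by (simp add: k)
    qed
  qed
  have "closed Y"
  proof -
    have "Y = (\<Inter>i. - ((\<Inter>j<i. {a. a j}) - {a. a i}) \<union> (\<lambda>a. e' (\<lambda>j. a (Suc (i + j)))) -` K1)"
      unfolding Y_def by auto
    moreover have "closed (- ((\<Inter>j<i. {a::nat \<Rightarrow> bool. a j}) - {a. a i}))" for i
    proof -
      have "clopen ((\<Inter>j<i. {a::nat \<Rightarrow> bool. a j}) - {a. a i})"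
        using clopen_coordinate by (intro clopen_Diff clopen_INT) auto
      then show ?thesis by (simp only: clopen_def closed_Compl)
    qed
    moreover have "closed ((\<lambda>a. e' (\<lambda>j. a (Suc (i + j)))) -` K1)" for i
    proof (rule closed_vimage[OF K1(1)])
      have "continuous_on UNIV (\<lambda>a::nat \<Rightarrow> bool. \<lambda>j. a (Suc (i + j)))"
        by (rule continuous_on_into_fun_bool) (rule clopen_coordinate)
      then show "continuous_on UNIV (\<lambda>a. e' (\<lambda>j. a (Suc (i + j))))"
        by (rule continuous_on_compose2[OF continuous_e(2)]) simp
    qed
    ultimately show ?thesis by (simp only:) (intro closed_INT ballI closed_Un)
  qed
  then have compY: "compact Y" using compact_Int_closed[OF compact_UNIV_fun_bool, of Y] by simp
  define L where "L = \<phi> ` Y"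
  have clL: "closed L"
    using compact_continuous_image[OF continuous_on_subset[OF \<phi>(1)] compY]
    unfolding L_def by (simp only: compact_closed_iff subset_UNIV)
  have L_K: "\<gamma> l \<notin> K" if "\<gamma> \<in> \<Gamma>" "l \<in> L" for \<gamma> l using that \<phi>(4) by (auto simp: L_def)
  obtain \<psi> where \<psi>: "homeomorphism UNIV (range \<phi>) \<phi> \<psi>"
    using compact_homeomorphism[OF compact_UNIV_fun_bool \<phi>(1,2)] by blast
  have \<psi>\<phi> [simp]: "\<psi> (\<phi> a) = a" for a using \<psi> by (simp add: homeomorphism_def)
  have cont\<psi>: "continuous_on L \<psi>"
    using \<psi> continuous_on_subset[of "range \<phi>" \<psi> L] by (auto simp: homeomorphism_def L_def)
  define f where "f x = \<phi> (case_nat False (e x))" for x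
  define g where "g x = \<phi> (case_nat True (\<psi> x))" for x
  define h where "h x = (if x \<in> K1 then f x else g x)" for x
  \<comment> \<open>\<open>K1\<close> and \<open>L\<close> are disjoint closed sets, so a definition
    by cases on them remains continuous.\<close>
  have disj: "x \<notin> K1" if "x \<in> L" for x using L_K[OF id_mem that] K1(2) by auto
  have step: "continuous_on S (\<lambda>x. \<phi> (case_nat b (u x)))" if "continuous_on S u" for S and u :: "'a \<Rightarrow> nat \<Rightarrow> bool" and b
  proof (rule continuous_on_compose2[OF \<phi>(1)])
    show "continuous_on S (\<lambda>x. case_nat b (u x))"
      by (rule continuous_on_compose2[OF continuous_case_nat that]) simp
  qed simp
  have "continuous_on K1 f" unfolding f_def
    by (rule step) (rule continuous_on_subset[OF continuous_e(1)], simp)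
  moreover have "continuous_on L g" unfolding g_def using cont\<psi> by (rule step)
  ultimately have cont: "continuous_on (K1 \<union> L) h"
    unfolding h_def using disj by (intro continuous_on_cases K1(1) clL) auto
  have hK: "h x = \<phi> (case_nat False (e x))" if "x \<in> K1" for x using that by (simp add: h_def f_def)
  have hL: "h (\<phi> a) = \<phi> (case_nat True a)" if "a \<in> Y" for a
    using disj[of "\<phi> a"] that by (simp add: h_def g_def L_def)
  have \<phi>_eq: "\<phi> a = \<phi> a' \<longleftrightarrow> a = a'" for a a' using \<phi>(2) by (simp add: inj_eq)
  have case_eq: "case_nat c a = case_nat c' a' \<longleftrightarrow> c = c' \<and> a = a'" for c c' and a a' :: "nat \<Rightarrow> bool"
  proof
    assume eq: "case_nat c a = case_nat c' a'"
    have "a i = a' i" for i using fun_cong[OF eq, of "Suc i"] by simp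
    then show "c = c' \<and> a = a'" using fun_cong[OF eq, of 0] by auto
  qed simp
  have inj: "inj_on h (K1 \<union> L)"
  proof (rule inj_onI)
    fix x y assume xy: "x \<in> K1 \<union> L" "y \<in> K1 \<union> L" "h x = h y"
    have e_eq: "e x = e y \<Longrightarrow> x = y" by (metis e_inverse(1))
    from xy(1,2) show "x = y"
    proof (elim UnE)
      assume "x \<in> K1" "y \<in> K1" then show ?thesis using xy(3) e_eq by (simp add: hK \<phi>_eq case_eq)
    next
      assume "x \<in> K1" "y \<in> L" then show ?thesis using xy(3) by (auto simp: hK hL L_def \<phi>_eq case_eq)
    next
      assume "x \<in> L" "y \<in> K1" then show ?thesis using xy(3) by (auto simp: hK hL L_def \<phi>_eq case_eq)
    next
      assume "x \<in> L" "y \<in> L" then show ?thesis using xy(3) by (auto simp: hL L_def \<phi>_eq case_eq)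
    qed
  qed
  have img: "h ` (K1 \<union> L) = L"
  proof
    show "h ` (K1 \<union> L) \<subseteq> L"
      using Y_False Y_True by (auto simp: hK hL L_def)
    show "L \<subseteq> h ` (K1 \<union> L)"
    proof
      fix y assume "y \<in> L"
      then obtain a where a: "a \<in> Y" "y = \<phi> a" by (auto simp: L_def)
      define a' where "a' i = a (Suc i)" for i
      have aa: "a = case_nat (a 0) a'" 
      proof (rule ext)
        show "a i = case_nat (a 0) a' i" for i by (cases i) (simp_all add: a'_def)
      qed
      show "y \<in> h ` (K1 \<union> L)"
      proof (cases "a 0")
        case True
        then have "a = case_nat True a'" using aa by simp
        then have "a' \<in> Y" "y = h (\<phi> a')" using a Y_True hL by auto
        then show ?thesis by (auto simp: L_def)
      next
        case False
        then have "a = case_nat False a'" using aa by simp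
        then have "e' a' \<in> K1" "y = h (e' a')" using a Y_False hK by auto
        then show ?thesis by blast
      qed
    qed
  qed
  have "sparse (K \<union> L)"
    unfolding sparse_def
  proof (intro conjI ballI impI)
    show "closed (K \<union> L)" using sparse_closed[OF K] clL by (rule closed_Un)
    fix x \<gamma> assume x: "x \<in> K \<union> L" and \<gamma>: "\<gamma> \<in> \<Gamma>" and \<gamma>x: "\<gamma> x \<in> K \<union> L"
    from x \<gamma>x show "\<gamma> x = x"
    proof (elim UnE)
      assume "x \<in> K" "\<gamma> x \<in> K" then show ?thesis using K \<gamma> unfolding sparse_def by blast
    next
      assume "x \<in> K" "\<gamma> x \<in> L" then show ?thesis using L_K[OF inv_mem[OF \<gamma>], of "\<gamma> x"] \<gamma> by simp
    next
      assume "x \<in> L" "\<gamma> x \<in> K" then show ?thesis using L_K[OF \<gamma>] by blast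
    next
      assume "x \<in> L" "\<gamma> x \<in> L"
      then obtain a a' where a: "x = \<phi> a" "\<gamma> x = \<phi> a'" by (auto simp: L_def)
      then have "a = a'" using \<phi>(5) \<gamma> by blast
      then show ?thesis using a by simp
    qed
  qed
  moreover have "L \<subseteq> b" using \<phi>(3) by (auto simp: L_def)
  ultimately show thesis using that clL L_K cont inj img by blast
qed

end

section \<open>Conjugating the joined relation onto the orbit relation\<close>

context minimal_ample_action
begin

text \<open>Each relation is generated by the \<Delta>-orbits together with a family of pairs: (k,
  \<sigma> k) and (l, \<tau> l) on one side, (l, \<tau> l) alone on the other. The map g respects
  the \<Delta>-orbits in both directions and carries the first family of pairs onto the
  second.\<close>

lemma absorption:
  assumes K: "sparse K" and K1: "closed K1" and \<sigma>: "continuous_on K \<sigma>" "\<And>k. k \<in> K \<Longrightarrow> \<sigma> (\<sigma> k) = k"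
    and K_eq: "K = K1 \<union> \<sigma> ` K1" "K1 \<inter> \<sigma> ` K1 = {}"
  shows "\<exists>g\<in>Homeo UNIV. \<forall>x y. (x, y) \<in> joined_rel \<Gamma> K \<sigma> \<longleftrightarrow> (g x, g y) \<in> orbit_rel \<Gamma>"
proof -
  have K1K: "K1 \<subseteq> K" and \<sigma>K1: "\<sigma> ` K1 \<subseteq> K" using K_eq(1) by auto
  have "\<exists>\<gamma>\<in>\<Gamma>. \<gamma> x \<in> UNIV - {x}" for x
  proof (rule orbit_meets_open)
    show "open (UNIV - {x})" using open_Compl_finite[of "{x}"] by (simp add: Compl_eq_Diff_UNIV)
    show "UNIV - {x} \<noteq> {}" by (rule open_diff_finite_nonempty) simp_all
  qed
  then obtain \<tau> p where \<tau>: "\<tau> \<in> \<Gamma>" "\<tau> p \<noteq> p" by blast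
  obtain n where n: "\<tau> p \<notin> cyl p n"
    using separation[of "\<tau> p" p] \<tau>(2) unfolding cyl_def by blast
  \<comment> \<open>A neighbourhood of p disjoint from its image under \<tau>. For \<open>L\<close>
    inside it, \<tau> fixes no point of \<open>L\<close> and \<tau>(L) is disjoint from
    \<open>L\<close>.\<close>
  define b where "b = cyl p n \<inter> {z. \<tau> z \<notin> cyl p n}"
  have "clopen b"
    unfolding b_def using clopen_cyl clopen_mem_vimage[OF \<tau>(1) clopen_Compl[OF clopen_cyl[of p n]]]
    by (intro clopen_Int) simp_all
  moreover have "p \<in> b" using n by (simp add: b_def)
  ultimately obtain L h1 where L: "closed L" "L \<subseteq> b" "sparse (K \<union> L)" "\<And>\<gamma> l. \<gamma> \<in> \<Gamma> \<Longrightarrow> l \<in> L \<Longrightarrow> \<gamma> l \<notin> K"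
    and h1: "continuous_on (K1 \<union> L) h1" "inj_on h1 (K1 \<union> L)" "h1 ` (K1 \<union> L) = L"
    using self_absorbing_set[OF K K1 K1K, of b] by blast
  have \<tau>_b: "\<tau> z \<notin> b" if "z \<in> b" for z using that by (auto simp: b_def)
  have \<tau>L: "\<tau> l \<noteq> l" if "l \<in> L" for l using that L(2) \<tau>_b[of l] by auto
  have sL: "sparse L" using sparse_subset[OF L(3,1)] by blast
  obtain \<Delta> where \<Delta>: "ample \<Delta>" "acts_minimally \<Delta>" "\<Delta> \<subseteq> \<Gamma>"
    and split': "\<forall>x y. (x, y) \<in> orbit_rel \<Gamma> \<longrightarrow> (x, y) \<in> orbit_rel \<Delta> \<or>
      (\<exists>l\<in>L. (x, l) \<in> orbit_rel \<Delta> \<and> (\<tau> l, y) \<in> orbit_rel \<Delta>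
        \<or> (x, \<tau> l) \<in> orbit_rel \<Delta> \<and> (l, y) \<in> orbit_rel \<Delta>)"
    and l\<tau>l': "\<forall>l\<in>L. (l, \<tau> l) \<notin> orbit_rel \<Delta>"
    by (rule splitting[OF sL \<tau>(1) \<tau>L])
  note split = split'[rule_format] and l\<tau>l = bspec[OF l\<tau>l']
  interpret D: minimal_ample_action e e' \<Delta>
    using \<Delta>(1,2) by unfold_locales
  have sub: "(x, y) \<in> orbit_rel \<Gamma>" if "(x, y) \<in> orbit_rel \<Delta>" for x y
    using that \<Delta>(3) unfolding orbit_rel_def by blast
  have \<tau>_rel: "(x, \<tau> x) \<in> orbit_rel \<Gamma>" for x using orbit_relI[OF \<tau>(1) refl] .
  \<comment> \<open>M1 holds the first members of all pairs and M2 the second ones; \<rho> leads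
    from a second member to its partner.\<close>
  define M1 M2 where "M1 = K1 \<union> L" and "M2 = \<sigma> ` K1 \<union> \<tau> ` L"
  define \<rho> where "\<rho> x = (if x \<in> K then \<sigma> x else inv \<tau> x)" for x
  have cl\<sigma>: "closed (\<sigma> ` K1)" using closed_image[OF K1 continuous_on_subset[OF \<sigma>(1) K1K]] .
  have cl\<tau>: "closed (\<tau> ` L)" using closed_mem_image[OF \<tau>(1) L(1)] .
  have \<tau>L_K: "\<tau> l \<notin> K" if "l \<in> L" for l using L(4)[OF \<tau>(1) that] .
  have L_K: "l \<notin> K" if "l \<in> L" for l using L(4)[OF id_mem that] by simp
  have \<tau>L_L: "\<tau> l \<notin> L" if "l \<in> L" for l using \<tau>_b that L(2) by blast
  have disj: "M1 \<inter> M2 = {}"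
    unfolding M1_def M2_def using K_eq(2) K1K \<sigma>K1 \<tau>L_K L_K \<tau>L_L by blast
  have \<rho>_\<sigma>: "\<rho> (\<sigma> k) = k" if "k \<in> K1" for k using that \<sigma>K1 K1K \<sigma>(2) by (auto simp: \<rho>_def)
  have \<rho>_\<tau>: "\<rho> (\<tau> l) = l" if "l \<in> L" for l using that \<tau>L_K \<tau>(1) by (simp add: \<rho>_def)
  have \<rho>M2: "\<rho> ` M2 = M1"
    unfolding M1_def M2_def image_Un image_image using \<rho>_\<sigma> \<rho>_\<tau> by simp
  have \<rho>_inj: "inj_on \<rho> M2"
    by (rule inj_on_inverseI[of _ "\<lambda>x. if x \<in> K1 then \<sigma> x else \<tau> x"])
      (use \<rho>_\<sigma> \<rho>_\<tau> L_K K1K in \<open>auto simp: M2_def\<close>)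
  have \<rho>_cont: "continuous_on M2 \<rho>"
    unfolding M2_def \<rho>_def
    using continuous_on_subset[OF \<sigma>(1) \<sigma>K1] continuous_on_subset[OF continuous_mem[OF inv_mem[OF \<tau>(1)]], of "\<tau> ` L"]
    by (intro continuous_on_cases cl\<sigma> cl\<tau>) (use \<sigma>K1 \<tau>L_K in auto)
  have clM: "closed M1" "closed M2"
    using K1 L(1) cl\<sigma> cl\<tau> by (simp_all add: M1_def M2_def closed_Un)
  have M_eq: "M1 \<union> M2 = K \<union> L \<union> \<tau> ` L" using K_eq(1) by (auto simp: M1_def M2_def)
  \<comment> \<open>Free on first members, where the shift \<open>h1\<close> is used; on second
    members forced by the requirement that each pair go to some pair (l, \<tau> l).\<close>
  define h where "h x = (if x \<in> M1 then h1 x else \<tau> (h1 (\<rho> x)))" for x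
  have h1L: "h1 x \<in> L" if "x \<in> M1" for x using that h1(3) by (auto simp: M1_def)
  have h_M1: "h x = h1 x" if "x \<in> M1" for x using that by (simp add: h_def)
  have h_M2: "h x = \<tau> (h1 (\<rho> x))" if "x \<in> M2" for x using that disj by (auto simp: h_def)
  have h_\<sigma>: "h (\<sigma> k) = \<tau> (h k)" if "k \<in> K1" for k
    using that \<rho>_\<sigma>[OF that] by (simp add: h_M1 h_M2 M1_def M2_def)
  have h_\<tau>: "h (\<tau> l) = \<tau> (h l)" if "l \<in> L" for l
    using that \<rho>_\<tau>[OF that] by (simp add: h_M1 h_M2 M1_def M2_def)
  have "continuous_on M2 (\<lambda>x. \<tau> (h1 (\<rho> x)))"
  proof (rule continuous_on_compose2[OF continuous_mem[OF \<tau>(1)]])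
    show "continuous_on M2 (\<lambda>x. h1 (\<rho> x))"
      by (rule continuous_on_compose2[OF _ \<rho>_cont, of M1]) (use h1(1) \<rho>M2 in \<open>simp_all add: M1_def\<close>)
  qed simp
  then have h_cont: "continuous_on (M1 \<union> M2) h"
    unfolding h_def using h1(1) disj by (intro continuous_on_cases clM) (auto simp: M1_def)
  have h_img: "h ` (M1 \<union> M2) = L \<union> \<tau> ` L"
  proof -
    have "h ` M1 = L" using h_M1 h1(3) by (simp add: M1_def)
    moreover have "h ` M2 = \<tau> ` h1 ` \<rho> ` M2" using h_M2 by (simp add: image_image)
    moreover have "h1 ` M1 = L" using h1(3) by (simp only: M1_def)
    ultimately show ?thesis by (simp only: \<rho>M2 image_Un)
  qed
  have h_inj: "inj_on h (M1 \<union> M2)"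
  proof (rule inj_onI)
    fix x y assume xy: "x \<in> M1 \<union> M2" "y \<in> M1 \<union> M2" "h x = h y"
    have \<rho>x: "\<rho> x \<in> M1" if "x \<in> M2" for x using that \<rho>M2 by blast
    from xy(1,2) show "x = y"
    proof (elim UnE)
      assume "x \<in> M1" "y \<in> M1"
      then show ?thesis using xy(3) h1(2) by (simp add: h_M1 inj_on_def M1_def)
    next
      assume "x \<in> M1" "y \<in> M2"
      then show ?thesis using xy(3) h1L \<rho>x \<tau>L_L by (metis h_M1 h_M2)
    next
      assume "x \<in> M2" "y \<in> M1"
      then show ?thesis using xy(3) h1L \<rho>x \<tau>L_L by (metis h_M1 h_M2)
    next
      assume x: "x \<in> M2" "y \<in> M2"
      then have "h1 (\<rho> x) = h1 (\<rho> y)" using xy(3) \<tau>(1) by (simp add: h_M2 mem_eq_iff)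
      then have "\<rho> x = \<rho> y" using h1(2) \<rho>x x unfolding inj_on_def M1_def by blast
      then show ?thesis using \<rho>_inj x unfolding inj_on_def by blast
    qed
  qed
  obtain h' where h': "homeomorphism (M1 \<union> M2) (L \<union> \<tau> ` L) h h'"
    using compact_homeomorphism[OF compact_closed[OF closed_Un[OF clM]] h_cont h_inj] h_img by auto
  \<comment> \<open>K and L together are already sparse for \<Gamma>. Adding \<tau>(L) creates only
    the coincidences of l with \<tau> l, and \<open>l\<tau>l\<close> says that \<Delta> no longer
    has them.\<close>
  have sM: "D.sparse (K \<union> L \<union> \<tau> ` L)"
  proof -
    have "x = y" if x: "x \<in> K \<union> L \<union> \<tau> ` L" and y: "y \<in> K \<union> L \<union> \<tau> ` L" and xy: "(x, y) \<in> orbit_rel \<Delta>" for x y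
    proof -
      have main: "x = y" if "x \<in> K \<union> L" "y \<in> \<tau> ` L" "(x, y) \<in> orbit_rel \<Delta>" for x y
      proof -
        obtain l where l: "l \<in> L" "y = \<tau> l" using \<open>y \<in> \<tau> ` L\<close> by blast
        have "(x, l) \<in> orbit_rel \<Gamma>"
          using sub[OF \<open>(x, y) \<in> orbit_rel \<Delta>\<close>] orbit_rel_sym[OF \<tau>_rel[of l]] orbit_rel_trans l(2) by blast
        then have "x = l" using sparseD[OF L(3)] \<open>x \<in> K \<union> L\<close> l(1) by blast
        then show ?thesis using l\<tau>l[OF l(1)] \<open>(x, y) \<in> orbit_rel \<Delta>\<close> l(2) by simp
      qed
      consider "x \<in> K \<union> L" "y \<in> K \<union> L" | "x \<in> K \<union> L" "y \<in> \<tau> ` L" | "x \<in> \<tau> ` L" "y \<in> K \<union> L"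
        | "x \<in> \<tau> ` L" "y \<in> \<tau> ` L"
        using x y by blast
      then show ?thesis
      proof cases
        case 1
        then show ?thesis using sparseD[OF L(3) _ _ sub[OF xy]] by blast
      next
        case 2
        then show ?thesis using main xy by blast
      next
        case 3
        then show ?thesis using main[of y x] D.orbit_rel_sym[OF xy] by simp
      next
        case 4
        then obtain l l' where l: "l \<in> L" "x = \<tau> l" "l' \<in> L" "y = \<tau> l'" by blast
        have "(l, l') \<in> orbit_rel \<Gamma>"
          using orbit_rel_trans[OF \<tau>_rel[of l]] orbit_rel_trans[OF sub[OF xy]] orbit_rel_sym[OF \<tau>_rel[of l']] l
          by simp
        then show ?thesis using sparseD[OF sL l(1,3)] l by simp
      qed
    qed
    then have "\<gamma> x = x" if "x \<in> K \<union> L \<union> \<tau> ` L" "\<gamma> \<in> \<Delta>" "\<gamma> x \<in> K \<union> L \<union> \<tau> ` L" for x \<gamma>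
      using that orbit_relI[OF that(2) refl] by metis
    moreover have "closed (K \<union> L \<union> \<tau> ` L)"
      using sparse_closed[OF K] L(1) cl\<tau> by (intro closed_Un)
    ultimately show ?thesis unfolding D.sparse_def by blast
  qed
  have sM': "D.sparse (L \<union> \<tau> ` L)"
    by (rule D.sparse_subset[OF sM]) (use L(1) cl\<tau> in \<open>auto intro: closed_Un\<close>)
  have sM12: "D.sparse (M1 \<union> M2)" using sM by (simp only: M_eq)
  obtain g where g: "g \<in> Homeo UNIV" "\<forall>x\<in>M1 \<union> M2. g x = h x"
      "\<forall>\<gamma>\<in>\<Delta>. inv g \<circ> (\<gamma> \<circ> g) \<in> \<Delta> \<and> g \<circ> (\<gamma> \<circ> inv g) \<in> \<Delta>"
    using D.extension_exists[OF h' sM12 sM'] by (elim bexE conjE)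
  have ginv: "inv g (g x) = x" "g (inv g x) = x" for x
    using g(1) by (simp_all add: Homeo_UNIV_iff bij_is_inj bij_is_surj surj_f_inv_f)
  have g_rel: "(g x, g y) \<in> orbit_rel \<Delta> \<longleftrightarrow> (x, y) \<in> orbit_rel \<Delta>" for x y
  proof
    assume "(g x, g y) \<in> orbit_rel \<Delta>"
    then obtain \<gamma> where \<gamma>: "\<gamma> \<in> \<Delta>" "\<gamma> (g x) = g y" by (rule orbit_relE)
    have "(inv g \<circ> (\<gamma> \<circ> g)) x = y" by (simp add: \<gamma>(2) ginv)
    then show "(x, y) \<in> orbit_rel \<Delta>"
      using g(3) \<gamma>(1) by (intro orbit_relI[of "inv g \<circ> (\<gamma> \<circ> g)"]) simp_all
  next
    assume "(x, y) \<in> orbit_rel \<Delta>"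
    then obtain \<gamma> where \<gamma>: "\<gamma> \<in> \<Delta>" "\<gamma> x = y" by (rule orbit_relE)
    have "(g \<circ> (\<gamma> \<circ> inv g)) (g x) = g y" by (simp add: \<gamma>(2) ginv)
    then show "(g x, g y) \<in> orbit_rel \<Delta>"
      using g(3) \<gamma>(1) by (intro orbit_relI[of "g \<circ> (\<gamma> \<circ> inv g)"]) simp_all
  qed
  \<comment> \<open>The pullback of the orbit relation along g. One inclusion follows from
    minimality of the joined relation once E contains its generators; the other traces a
    \<Gamma>-related pair through \<open>split\<close>.\<close>
  define E where "E = {(x, y). (g x, g y) \<in> orbit_rel \<Gamma>}"
  have E_equiv: "equiv UNIV E"
    unfolding E_def using orbit_rel_refl orbit_rel_sym orbit_rel_trans
    by (intro equivI refl_onI symI transI) blast+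
  have E_orbit: "orbit_rel \<Gamma> \<subseteq> E"
  proof
    fix q assume "q \<in> orbit_rel \<Gamma>"
    moreover obtain x y where q: "q = (x, y)" by (cases q)
    ultimately have "(x, y) \<in> orbit_rel \<Gamma>" by simp
    have gl: "(g l, g (\<tau> l)) \<in> orbit_rel \<Gamma>" if "l \<in> L" for l
      using g(2) h_\<tau>[OF that] \<tau>_rel[of "h l"] that by (simp add: M1_def M2_def)
    have gD: "(g a, g b) \<in> orbit_rel \<Gamma>" if "(a, b) \<in> orbit_rel \<Delta>" for a b
      using that g_rel sub by blast
    from split[OF \<open>(x, y) \<in> orbit_rel \<Gamma>\<close>] have "(g x, g y) \<in> orbit_rel \<Gamma>"
    proof (elim disjE bexE conjE)
      assume "(x, y) \<in> orbit_rel \<Delta>" then show ?thesis by (rule gD)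
    next
      fix l assume "l \<in> L" "(x, l) \<in> orbit_rel \<Delta>" "(\<tau> l, y) \<in> orbit_rel \<Delta>"
      then show ?thesis using gD gl orbit_rel_trans by meson
    next
      fix l assume "l \<in> L" "(x, \<tau> l) \<in> orbit_rel \<Delta>" "(l, y) \<in> orbit_rel \<Delta>"
      then show ?thesis using gD orbit_rel_sym[OF gl] orbit_rel_trans by meson
    qed
    then show "q \<in> E" by (simp add: q E_def)
  qed
  have gk: "(g k, g (\<sigma> k)) \<in> orbit_rel \<Gamma>" if "k \<in> K1" for k
    using g(2) h_\<sigma>[OF that] \<tau>_rel[of "h k"] that by (simp add: M1_def M2_def)
  have E_\<sigma>: "(k, \<sigma> k) \<in> E" if "k \<in> K" for k
  proof (cases "k \<in> K1")
    case True
    then show ?thesis using gk by (simp add: E_def)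
  next
    case False
    then obtain k' where k': "k' \<in> K1" "k = \<sigma> k'" using \<open>k \<in> K\<close> K_eq(1) by blast
    then have "\<sigma> k = k'" using \<sigma>(2) K1K by blast
    then show ?thesis using orbit_rel_sym[OF gk[OF k'(1)]] k'(2) by (simp add: E_def)
  qed
  have J_sub: "joined_rel \<Gamma> K \<sigma> \<subseteq> E"
    by (rule joined_rel_finest(4)[OF E_equiv E_orbit E_\<sigma>])
  let ?J = "joined_rel \<Gamma> K \<sigma>"
  have J: "sym ?J" "trans ?J"
    by (rule equivE[OF joined_rel_finest(1)], assumption)+
  have J_sym: "(y, x) \<in> ?J" if "(x, y) \<in> ?J" for x y
    using J(1) that by (rule symD)
  have J_trans: "(x, z) \<in> ?J" if "(x, y) \<in> ?J" "(y, z) \<in> ?J" for x y z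
    using J(2) that by (rule transD)
  have J_orbit: "(x, y) \<in> ?J" if "(x, y) \<in> orbit_rel \<Gamma>" for x y
    using joined_rel_finest(2) that by (rule subsetD)
  have E_sub: "(x, y) \<in> ?J" if xy: "(g x, g y) \<in> orbit_rel \<Gamma>" for x y
  proof -
    \<comment> \<open>Every target pair (l, \<tau> l) comes from a joined pair: from (m, \<sigma> m)
      if the preimage m of l lies in \<open>K1\<close>, and from (m, \<tau> m) if it lies in
      \<open>L\<close>.\<close>
    have link: "\<exists>m m'. g m = l \<and> g m' = \<tau> l \<and> (m, m') \<in> ?J" if l: "l \<in> L" for l
    proof -
      obtain m where m: "m \<in> M1" "l = h1 m" using l h1(3) by (auto simp: M1_def)
      then have gm: "g m = l" using g(2) h_M1 by simp
      show ?thesis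
      proof (cases "m \<in> K1")
        case True
        then have "g (\<sigma> m) = \<tau> l" using g(2) h_\<sigma>[OF True] h_M1 m by (simp add: M2_def)
        moreover have "(m, \<sigma> m) \<in> ?J" using subsetD[OF K1K True] by (rule joined_rel_finest(3))
        ultimately show ?thesis using gm by blast
      next
        case False
        then have mL: "m \<in> L" using m(1) by (simp add: M1_def)
        then have "g (\<tau> m) = \<tau> l" using g(2) h_\<tau>[OF mL] h_M1 m by (simp add: M2_def)
        then show ?thesis using gm J_orbit[OF \<tau>_rel[of m]] by blast
      qed
    qed
    have gD: "(a, b) \<in> ?J" if "(g a, g b) \<in> orbit_rel \<Delta>" for a b
      using that g_rel sub J_orbit by blast
    from split[OF xy] show ?thesis
    proof (elim disjE bexE conjE)
      assume "(g x, g y) \<in> orbit_rel \<Delta>" then show ?thesis by (rule gD)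
    next
      fix l assume l: "l \<in> L" "(g x, l) \<in> orbit_rel \<Delta>" "(\<tau> l, g y) \<in> orbit_rel \<Delta>"
      obtain m m' where m: "g m = l" "g m' = \<tau> l" "(m, m') \<in> ?J" using link[OF l(1)] by blast
      then have "(x, m) \<in> ?J" "(m', y) \<in> ?J" using l(2,3) gD by simp_all
      then show ?thesis using J_trans m(3) by meson
    next
      fix l assume l: "l \<in> L" "(g x, \<tau> l) \<in> orbit_rel \<Delta>" "(l, g y) \<in> orbit_rel \<Delta>"
      obtain m m' where m: "g m = l" "g m' = \<tau> l" "(m, m') \<in> ?J" using link[OF l(1)] by blast
      then have "(x, m') \<in> ?J" "(m, y) \<in> ?J" using l(2,3) gD by simp_all
      then show ?thesis using J_trans J_sym[OF m(3)] by meson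
    qed
  qed
  show ?thesis
  proof (intro bexI[OF _ g(1)] allI)
    fix x y
    show "(x, y) \<in> ?J \<longleftrightarrow> (g x, g y) \<in> orbit_rel \<Gamma>"
      using J_sub E_sub by (auto simp: E_def)
  qed
qed

end

section \<open>The group inducing the joined relation\<close>

theorem theorem5p1:
  fixes \<Gamma> :: "('a::topological_space \<Rightarrow> 'a) set"
    and K K\<^sub>1 :: "'a set"
    and \<sigma> :: "'a \<Rightarrow> 'a"
  assumes cantor: "(UNIV :: 'a set) homeomorphic (UNIV :: (nat \<Rightarrow> bool) set)"
    and "ample \<Gamma>"
    and "acts_minimally \<Gamma>"
    and "closed K"
    and "\<forall>k\<in>K. \<not> k isolated_in K"
    and "closed K\<^sub>1"
    and "\<sigma> \<in> Homeo K"
    and "\<forall>k\<in>K. \<sigma> (\<sigma> k) = k"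
    and "K = K\<^sub>1 \<union> \<sigma> ` K\<^sub>1"
    and "K\<^sub>1 \<inter> \<sigma> ` K\<^sub>1 = {}"
    and "orbit_sparse \<Gamma> K"
  shows "\<exists>\<Sigma>. ample \<Sigma> \<and> orbit_rel \<Sigma> = joined_rel \<Gamma> K \<sigma> \<and> orbit_equivalent \<Sigma> \<Gamma>"
proof -
  obtain e e' where "homeomorphism (UNIV :: 'a set) (UNIV :: (nat \<Rightarrow> bool) set) e e'"
    using cantor unfolding homeomorphic_def by blast
  then interpret minimal_ample_action e e' \<Gamma>
    using assms(2,3) by unfold_locales
  have "sparse K"
    unfolding sparse_def
  proof (intro conjI ballI impI)
    show "closed K" by fact
    fix x \<gamma> assume x: "x \<in> K" and \<gamma>: "\<gamma> \<in> \<Gamma>" "\<gamma> x \<in> K"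
    have "x = id x" by simp
    then have "x \<in> orbit_of \<Gamma> x \<inter> K" "\<gamma> x \<in> orbit_of \<Gamma> x \<inter> K"
      using x \<gamma> id_mem unfolding orbit_of_def by blast+
    then show "\<gamma> x = x"
      using \<open>orbit_sparse \<Gamma> K\<close> unfolding orbit_sparse_def by blast
  qed
  moreover have "continuous_on K \<sigma>"
    using \<open>\<sigma> \<in> Homeo K\<close> by (auto simp: Homeo_def homeomorphism_def)
  ultimately obtain g where g: "g \<in> Homeo UNIV"
      "\<forall>x y. (x, y) \<in> joined_rel \<Gamma> K \<sigma> \<longleftrightarrow> (g x, g y) \<in> orbit_rel \<Gamma>"
    using absorption[of K K\<^sub>1 \<sigma>] assms(6,8-10) by blast
  \<comment> \<open>Conjugation makes the orbit relation of the new group the pullback along g. The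
    same g therefore identifies that relation with the joined one and witnesses orbit equivalence
    with \<Gamma>.\<close>
  let ?\<Sigma> = "(\<lambda>\<gamma>. inv g \<circ> (\<gamma> \<circ> g)) ` \<Gamma>"
  have rel: "(x, y) \<in> orbit_rel ?\<Sigma> \<longleftrightarrow> (g x, g y) \<in> orbit_rel \<Gamma>" for x y
    using g(1) by (intro orbit_rel_conjugate) (simp add: Homeo_UNIV_iff)
  show ?thesis
  proof (intro exI[of _ ?\<Sigma>] conjI)
    show "ample ?\<Sigma>" using g(1) by (rule ample_conjugate)
    show "orbit_rel ?\<Sigma> = joined_rel \<Gamma> K \<sigma>" using rel g(2) by auto
    show "orbit_equivalent ?\<Sigma> \<Gamma>" unfolding orbit_equivalent_def using rel g(1) by blast
  qed
qed

end
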